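(* Let $\tau>0$ and let $\ell:[0,\tau]\to(0,\infty)$ be a strictly positive, twice continuously differentiable function with $\ell'/\ell\in L_\infty(0,\tau)$ and $\ell(0)=1$. Then there exists a constant $C(\tau)$ such that for every $u_0\in H_0^1(0,1)$ the solution $u$ of $$i\,\partial_t u+\partial_x^2u=0\ \ (x\in[0,\ell(t)],\ t\in[0,\tau]),\qquad u(0,t)=u(\ell(t),t)=0,\qquad u(x,0)=u_0(x)\ \ (x\in[0,1])$$ satisfies $$\int_0^\tau |u_x(0,t)|^2+|u_x(\ell(t),t)|^2\,dt\ \le\ C(\tau)\,\|u_0\|_{H_0^1(0,1)}^2 .$$
   Context: All functions are complex valued. The norm is $\|\varphi\|_{H_0^1(0,1)}=\|\varphi'\|_{L_2(0,1)}$. The constant may depend on $\tau$ and $\ell$ but not on $u_0$. Notion of solution: with $w(y,t)=u(\ell(t)y,t)$, $y\in[0,1]$, the moving-domain system is equivalent to $w_t=A(t)w$, $w(\cdot,0)=u_0$, where $A(t)w=\frac{i}{\ell(t)^2}w_{yy}+\frac{\ell'(t)}{\ell(t)}\,y\,w_y$ with domain $D=H^2(0,1)\cap H_0^1(0,1)$ in $L_2(0,1)$. The family $(A(t))_{t\in[0,\tau]}$ generates a unique evolution family $U(t,s)$, $0\le s\le t\le\tau$, on $L_2(0,1)$; the solution is $w(t)=U(t,0)u_0$, $u(x,t)=w(x/\ell(t),t)$, and it is a classical $D$-valued solution if $u_0\in D$. For $u_0\in H_0^1(0,1)$ the boundary traces $u_x(0,\cdot)$, $u_x(\ell(\cdot),\cdot)$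 are understood by density, as extensions from $u_0\in D$. *)

theory Defs
  imports "HOL-Analysis.Analysis"
begin

text \<open>Elements of \<open>L\<^sub>2\<close> are represented by functions; identities between them are stated almost
  everywhere, and all notions below depend only on the almost-everywhere class on the open interval.\<close>

abbreviation leb :: "real \<Rightarrow> real \<Rightarrow> real measure" where
  "leb a b \<equiv> lebesgue_on {a<..<b}"

definition L2 :: "real \<Rightarrow> real \<Rightarrow> (real \<Rightarrow> complex) set" where
  "L2 a b = {f. f \<in> borel_measurable (leb a b) \<and> integrable (leb a b) (\<lambda>x. (cmod (f x))\<^sup>2)}"

definition L2norm :: "real \<Rightarrow> real \<Rightarrow> (real \<Rightarrow> complex) \<Rightarrow> real" where
  "L2norm a b f = sqrt (LINT x|leb a b. (cmod (f x))\<^sup>2)"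

definition test_functions :: "real \<Rightarrow> real \<Rightarrow> (real \<Rightarrow> complex) set" where
  "test_functions a b = {\<phi>.
     (\<exists>d :: nat \<Rightarrow> real \<Rightarrow> complex. d 0 = \<phi> \<and>
        (\<forall>n x. (d n has_vector_derivative d (Suc n) x) (at x))) \<and>
     (\<exists>c e. a < c \<and> e < b \<and> (\<forall>x. x \<notin> {c..e} \<longrightarrow> \<phi> x = 0))}"

definition has_weak_deriv ::
    "real \<Rightarrow> real \<Rightarrow> (real \<Rightarrow> complex) \<Rightarrow> (real \<Rightarrow> complex) \<Rightarrow> bool" where
  "has_weak_deriv a b f g \<longleftrightarrow> f \<in> L2 a b \<and> g \<in> L2 a b \<and>
     (\<forall>\<phi>\<in>test_functions a b.
        (LINT x|leb a b. f x * vector_derivative \<phi> (at x)) = - (LINT x|leb a b. g x * \<phi> x))"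

definition H1 :: "real \<Rightarrow> real \<Rightarrow> (real \<Rightarrow> complex) set" where
  "H1 a b = {f. \<exists>g. has_weak_deriv a b f g}"

text \<open>For \<open>f \<in> H1 a b\<close> the choice is unique almost everywhere on the interval.\<close>

definition weak_deriv :: "real \<Rightarrow> real \<Rightarrow> (real \<Rightarrow> complex) \<Rightarrow> real \<Rightarrow> complex" where
  "weak_deriv a b f = (SOME g. has_weak_deriv a b f g)"

definition H1norm :: "real \<Rightarrow> real \<Rightarrow> (real \<Rightarrow> complex) \<Rightarrow> real" where
  "H1norm a b f = sqrt ((L2norm a b f)\<^sup>2 + (L2norm a b (weak_deriv a b f))\<^sup>2)"

definition H2 :: "real \<Rightarrow> real \<Rightarrow> (real \<Rightarrow> complex) set" where
  "H2 a b = {f \<in> H1 a b. weak_deriv a b f \<in> H1 a b}"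

definition H2norm :: "real \<Rightarrow> real \<Rightarrow> (real \<Rightarrow> complex) \<Rightarrow> real" where
  "H2norm a b f = sqrt ((L2norm a b f)\<^sup>2 + (L2norm a b (weak_deriv a b f))\<^sup>2
                        + (L2norm a b (weak_deriv a b (weak_deriv a b f)))\<^sup>2)"

text \<open>The closure of the test functions in \<open>H\<^sup>1\<close>.\<close>

definition H01 :: "real \<Rightarrow> real \<Rightarrow> (real \<Rightarrow> complex) set" where
  "H01 a b = {f \<in> H1 a b. \<forall>\<epsilon>>0. \<exists>\<phi>\<in>test_functions a b. H1norm a b (\<lambda>x. f x - \<phi> x) < \<epsilon>}"

definition H01norm :: "real \<Rightarrow> real \<Rightarrow> (real \<Rightarrow> complex) \<Rightarrow> real" where
  "H01norm a b f = L2norm a b (weak_deriv a b f)"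

text \<open>Pointwise value on the closed interval of the continuous representative of an
  \<open>H\<^sup>1\<close> function; at the end points this is the Sobolev trace.\<close>

definition trace_at :: "real \<Rightarrow> real \<Rightarrow> (real \<Rightarrow> complex) \<Rightarrow> real \<Rightarrow> complex" where
  "trace_at a b f p =
     (THE c. \<exists>v. continuous_on {a..b} v \<and> (AE x in leb a b. v x = f x) \<and> v p = c)"

definition dom_A :: "(real \<Rightarrow> complex) set" where
  "dom_A = H2 0 1 \<inter> H01 0 1"

definition A_op :: "(real \<Rightarrow> real) \<Rightarrow> (real \<Rightarrow> real) \<Rightarrow> real
    \<Rightarrow> (real \<Rightarrow> complex) \<Rightarrow> real \<Rightarrow> complex" where
  "A_op l l' t f = (\<lambda>y. \<i> / (of_real (l t))\<^sup>2 * weak_deriv 0 1 (weak_deriv 0 1 f) y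
                      + of_real (l' t / l t * y) * weak_deriv 0 1 f y)"

definition bounded_operator_L2 :: "((real \<Rightarrow> complex) \<Rightarrow> real \<Rightarrow> complex) \<Rightarrow> bool" where
  "bounded_operator_L2 T \<longleftrightarrow>
     (\<forall>f\<in>L2 0 1. T f \<in> L2 0 1) \<and>
     (\<forall>f\<in>L2 0 1. \<forall>g\<in>L2 0 1. AE y in leb 0 1. T (\<lambda>x. f x + g x) y = T f y + T g y) \<and>
     (\<forall>c. \<forall>f\<in>L2 0 1. AE y in leb 0 1. T (\<lambda>x. c * f x) y = c * T f y) \<and>
     (\<exists>K. \<forall>f\<in>L2 0 1. L2norm 0 1 (T f) \<le> K * L2norm 0 1 f)"

text \<open>A strongly continuous evolution family \<open>U t s\<close>, \<open>0 \<le> s \<le> t \<le> \<tau>\<close>, of bounded operators on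
  \<open>L\<^sub>2(0,1)\<close>.\<close>

definition evolution_family ::
    "real \<Rightarrow> (real \<Rightarrow> real \<Rightarrow> (real \<Rightarrow> complex) \<Rightarrow> real \<Rightarrow> complex) \<Rightarrow> bool" where
  "evolution_family \<tau> U \<longleftrightarrow>
     (\<forall>s t. 0 \<le> s \<and> s \<le> t \<and> t \<le> \<tau> \<longrightarrow> bounded_operator_L2 (U t s)) \<and>
     (\<forall>s\<in>{0..\<tau>}. \<forall>f\<in>L2 0 1. AE y in leb 0 1. U s s f y = f y) \<and>
     (\<forall>s r t. 0 \<le> s \<and> s \<le> r \<and> r \<le> t \<and> t \<le> \<tau> \<longrightarrow>
        (\<forall>f\<in>L2 0 1. AE y in leb 0 1. U t r (U r s f) y = U t s f y)) \<and>
     (\<forall>f\<in>L2 0 1. \<forall>t s. 0 \<le> s \<and> s \<le> t \<and> t \<le> \<tau> \<longrightarrow>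
        ((\<lambda>(t', s'). L2norm 0 1 (\<lambda>y. U t' s' f y - U t s f y)) \<longlongrightarrow> 0)
          (at (t, s) within {(t', s'). 0 \<le> s' \<and> s' \<le> t' \<and> t' \<le> \<tau>}))"

text \<open>\<open>w\<close> is a classical \<open>D\<close>-valued solution of \<open>w' = A(t) w\<close> on \<open>[s,\<tau>]\<close>: it is continuous into
  \<open>D\<close> with the \<open>H\<^sup>2\<close> norm and differentiable into \<open>L\<^sub>2(0,1)\<close> (one-sidedly at the end points).
  Continuity of the derivative is then automatic for continuous \<open>l\<close>, \<open>l'\<close>, \<open>l > 0\<close>.\<close>

definition classical_solution :: "real \<Rightarrow> (real \<Rightarrow> real) \<Rightarrow> (real \<Rightarrow> real) \<Rightarrow> real
    \<Rightarrow> (real \<Rightarrow> real \<Rightarrow> complex) \<Rightarrow> bool" where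
  "classical_solution \<tau> l l' s w \<longleftrightarrow> (\<forall>t\<in>{s..\<tau>}.
     w t \<in> dom_A \<and>
     ((\<lambda>r. H2norm 0 1 (\<lambda>y. w r y - w t y)) \<longlongrightarrow> 0) (at t within {s..\<tau>}) \<and>
     ((\<lambda>r. L2norm 0 1 (\<lambda>y. (w r y - w t y) / of_real (r - t) - A_op l l' t (w t) y)) \<longlongrightarrow> 0)
       (at t within {s..\<tau>}))"

definition generates_evolution_family :: "real \<Rightarrow> (real \<Rightarrow> real) \<Rightarrow> (real \<Rightarrow> real)
    \<Rightarrow> (real \<Rightarrow> real \<Rightarrow> (real \<Rightarrow> complex) \<Rightarrow> real \<Rightarrow> complex) \<Rightarrow> bool" where
  "generates_evolution_family \<tau> l l' U \<longleftrightarrow> evolution_family \<tau> U \<and>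
     (\<forall>s\<in>{0..\<tau>}. \<forall>f\<in>dom_A. classical_solution \<tau> l l' s (\<lambda>t. U t s f))"

definition moving_solution :: "(real \<Rightarrow> real)
    \<Rightarrow> (real \<Rightarrow> real \<Rightarrow> (real \<Rightarrow> complex) \<Rightarrow> real \<Rightarrow> complex)
    \<Rightarrow> (real \<Rightarrow> complex) \<Rightarrow> real \<Rightarrow> real \<Rightarrow> complex" where
  "moving_solution l U u0 x t = U t 0 u0 (x / l t)"

text \<open>\<open>u\<^sub>x(p(t),t)\<close> for a boundary curve \<open>p(t) \<in> {0, l(t)}\<close> and initial data in \<open>D\<close>.\<close>

definition classical_trace_x :: "(real \<Rightarrow> real)
    \<Rightarrow> (real \<Rightarrow> real \<Rightarrow> (real \<Rightarrow> complex) \<Rightarrow> real \<Rightarrow> complex)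
    \<Rightarrow> (real \<Rightarrow> real) \<Rightarrow> (real \<Rightarrow> complex) \<Rightarrow> real \<Rightarrow> complex" where
  "classical_trace_x l U p u0 t =
     trace_at 0 (l t) (weak_deriv 0 (l t) (\<lambda>x. moving_solution l U u0 x t)) (p t)"

text \<open>\<open>g\<close> represents \<open>u\<^sub>x(p(\<cdot>),\<cdot>)\<close> for \<open>u0 \<in> H\<^sub>0\<^sup>1(0,1)\<close>: the value at \<open>u0\<close> of the continuous extension
  of the trace map from \<open>D\<close>, as a map from \<open>H\<^sub>0\<^sup>1(0,1)\<close> into \<open>L\<^sub>2(0,\<tau>)\<close>.  Since \<open>D\<close> is dense in
  \<open>H\<^sub>0\<^sup>1(0,1)\<close>, \<open>g\<close> is unique almost everywhere; for \<open>u0 \<in> D\<close> the constant sequence shows that it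
  agrees with the classical trace.\<close>

definition is_trace_x :: "real \<Rightarrow> (real \<Rightarrow> real)
    \<Rightarrow> (real \<Rightarrow> real \<Rightarrow> (real \<Rightarrow> complex) \<Rightarrow> real \<Rightarrow> complex)
    \<Rightarrow> (real \<Rightarrow> real) \<Rightarrow> (real \<Rightarrow> complex) \<Rightarrow> (real \<Rightarrow> complex) \<Rightarrow> bool" where
  "is_trace_x \<tau> l U p u0 g \<longleftrightarrow> g \<in> L2 0 \<tau> \<and>
     (\<forall>v :: nat \<Rightarrow> real \<Rightarrow> complex.
        (\<forall>n. v n \<in> dom_A) \<and> (\<lambda>n. H01norm 0 1 (\<lambda>y. v n y - u0 y)) \<longlonglongrightarrow> 0 \<longrightarrow>
        (\<forall>n. classical_trace_x l U p (v n) \<in> L2 0 \<tau>) \<and>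
        (\<lambda>n. L2norm 0 \<tau> (\<lambda>t. classical_trace_x l U p (v n) t - g t)) \<longlonglongrightarrow> 0)"

end

theory Submission imports Defs
begin

text \<open>
  In the fixed coordinate \<open>y = x / l(t)\<close> the solution is \<open>w(y,t) = u(l(t) y, t)\<close> and
  \<open>w\<^sub>t = \<i> l\<^sup>-\<^sup>2 w\<^sub>y\<^sub>y + (l'/l) y w\<^sub>y\<close>.  For data in \<open>dom_A\<close> the following quantities are
  differentiable in \<open>t\<close>: the mass \<open>M = \<parallel>w\<parallel>\<^sup>2\<close>, the energy \<open>E = \<parallel>w\<^sub>y\<parallel>\<^sup>2\<close> and, for an affine weight
  \<open>q\<close>, the momentum \<open>J\<^sub>q = Im \<integral> q w cnj w\<^sub>y\<close>.  With \<open>p\<^sub>0\<close>, \<open>p\<^sub>1\<close> for \<open>\<bar>w\<^sub>y\<bar>\<^sup>2\<close> at the two ends, the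
  equation and integration by parts give
  \<open>M' = - (l'/l) M\<close>, \<open>E' = (l'/l) (E - p\<^sub>1)\<close> and
  \<open>J\<^sub>q' = l\<^sup>-\<^sup>2 (q(1) p\<^sub>1 - q(0) p\<^sub>0 - 2 q' E) - q' (l'/l) J\<^sub>y\<close>.

  With \<open>q = 2y - 1\<close> both fluxes \<open>p\<^sub>0\<close>, \<open>p\<^sub>1\<close> appear with a positive sign, so their integral over
  time is bounded by \<open>\<bar>J\<^sub>q\<bar>\<close> at the two end times plus a time integral of \<open>E\<close>; Poincare's
  inequality bounds \<open>\<bar>J\<^sub>q\<bar>\<close> by \<open>2 E\<close> when \<open>\<bar>q\<bar> \<le> 1\<close> (\<open>flux_estimate\<close>).  It remains to bound \<open>E(t)\<close> by \<open>E(0)\<close>.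
  When \<open>l' < 0\<close>, the flux in \<open>E'\<close> has the wrong sign and cannot be absorbed in general.
  It cancels in the derivative of \<open>E + l l' J\<^sub>y\<close>; up to the factor \<open>l\<close>
  and a term of order zero this is the energy of \<open>exp (- \<i> l' x\<^sup>2 / (4 l)) u\<close>.  A multiple of
  \<open>M\<close> makes this quantity dominate \<open>E / 2\<close>, and Gronwall's argument applies (\<open>energy_growth\<close>).

  The solution is differentiable in time only as a map into \<open>L\<^sub>2\<close>, so \<open>E\<close> and \<open>J\<^sub>q\<close> cannot be
  differentiated under the integral.  Their increments are therefore written as pairings of
  \<open>w(r) - w(t)\<close> with functions that depend continuously on \<open>r\<close> (\<open>pairing_has_derivative\<close>).

  The spatial part rests on a single integration by parts formula for weakly differentiable
  functions (\<open>H1_by_parts\<close>).  It comes from Fubini's theorem once such functions are known to have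
  a representative that is the primitive of the weak derivative, which is the
  lemma of du Bois-Reymond (\<open>weakly_constant_imp_constant\<close>).

  Finally, the estimate makes the trace map Lipschitz from \<open>dom_A\<close> with the \<open>H\<^sub>0\<^sup>1\<close> norm into
  \<open>L\<^sub>2(0,\<tau>)\<close>.  The domain contains the test functions, hence is dense, and \<open>L\<^sub>2\<close> is complete, so the
  map extends to \<open>H\<^sub>0\<^sup>1\<close> with the same bound.
\<close>

section \<open>Smooth functions and test functions\<close>

definition smooth :: "(real \<Rightarrow> complex) \<Rightarrow> bool" where
  "smooth \<phi> \<longleftrightarrow> (\<exists>d :: nat \<Rightarrow> real \<Rightarrow> complex. d 0 = \<phi> \<and>
        (\<forall>n x. (d n has_vector_derivative d (Suc n) x) (at x)))"

text \<open>To see that a function is smooth it is enough to place it in a family that is closed under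
  differentiation.  This avoids closed formulas for higher derivatives.\<close>

lemma smooth_coinduct:
  assumes "\<phi> \<in> S"
    and step: "\<And>f. f \<in> S \<Longrightarrow> \<exists>f'\<in>S. \<forall>x. (f has_vector_derivative f' x) (at x)"
  shows "smooth \<phi>"
proof -
  from step obtain D where D: "\<And>f. f \<in> S \<Longrightarrow> D f \<in> S"
      "\<And>f x. f \<in> S \<Longrightarrow> (f has_vector_derivative D f x) (at x)"
    by metis
  have "(D ^^ n) \<phi> \<in> S" for n
    by (induction n) (auto simp: assms(1) D)
  then show ?thesis
    unfolding smooth_def by (intro exI[of _ "\<lambda>n. (D ^^ n) \<phi>"]) (auto simp: D)
qed

lemma smooth_derivative:
  assumes "smooth \<phi>"
  obtains \<phi>' where "smooth \<phi>'" "\<And>x. (\<phi> has_vector_derivative \<phi>' x) (at x)"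
proof -
  from assms obtain d where d: "d 0 = \<phi>" "\<And>n x. (d n has_vector_derivative d (Suc n) x) (at x)"
    unfolding smooth_def by blast
  show thesis
  proof
    show "smooth (d (Suc 0))"
      unfolding smooth_def by (intro exI[of _ "\<lambda>n. d (Suc n)"]) (auto simp: d)
    show "(\<phi> has_vector_derivative d (Suc 0) x) (at x)" for x
      using d(2)[of 0] d(1) by simp
  qed
qed

lemma smooth_antiderivative:
  assumes "smooth \<psi>" "\<And>x. (\<phi> has_vector_derivative \<psi> x) (at x)"
  shows "smooth \<phi>"
proof (rule smooth_coinduct[of _ "insert \<phi> {f. smooth f}"])
  show "\<exists>f'\<in>insert \<phi> {f. smooth f}. \<forall>x. (f has_vector_derivative f' x) (at x)"
    if "f \<in> insert \<phi> {f. smooth f}" for f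
    using that assms smooth_derivative by (metis insert_iff mem_Collect_eq)
qed simp

lemma smooth_imp_continuous_on: "smooth \<phi> \<Longrightarrow> continuous_on A \<phi>"
  by (metis smooth_derivative has_vector_derivative_continuous continuous_at_imp_continuous_on)

text \<open>By the product rule, the algebra generated by the smooth functions is closed under
  differentiation, so all its members are smooth. This takes the place of the Leibniz formula for
  the derivatives of a product.\<close>

inductive_set smooth_algebra :: "(real \<Rightarrow> complex) set" where
  base: "smooth f \<Longrightarrow> f \<in> smooth_algebra"
| add: "f \<in> smooth_algebra \<Longrightarrow> g \<in> smooth_algebra \<Longrightarrow> (\<lambda>x. f x + g x) \<in> smooth_algebra"
| mult: "f \<in> smooth_algebra \<Longrightarrow> g \<in> smooth_algebra \<Longrightarrow> (\<lambda>x. f x * g x) \<in> smooth_algebra"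

lemma smooth_algebra_iff: "f \<in> smooth_algebra \<longleftrightarrow> smooth f"
proof
  assume "f \<in> smooth_algebra"
  then show "smooth f"
  proof (rule smooth_coinduct)
    show "\<exists>f'\<in>smooth_algebra. \<forall>x. (f has_vector_derivative f' x) (at x)"
      if "f \<in> smooth_algebra" for f
      using that
    proof induction
      case (base f)
      then show ?case
        using smooth_derivative smooth_algebra.base by metis
    next
      case (add f g)
      then obtain f' g' where "f' \<in> smooth_algebra" "g' \<in> smooth_algebra"
        "\<And>x. (f has_vector_derivative f' x) (at x)" "\<And>x. (g has_vector_derivative g' x) (at x)"
        by auto
      then show ?case
        by (intro bexI[of _ "\<lambda>x. f' x + g' x"])
           (auto intro!: smooth_algebra.add has_vector_derivative_add)
    next
      case (mult f g)
      then obtain f' g' where "f' \<in> smooth_algebra" "g' \<in> smooth_algebra"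
        "\<And>x. (f has_vector_derivative f' x) (at x)" "\<And>x. (g has_vector_derivative g' x) (at x)"
        by auto
      then show ?case
        using mult.hyps
        by (intro bexI[of _ "\<lambda>x. f x * g' x + f' x * g x"])
           (auto intro!: smooth_algebra.add smooth_algebra.mult has_vector_derivative_mult)
    qed
  qed
qed (rule smooth_algebra.base)

lemma smooth_add: "smooth f \<Longrightarrow> smooth g \<Longrightarrow> smooth (\<lambda>x. f x + g x)"
  using smooth_algebra.add by (simp add: smooth_algebra_iff)

lemma smooth_mult: "smooth f \<Longrightarrow> smooth g \<Longrightarrow> smooth (\<lambda>x. f x * g x)"
  using smooth_algebra.mult by (simp add: smooth_algebra_iff)

lemma smooth_const: "smooth (\<lambda>x. c)"
  by (rule smooth_coinduct[of _ "range (\<lambda>c x. c)"]) (auto intro!: exI[of _ 0] derivative_intros)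

lemma smooth_cmult: "smooth f \<Longrightarrow> smooth (\<lambda>x. c * f x)"
  by (rule smooth_mult[OF smooth_const])

lemma smooth_diff: "smooth f \<Longrightarrow> smooth g \<Longrightarrow> smooth (\<lambda>x. f x - g x)"
  using smooth_add[of f "\<lambda>x. (-1) * g x"] smooth_cmult[of g "-1"] by simp

lemma smooth_affine: "smooth (\<lambda>x. of_real (c * x + d))"
  by (rule smooth_antiderivative[OF smooth_const[of "of_real c"]])
     (auto intro!: derivative_eq_intros simp: has_vector_derivative_of_real)

lemma smooth_cnj:
  assumes "smooth f" shows "smooth (\<lambda>x. cnj (f x))"
proof (rule smooth_coinduct[of _ "{\<lambda>x. cnj (f x) |f. smooth f}"])
  fix g assume "g \<in> {\<lambda>x. cnj (f x) |f. smooth f}"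
  then obtain f where f: "g = (\<lambda>x. cnj (f x))" "smooth f" by auto
  obtain f' where "smooth f'" "\<And>x. (f has_vector_derivative f' x) (at x)"
    using smooth_derivative[OF f(2)] by metis
  then show "\<exists>f'\<in>{\<lambda>x. cnj (f x) |f. smooth f}. \<forall>x. (g has_vector_derivative f' x) (at x)"
    unfolding f(1)
    by (intro bexI[of _ "\<lambda>x. cnj (f' x)"]) (auto intro!: has_vector_derivative_cnj)
qed (use assms in auto)

lemma smooth_compose_affine:
  assumes "smooth f" shows "smooth (\<lambda>x. f (k * x + e))"
proof (rule smooth_coinduct[of _ "{\<lambda>x. of_real c * f (k * x + e) |c f. smooth f}"])
  show "(\<lambda>x. f (k * x + e)) \<in> {\<lambda>x. of_real c * f (k * x + e) |c f. smooth f}"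
    by (clarsimp intro!: exI[of _ 1] exI[of _ f] simp: assms)
  fix g assume "g \<in> {\<lambda>x. of_real c * f (k * x + e) |c f. smooth f}"
  then obtain c f where f: "g = (\<lambda>x. of_real c * f (k * x + e))" "smooth f" by auto
  obtain f' where f': "smooth f'" "\<And>x. (f has_vector_derivative f' x) (at x)"
    using smooth_derivative[OF f(2)] by metis
  have "((\<lambda>x. f (k * x + e)) has_vector_derivative k *\<^sub>R f' (k * x + e)) (at x)" for x
  proof -
    have "((\<lambda>x. k * x + e) has_vector_derivative k) (at x)"
      by (auto intro!: derivative_eq_intros simp flip: has_real_derivative_iff_has_vector_derivative)
    from vector_diff_chain_at[OF this f'(2)] show ?thesis
      by (simp add: o_def)
  qed
  from has_vector_derivative_mult_right[OF this, of "of_real c"]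
  have "(g has_vector_derivative of_real (c * k) * f' (k * x + e)) (at x)" for x
    unfolding f(1) by (simp add: scaleR_conv_of_real mult.assoc)
  then show "\<exists>f'\<in>{\<lambda>x. of_real c * f (k * x + e) |c f. smooth f}.
      \<forall>x. (g has_vector_derivative f' x) (at x)"
    using f'(1) by (intro bexI[of _ "\<lambda>x. of_real (c * k) * f' (k * x + e)"]) blast+
qed

text \<open>For \<open>p = 1\<close> this is Cauchy's function \<open>exp (- 1 / x)\<close>. With polynomial factors in \<open>1 / x\<close> the
  family is closed under differentiation.\<close>

definition flat_step :: "real poly \<Rightarrow> real \<Rightarrow> real" where
  "flat_step p x = (if x > 0 then poly p (inverse x) * exp (- inverse x) else 0)"

lemma power_mult_poly_exp_tendsto_0:
  "((\<lambda>s::real. s ^ k * poly p s * exp (- s)) \<longlongrightarrow> 0) at_top"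
proof (induction p arbitrary: k)
  case (pCons a p)
  have "((\<lambda>s::real. a * (s ^ k / exp s) + s ^ Suc k * poly p s * exp (- s)) \<longlongrightarrow> a * 0 + 0) at_top"
    by (intro tendsto_intros tendsto_power_div_exp_0 pCons.IH)
  then show ?case
    by (simp add: algebra_simps exp_minus divide_simps)
qed simp

text \<open>Only the origin needs an argument: there the difference quotient from the right is
  \<open>s p(s) exp (- s)\<close> with \<open>s = 1 / h\<close>, and the exponential wins.\<close>

lemma flat_step_DERIV:
  "(flat_step p has_real_derivative flat_step ([:0, 0, 1:] * (p - pderiv p)) x) (at x)"
proof -
  consider "x < 0" | "x > 0" | "x = 0" by linarith
  then show ?thesis
  proof cases
    case 1
    have "((\<lambda>x. 0) has_real_derivative 0) (at x)" by simp
    moreover have "\<forall>\<^sub>F y in nhds x. 0 = flat_step p y"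
      using eventually_nhds_in_open[of "{..<0}" x] 1
      by (auto elim!: eventually_mono simp: flat_step_def)
    ultimately have "(flat_step p has_real_derivative 0) (at x)"
      by (subst (asm) DERIV_cong_ev[OF refl _ refl]) auto
    then show ?thesis using 1 by (simp add: flat_step_def)
  next
    case 2
    have "((\<lambda>x. poly p (inverse x) * exp (- inverse x)) has_real_derivative
            poly ([:0, 0, 1:] * (p - pderiv p)) (inverse x) * exp (- inverse x)) (at x)"
      using 2 by (auto intro!: derivative_eq_intros DERIV_chain2[OF poly_DERIV]
          simp: algebra_simps power2_eq_square)
    moreover have "\<forall>\<^sub>F y in nhds x. poly p (inverse y) * exp (- inverse y) = flat_step p y"
      using eventually_nhds_in_open[of "{0<..}" x] 2
      by (auto elim!: eventually_mono simp: flat_step_def)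
    ultimately have "(flat_step p has_real_derivative
        poly ([:0, 0, 1:] * (p - pderiv p)) (inverse x) * exp (- inverse x)) (at x)"
      by (subst (asm) DERIV_cong_ev[OF refl _ refl]) auto
    then show ?thesis using 2 by (simp add: flat_step_def)
  next
    case 3
    have "((\<lambda>h. inverse h ^ 1 * poly p (inverse h) * exp (- inverse h)) \<longlongrightarrow> 0) (at_right (0::real))"
      by (rule filterlim_compose[OF power_mult_poly_exp_tendsto_0 filterlim_inverse_at_top_right])
    then have R: "((\<lambda>h. flat_step p h / h) \<longlongrightarrow> 0) (at_right 0)"
      by (rule Lim_transform_eventually)
         (auto simp: eventually_at_filter flat_step_def field_simps)
    have L: "((\<lambda>h. flat_step p h / h) \<longlongrightarrow> 0) (at_left 0)"
      by (rule Lim_transform_eventually[OF tendsto_const])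
         (auto simp: eventually_at_filter flat_step_def field_simps)
    show ?thesis
      using filterlim_split_at[OF L R] 3 by (simp add: DERIV_def flat_step_def)
  qed
qed

lemma smooth_flat_step: "smooth (\<lambda>x. of_real (flat_step p x))"
proof (rule smooth_coinduct[of _ "{\<lambda>x. of_real (flat_step p x) |p. True}"])
  fix f :: "real \<Rightarrow> complex" assume "f \<in> {\<lambda>x. of_real (flat_step p x) |p. True}"
  then obtain p where f: "f = (\<lambda>x. of_real (flat_step p x))" by auto
  show "\<exists>f'\<in>{\<lambda>x. of_real (flat_step p x) |p. True}. \<forall>x. (f has_vector_derivative f' x) (at x)"
    unfolding f using flat_step_DERIV
    by (intro bexI[of _ "\<lambda>x. of_real (flat_step ([:0, 0, 1:] * (p - pderiv p)) x)"])
       (blast intro: has_vector_derivative_of_real)+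
qed auto

lemma test_functions_iff:
  "\<phi> \<in> test_functions a b \<longleftrightarrow>
     smooth \<phi> \<and> (\<exists>c e. a < c \<and> e < b \<and> (\<forall>x. x \<notin> {c..e} \<longrightarrow> \<phi> x = 0))"
  by (simp add: test_functions_def smooth_def)

lemma test_functions_smooth: "\<phi> \<in> test_functions a b \<Longrightarrow> smooth \<phi>"
  by (simp add: test_functions_iff)

lemma test_functions_support2:
  assumes "\<phi> \<in> test_functions a b" "\<psi> \<in> test_functions a b"
  obtains c e where "a < c" "e < b" "\<And>x. x \<notin> {c..e} \<Longrightarrow> \<phi> x = 0 \<and> \<psi> x = 0"
proof -
  obtain c e c' e' where "a < c" "e < b" "\<And>x. x \<notin> {c..e} \<Longrightarrow> \<phi> x = 0"
    "a < c'" "e' < b" "\<And>x. x \<notin> {c'..e'} \<Longrightarrow> \<psi> x = 0"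
    using assms unfolding test_functions_iff by metis
  then show thesis
    by (intro that[of "min c c'" "max e e'"]) (simp_all add: not_le, blast)
qed

lemma test_functions_diff:
  assumes "\<phi> \<in> test_functions a b" "\<psi> \<in> test_functions a b"
  shows "(\<lambda>x. \<phi> x - \<psi> x) \<in> test_functions a b"
proof -
  obtain c e where "a < c" "e < b" "\<And>x. x \<notin> {c..e} \<Longrightarrow> \<phi> x = 0 \<and> \<psi> x = 0"
    using test_functions_support2[OF assms] by metis
  then show ?thesis
    using assms unfolding test_functions_iff
    by (metis (no_types, lifting) diff_zero smooth_diff)
qed

lemma test_functions_mult:
  assumes "smooth g" "\<phi> \<in> test_functions a b"
  shows "(\<lambda>x. g x * \<phi> x) \<in> test_functions a b"
  using assms unfolding test_functions_iff by (metis mult_zero_right smooth_mult)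

lemma test_functions_cnj:
  "\<phi> \<in> test_functions a b \<Longrightarrow> (\<lambda>x. cnj (\<phi> x)) \<in> test_functions a b"
  unfolding test_functions_iff by (metis complex_cnj_zero smooth_cnj)

lemma test_functions_derivative:
  assumes "\<phi> \<in> test_functions a b"
  obtains \<phi>' where "\<phi>' \<in> test_functions a b" "\<And>x. (\<phi> has_vector_derivative \<phi>' x) (at x)"
proof -
  obtain c e where ce: "a < c" "e < b" "\<And>x. x \<notin> {c..e} \<Longrightarrow> \<phi> x = 0" and "smooth \<phi>"
    using assms unfolding test_functions_iff by metis
  obtain \<phi>' where \<phi>': "smooth \<phi>'" "\<And>x. (\<phi> has_vector_derivative \<phi>' x) (at x)"
    using smooth_derivative[OF \<open>smooth \<phi>\<close>] by metis
  have "\<phi>' x = 0" if "x \<notin> {c..e}" for x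
  proof -
    have "((\<lambda>x. 0) has_vector_derivative \<phi>' x) (at x)"
      using \<phi>'(2)[of x]
      by (rule has_vector_derivative_transform_within_open[where S = "- {c..e}"])
         (use that ce in auto)
    then show ?thesis
      using has_vector_derivative_const vector_derivative_at by metis
  qed
  then show thesis
    using ce \<phi>' by (intro that[of \<phi>']) (auto simp: test_functions_iff)
qed

lemma test_functions_scale:
  assumes "\<phi> \<in> test_functions 0 k" "k > 0"
  shows "(\<lambda>y. \<phi> (k * y)) \<in> test_functions 0 1"
proof -
  obtain c e where ce: "0 < c" "e < k" "\<And>x. x \<notin> {c..e} \<Longrightarrow> \<phi> x = 0" and "smooth \<phi>"
    using assms unfolding test_functions_iff by metis
  have "smooth (\<lambda>y. \<phi> (k * y))"
    using smooth_compose_affine[OF \<open>smooth \<phi>\<close>, of k 0] by simp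
  moreover have "\<phi> (k * x) = 0" if "x \<notin> {c / k..e / k}" for x
    using that ce(3)[of "k * x"] \<open>k > 0\<close> by (auto simp: field_simps)
  moreover have "0 < c / k" "e / k < 1"
    using ce \<open>k > 0\<close> by auto
  ultimately show ?thesis
    unfolding test_functions_iff by blast
qed

text \<open>A smooth function supported in \<open>[c, d]\<close>; as \<open>n\<close> grows it fills up to the indicator of
  the interval while staying between \<open>0\<close> and \<open>1\<close>.\<close>

definition bump :: "real \<Rightarrow> real \<Rightarrow> nat \<Rightarrow> real \<Rightarrow> real" where
  "bump c d n x = flat_step 1 (real n * (x - c)) * flat_step 1 (real n * (d - x))"

lemma flat_step_1_bounds: "0 \<le> flat_step 1 x" "flat_step 1 x \<le> 1"
  by (auto simp: flat_step_def)

lemma bump_bounds: "\<bar>bump c d n x\<bar> \<le> 1"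
  unfolding bump_def abs_mult
  using flat_step_1_bounds by (intro mult_le_one) auto

lemma bump_test_function:
  assumes "a < c" "d < b"
  shows "(\<lambda>x. of_real (bump c d n x)) \<in> test_functions a b"
proof -
  have "smooth (\<lambda>x. of_real (flat_step 1 (real n * x + (- real n * c))))"
    "smooth (\<lambda>x. of_real (flat_step 1 (- real n * x + real n * d)))"
    by (rule smooth_compose_affine[OF smooth_flat_step])+
  from smooth_mult[OF this] have "smooth (\<lambda>x. of_real (bump c d n x))"
    by (simp add: bump_def algebra_simps)
  moreover have "bump c d n x = 0" if "x \<notin> {c..d}" for x
    using that by (auto simp: bump_def flat_step_def zero_less_mult_iff)
  ultimately show ?thesis
    unfolding test_functions_iff using assms by (metis of_real_0)
qed

lemma bump_tendsto: "(\<lambda>n. bump c d n x) \<longlonglongrightarrow> indicator {c<..<d} x"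
proof -
  have pos: "(\<lambda>n. flat_step 1 (real n * y)) \<longlonglongrightarrow> (if y > 0 then 1 else 0)" for y
  proof (cases "y > 0")
    case True
    have "(\<lambda>n. exp (- (inverse (real n) * inverse y))) \<longlonglongrightarrow> exp (- (0 * inverse y))"
      by (intro tendsto_intros lim_inverse_n)
    moreover have "\<forall>\<^sub>F n in sequentially. exp (- (inverse (real n) * inverse y)) = flat_step 1 (real n * y)"
      using eventually_gt_at_top[of 0]
      by eventually_elim (use True in \<open>auto simp: flat_step_def\<close>)
    ultimately show ?thesis
      using True by (auto intro: Lim_transform_eventually)
  qed (auto simp: flat_step_def zero_less_mult_iff)
  have "(\<lambda>n. bump c d n x) \<longlonglongrightarrow> (if x - c > 0 then 1 else 0) * (if d - x > 0 then 1 else 0)"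
    unfolding bump_def by (intro tendsto_mult pos)
  then show ?thesis
    by (simp add: indicator_def split: if_splits)
qed

text \<open>A primitive that vanishes to the left of the support is constant to the right of it, and
  the constant is the mean. So the derivatives of test functions are exactly the test functions
  with mean zero.\<close>

lemma test_functions_antiderivative:
  assumes \<psi>: "\<psi> \<in> test_functions a b" and int: "integral {a..b} \<psi> = 0"
  obtains \<phi> where "\<phi> \<in> test_functions a b" "\<And>x. (\<phi> has_vector_derivative \<psi> x) (at x)"
proof -
  obtain c e where ce: "a < c" "e < b" "\<And>x. x \<notin> {c..e} \<Longrightarrow> \<psi> x = 0"
    using \<psi> unfolding test_functions_iff by metis
  have cont: "continuous_on A \<psi>" for A
    by (rule smooth_imp_continuous_on[OF test_functions_smooth[OF \<psi>]])
  have intg: "\<psi> integrable_on {u..v}" for u v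
    using integrable_continuous_real cont by blast
  define \<phi> where "\<phi> = (\<lambda>x. integral {a..x} \<psi>)"
  have left: "\<phi> x = 0" if "x < c" for x
    unfolding \<phi>_def using that ce(3) by (intro integral_eq_0_iff[THEN iffD2] integral_unique has_integral_is_0) auto
  have right: "\<phi> x = 0" if "x > e" for x
  proof (cases "a \<le> x")
    case True
    have "integral {x..max x b} \<psi> = 0"
      using that ce(3) by (intro integral_unique has_integral_is_0) auto
    moreover have "integral {b..max x b} \<psi> = 0"
      using that ce(3) ce(2) by (intro integral_unique has_integral_is_0) auto
    moreover have "\<phi> x + integral {x..max x b} \<psi> = integral {a..max x b} \<psi>"
      unfolding \<phi>_def using True intg by (intro Henstock_Kurzweil_Integration.integral_combine) auto
    moreover have "integral {a..b} \<psi> + integral {b..max x b} \<psi> = integral {a..max x b} \<psi>" if "a \<le> b"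
      using intg that by (intro Henstock_Kurzweil_Integration.integral_combine) auto
    moreover have "integral {a..max x b} \<psi> = 0" if "\<not> a \<le> b"
      using that ce by (intro integral_unique has_integral_is_0) auto
    ultimately show ?thesis using int by auto
  qed (simp add: \<phi>_def)
  have deriv: "(\<phi> has_vector_derivative \<psi> x) (at x)" for x
  proof (cases "x < c")
    case True
    have "((\<lambda>x. 0) has_vector_derivative 0) (at x)" by simp
    then have "(\<phi> has_vector_derivative 0) (at x)"
      by (rule has_vector_derivative_transform_within_open[where S = "{..<c}"]) (use True left in auto)
    then show ?thesis using True ce by simp
  next
    case False
    have "((\<lambda>u. integral {a..u} \<psi>) has_vector_derivative \<psi> x) (at x within {a..x + 1})"
      by (rule integral_has_vector_derivative) (use False ce cont in auto)
    then show ?thesis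
      using False ce by (simp add: \<phi>_def at_within_Icc_at)
  qed
  have "\<phi> \<in> test_functions a b"
    unfolding test_functions_iff
    using smooth_antiderivative[OF test_functions_smooth[OF \<psi>] deriv] ce left right
    by (metis atLeastAtMost_iff not_le)
  then show thesis
    using that deriv by blast
qed

section \<open>Square integrable functions\<close>

lemma finite_measure_leb: "finite_measure (leb a b)"
  by (rule finite_measure_lebesgue_on) auto

lemma L2_measurable: "f \<in> L2 a b \<Longrightarrow> f \<in> borel_measurable (leb a b)"
  by (simp add: L2_def)

lemma L2_integrable_norm_sq: "f \<in> L2 a b \<Longrightarrow> integrable (leb a b) (\<lambda>x. (cmod (f x))\<^sup>2)"
  by (simp add: L2_def)

lemma L2norm_sq: "(L2norm a b f)\<^sup>2 = (LINT x|leb a b. (cmod (f x))\<^sup>2)"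
  by (simp add: L2norm_def)

lemma L2norm_nonneg [simp]: "0 \<le> L2norm a b f"
  by (simp add: L2norm_def)

lemma L2norm_cong_AE:
  assumes "AE x in leb a b. f x = g x" "f \<in> L2 a b" "g \<in> L2 a b"
  shows "L2norm a b f = L2norm a b g"
proof -
  note [measurable] = L2_measurable[OF assms(2)] L2_measurable[OF assms(3)]
  show ?thesis
    unfolding L2norm_def using assms(1) by (auto intro!: arg_cong[where f = sqrt] integral_cong_AE)
qed

lemma L2_mult_bounded:
  assumes f: "f \<in> L2 a b" and q: "q \<in> borel_measurable (leb a b)"
    and K: "\<And>x. x \<in> {a<..<b} \<Longrightarrow> cmod (q x) \<le> K"
  shows "(\<lambda>x. q x * f x) \<in> L2 a b"
proof -
  note [measurable] = L2_measurable[OF f] q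
  have "integrable (leb a b) (\<lambda>x. (cmod (q x * f x))\<^sup>2)"
  proof (rule Bochner_Integration.integrable_bound)
    show "integrable (leb a b) (\<lambda>x. K\<^sup>2 * (cmod (f x))\<^sup>2)"
      by (intro integrable_mult_right L2_integrable_norm_sq f)
    show "AE x in leb a b. norm ((cmod (q x * f x))\<^sup>2) \<le> norm (K\<^sup>2 * (cmod (f x))\<^sup>2)"
      using K by (intro AE_I2) (auto simp: norm_mult power_mult_distrib intro!: mult_right_mono power_mono)
  qed measurable
  then show ?thesis by (simp add: L2_def)
qed

lemma L2_cmult: "f \<in> L2 a b \<Longrightarrow> (\<lambda>x. c * f x) \<in> L2 a b"
  by (rule L2_mult_bounded[where K = "cmod c"]) auto

lemma L2_mult_affine:
  assumes "f \<in> L2 a b"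
  shows "(\<lambda>x. of_real (c * x + d) * f x) \<in> L2 a b"
proof (rule L2_mult_bounded[OF assms, where K = "\<bar>c\<bar> * (\<bar>a\<bar> + \<bar>b\<bar>) + \<bar>d\<bar>"])
  have "continuous_on {a<..<b} (\<lambda>x. complex_of_real (c * x + d))"
    by (intro continuous_intros)
  then show "(\<lambda>x. complex_of_real (c * x + d)) \<in> borel_measurable (leb a b)"
    by (rule continuous_imp_measurable_on_sets_lebesgue) auto
  fix x assume "x \<in> {a<..<b}"
  then have "\<bar>x\<bar> \<le> \<bar>a\<bar> + \<bar>b\<bar>" by auto
  then have "\<bar>c\<bar> * \<bar>x\<bar> \<le> \<bar>c\<bar> * (\<bar>a\<bar> + \<bar>b\<bar>)" by (rule mult_left_mono) auto
  moreover have "\<bar>c * x + d\<bar> \<le> \<bar>c\<bar> * \<bar>x\<bar> + \<bar>d\<bar>" by (metis abs_mult abs_triangle_ineq)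
  ultimately show "cmod (complex_of_real (c * x + d)) \<le> \<bar>c\<bar> * (\<bar>a\<bar> + \<bar>b\<bar>) + \<bar>d\<bar>"
    by (metis norm_of_real order_trans add_right_mono)
qed

lemma L2_cnj:
  assumes "f \<in> L2 a b" shows "(\<lambda>x. cnj (f x)) \<in> L2 a b"
proof -
  have "continuous_on UNIV cnj" by (intro continuous_intros)
  from borel_measurable_continuous_on[OF this L2_measurable[OF assms]]
  show ?thesis using assms by (simp add: L2_def)
qed

lemma L2_continuous:
  assumes "continuous_on {a..b} f"
  shows "f \<in> L2 a b"
proof -
  have "bounded (f ` {a..b})"
    by (intro compact_imp_bounded compact_continuous_image assms compact_Icc)
  then obtain B where B: "\<And>x. x \<in> {a..b} \<Longrightarrow> cmod (f x) \<le> B"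
    unfolding bounded_iff by (meson image_eqI)
  have [measurable]: "f \<in> borel_measurable (leb a b)"
    by (rule continuous_imp_measurable_on_sets_lebesgue)
       (auto intro: continuous_on_subset[OF assms])
  have "integrable (leb a b) (\<lambda>x. (cmod (f x))\<^sup>2)"
    by (rule finite_measure.integrable_const_bound[OF finite_measure_leb, where B = "B\<^sup>2"])
       (auto intro!: AE_I2 power_mono B)
  then show ?thesis by (simp add: L2_def)
qed

lemma L2_mult_integrable:
  assumes "f \<in> L2 a b" "g \<in> L2 a b"
  shows "integrable (leb a b) (\<lambda>x. f x * g x)"
proof (rule Bochner_Integration.integrable_bound)
  note [measurable] = L2_measurable[OF assms(1)] L2_measurable[OF assms(2)]
  show "integrable (leb a b) (\<lambda>x. (cmod (f x))\<^sup>2 + (cmod (g x))\<^sup>2)"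
    by (intro Bochner_Integration.integrable_add L2_integrable_norm_sq assms)
  show "AE x in leb a b. norm (f x * g x) \<le> norm ((cmod (f x))\<^sup>2 + (cmod (g x))\<^sup>2)"
  proof (intro AE_I2)
    fix x
    show "norm (f x * g x) \<le> norm ((cmod (f x))\<^sup>2 + (cmod (g x))\<^sup>2)"
      using sum_squares_bound[of "cmod (f x)" "cmod (g x)"]
        mult_nonneg_nonneg[OF norm_ge_zero[of "f x"] norm_ge_zero[of "g x"]]
      by (simp only: norm_mult real_norm_def)
  qed
qed (intro borel_measurable_times L2_measurable assms)

lemma L2_integrable: "f \<in> L2 a b \<Longrightarrow> integrable (leb a b) f"
  using L2_mult_integrable[of f a b "\<lambda>x. 1"] L2_continuous[of a b "\<lambda>x. 1"] by simp

lemma L2_add: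
  assumes "f \<in> L2 a b" "g \<in> L2 a b"
  shows "(\<lambda>x. f x + g x) \<in> L2 a b"
proof -
  note [measurable] = L2_measurable[OF assms(1)] L2_measurable[OF assms(2)]
  have "integrable (leb a b) (\<lambda>x. (cmod (f x + g x))\<^sup>2)"
  proof (rule Bochner_Integration.integrable_bound)
    show "integrable (leb a b) (\<lambda>x. 2 * (cmod (f x))\<^sup>2 + 2 * (cmod (g x))\<^sup>2)"
      by (intro Bochner_Integration.integrable_add integrable_mult_right L2_integrable_norm_sq assms)
    show "AE x in leb a b. norm ((cmod (f x + g x))\<^sup>2) \<le> norm (2 * (cmod (f x))\<^sup>2 + 2 * (cmod (g x))\<^sup>2)"
    proof (intro AE_I2)
      fix x
      have "(cmod (f x + g x))\<^sup>2 \<le> (cmod (f x) + cmod (g x))\<^sup>2"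
        by (intro power_mono norm_triangle_ineq) auto
      also have "\<dots> \<le> 2 * (cmod (f x))\<^sup>2 + 2 * (cmod (g x))\<^sup>2"
        using sum_squares_bound[of "cmod (f x)" "cmod (g x)"] by (simp add: power2_sum)
      finally show "norm ((cmod (f x + g x))\<^sup>2) \<le> norm (2 * (cmod (f x))\<^sup>2 + 2 * (cmod (g x))\<^sup>2)"
        by simp
    qed
  qed measurable
  then show ?thesis by (simp add: L2_def)
qed

lemma L2_diff: "f \<in> L2 a b \<Longrightarrow> g \<in> L2 a b \<Longrightarrow> (\<lambda>x. f x - g x) \<in> L2 a b"
  using L2_add[of f a b "\<lambda>x. (-1) * g x"] L2_cmult[of g a b "-1"] by simp

lemma L2norm_cnj [simp]: "L2norm a b (\<lambda>x. cnj (f x)) = L2norm a b f"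
  by (simp add: L2norm_def)

lemma L2norm_cmult: "L2norm a b (\<lambda>x. c * f x) = cmod c * L2norm a b f"
  by (simp add: L2norm_def norm_mult power_mult_distrib real_sqrt_mult)

lemma L2norm_minus_commute: "L2norm a b (\<lambda>x. f x - g x) = L2norm a b (\<lambda>x. g x - f x)"
  by (simp add: L2norm_def norm_minus_commute)

lemma L2norm_eq_0_AE:
  assumes "f \<in> L2 a b" "L2norm a b f = 0"
  shows "AE x in leb a b. f x = 0"
  using integral_nonneg_eq_0_iff_AE[OF L2_integrable_norm_sq[OF assms(1)]] assms(2)
  by (simp add: L2norm_def)

text \<open>The pointwise bound \<open>\<bar>f g\<bar> \<le> \<alpha> / 2 \<bar>f\<bar>\<^sup>2 + \<bar>g\<bar>\<^sup>2 / (2 \<alpha>)\<close> is integrated with the optimal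
  \<open>\<alpha> = \<parallel>g\<parallel> / \<parallel>f\<parallel>\<close>.\<close>

lemma L2_Cauchy_Schwarz_norm:
  assumes f: "f \<in> L2 a b" and g: "g \<in> L2 a b"
  shows "(LINT x|leb a b. cmod (f x * g x)) \<le> L2norm a b f * L2norm a b g"
proof -
  note [measurable] = L2_measurable[OF f] L2_measurable[OF g]
  consider "L2norm a b f = 0" | "L2norm a b g = 0" | "L2norm a b f > 0" "L2norm a b g > 0"
    using L2norm_nonneg by (metis less_eq_real_def)
  then show ?thesis
  proof cases
    case 1
    then have "(LINT x|leb a b. cmod (f x * g x)) = (LINT x|leb a b. 0)"
      using L2norm_eq_0_AE[OF f] by (intro integral_cong_AE) auto
    then show ?thesis using 1 by simp
  next
    case 2
    then have "(LINT x|leb a b. cmod (f x * g x)) = (LINT x|leb a b. 0)"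
      using L2norm_eq_0_AE[OF g] by (intro integral_cong_AE) auto
    then show ?thesis using 2 by simp
  next
    case 3
    define \<alpha> where "\<alpha> = L2norm a b g / L2norm a b f"
    have "\<alpha> > 0" using 3 by (simp add: \<alpha>_def)
    have "(LINT x|leb a b. cmod (f x * g x)) \<le>
        (LINT x|leb a b. \<alpha> / 2 * (cmod (f x))\<^sup>2 + 1 / (2 * \<alpha>) * (cmod (g x))\<^sup>2)"
    proof (intro integral_mono integrable_norm L2_mult_integrable f g Bochner_Integration.integrable_add
        integrable_mult_right L2_integrable_norm_sq)
      fix x
      have "0 \<le> (\<alpha> * cmod (f x) - cmod (g x))\<^sup>2 / (2 * \<alpha>)"
        using \<open>\<alpha> > 0\<close> by simp
      also have "\<dots> = \<alpha> / 2 * (cmod (f x))\<^sup>2 + 1 / (2 * \<alpha>) * (cmod (g x))\<^sup>2 - cmod (f x) * cmod (g x)"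
        using \<open>\<alpha> > 0\<close> by (simp add: field_simps power2_eq_square)
      finally show "cmod (f x * g x) \<le> \<alpha> / 2 * (cmod (f x))\<^sup>2 + 1 / (2 * \<alpha>) * (cmod (g x))\<^sup>2"
        by (simp add: norm_mult)
    qed
    also have "\<dots> = \<alpha> / 2 * (L2norm a b f)\<^sup>2 + 1 / (2 * \<alpha>) * (L2norm a b g)\<^sup>2"
      using L2_integrable_norm_sq[OF f] L2_integrable_norm_sq[OF g] by (simp add: L2norm_sq)
    also have "\<dots> = L2norm a b f * L2norm a b g"
      using 3 by (simp add: \<alpha>_def field_simps power2_eq_square)
    finally show ?thesis .
  qed
qed

lemma L2_Cauchy_Schwarz:
  assumes "f \<in> L2 a b" "g \<in> L2 a b"
  shows "cmod (LINT x|leb a b. f x * g x) \<le> L2norm a b f * L2norm a b g"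
  using integral_norm_bound L2_Cauchy_Schwarz_norm[OF assms] by (rule order_trans)

lemma L2norm_triangle:
  assumes f: "f \<in> L2 a b" and g: "g \<in> L2 a b"
  shows "L2norm a b (\<lambda>x. f x + g x) \<le> L2norm a b f + L2norm a b g"
proof (rule power2_le_imp_le)
  have fg: "integrable (leb a b) (\<lambda>x. f x * g x)"
    by (rule L2_mult_integrable[OF f g])
  have "(L2norm a b (\<lambda>x. f x + g x))\<^sup>2 \<le>
      (LINT x|leb a b. (cmod (f x))\<^sup>2 + (cmod (g x))\<^sup>2 + 2 * cmod (f x * g x))"
    unfolding L2norm_sq
  proof (intro integral_mono Bochner_Integration.integrable_add integrable_mult_right integrable_norm
      L2_integrable_norm_sq f g fg L2_add)
    fix x
    have "(cmod (f x + g x))\<^sup>2 \<le> (cmod (f x) + cmod (g x))\<^sup>2"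
      by (intro power_mono norm_triangle_ineq) auto
    then show "(cmod (f x + g x))\<^sup>2 \<le> (cmod (f x))\<^sup>2 + (cmod (g x))\<^sup>2 + 2 * cmod (f x * g x)"
      by (simp add: power2_sum norm_mult)
  qed
  also have "\<dots> = (L2norm a b f)\<^sup>2 + (L2norm a b g)\<^sup>2 + 2 * (LINT x|leb a b. cmod (f x * g x))"
    using L2_integrable_norm_sq[OF f] L2_integrable_norm_sq[OF g] integrable_norm[OF fg]
    by (simp add: L2norm_sq)
  also have "\<dots> \<le> (L2norm a b f + L2norm a b g)\<^sup>2"
    using L2_Cauchy_Schwarz_norm[OF f g] by (simp add: power2_sum)
  finally show "(L2norm a b (\<lambda>x. f x + g x))\<^sup>2 \<le> (L2norm a b f + L2norm a b g)\<^sup>2" .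
qed simp

lemma L2norm_triangle_diff:
  assumes "f \<in> L2 a b" "g \<in> L2 a b"
  shows "L2norm a b f \<le> L2norm a b (\<lambda>x. f x - g x) + L2norm a b g"
  using L2norm_triangle[OF L2_diff[OF assms] assms(2)] by simp

lemma L2norm_triangle_diff3:
  assumes "f \<in> L2 a b" "g \<in> L2 a b" "h \<in> L2 a b"
  shows "L2norm a b (\<lambda>x. f x - h x) \<le> L2norm a b (\<lambda>x. f x - g x) + L2norm a b (\<lambda>x. g x - h x)"
  using L2norm_triangle[OF L2_diff[OF assms(1,2)] L2_diff[OF assms(2,3)]] by simp

lemma L2norm_tendsto:
  assumes "\<forall>\<^sub>F r in F. f r \<in> L2 a b" "g \<in> L2 a b"
    and "((\<lambda>r. L2norm a b (\<lambda>x. f r x - g x)) \<longlongrightarrow> 0) F"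
  shows "((\<lambda>r. L2norm a b (f r)) \<longlongrightarrow> L2norm a b g) F"
proof (rule Lim_transform2[OF tendsto_const], rule Lim_null_comparison[OF _ assms(3)])
  show "\<forall>\<^sub>F r in F. norm (L2norm a b g - L2norm a b (f r)) \<le> L2norm a b (\<lambda>x. f r x - g x)"
    using assms(1)
  proof eventually_elim
    case (elim r)
    then show ?case
      using L2norm_triangle_diff[OF elim assms(2)] L2norm_triangle_diff[OF assms(2) elim]
        L2norm_minus_commute[of a b g "f r"] by simp
  qed
qed

lemma L2_pairing_tendsto:
  assumes f: "\<forall>\<^sub>F r in F. f r \<in> L2 a b" "f0 \<in> L2 a b"
    and g: "\<forall>\<^sub>F r in F. g r \<in> L2 a b" "g0 \<in> L2 a b"
    and lim: "((\<lambda>r. L2norm a b (\<lambda>x. f r x - f0 x)) \<longlongrightarrow> 0) F"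
      "((\<lambda>r. L2norm a b (\<lambda>x. g r x - g0 x)) \<longlongrightarrow> 0) F"
  shows "((\<lambda>r. LINT x|leb a b. f r x * g r x) \<longlongrightarrow> (LINT x|leb a b. f0 x * g0 x)) F"
proof (rule Lim_transform2[OF tendsto_const], rule Lim_null_comparison)
  have "((\<lambda>r. L2norm a b (\<lambda>x. f r x - f0 x) * L2norm a b (g r) +
      L2norm a b f0 * L2norm a b (\<lambda>x. g r x - g0 x)) \<longlongrightarrow> 0 * L2norm a b g0 + L2norm a b f0 * 0) F"
    by (intro tendsto_intros lim L2norm_tendsto g)
  then show "((\<lambda>r. L2norm a b (\<lambda>x. f r x - f0 x) * L2norm a b (g r) +
      L2norm a b f0 * L2norm a b (\<lambda>x. g r x - g0 x)) \<longlongrightarrow> 0) F"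
    by simp
  show "\<forall>\<^sub>F r in F. norm ((LINT x|leb a b. f0 x * g0 x) - (LINT x|leb a b. f r x * g r x)) \<le>
      L2norm a b (\<lambda>x. f r x - f0 x) * L2norm a b (g r) +
      L2norm a b f0 * L2norm a b (\<lambda>x. g r x - g0 x)"
    using f(1) g(1)
  proof eventually_elim
    case (elim r)
    note i = L2_mult_integrable[OF L2_diff[OF elim(1) f(2)] elim(2)]
      L2_mult_integrable[OF f(2) L2_diff[OF elim(2) g(2)]]
      L2_mult_integrable[OF elim] L2_mult_integrable[OF f(2) g(2)]
    have "(LINT x|leb a b. f r x * g r x) - (LINT x|leb a b. f0 x * g0 x) =
       (LINT x|leb a b. (f r x - f0 x) * g r x) + (LINT x|leb a b. f0 x * (g r x - g0 x))"
      unfolding Bochner_Integration.integral_diff[OF i(3,4), symmetric]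
        Bochner_Integration.integral_add[OF i(1,2), symmetric]
      by (intro Bochner_Integration.integral_cong) (auto simp: algebra_simps)
    then have "norm ((LINT x|leb a b. f r x * g r x) - (LINT x|leb a b. f0 x * g0 x)) \<le>
      L2norm a b (\<lambda>x. f r x - f0 x) * L2norm a b (g r) +
      L2norm a b f0 * L2norm a b (\<lambda>x. g r x - g0 x)"
      using L2_Cauchy_Schwarz[OF L2_diff[OF elim(1) f(2)] elim(2)]
        L2_Cauchy_Schwarz[OF f(2) L2_diff[OF elim(2) g(2)]]
      by (metis (no_types, lifting) norm_triangle_le add_mono)
    then show ?case by (metis norm_minus_commute)
  qed
qed

text \<open>The Riesz-Fischer theorem. On a bounded interval a Cauchy sequence in \<open>L\<^sub>2\<close> is Cauchy in
  \<open>L\<^sub>1\<close>, so a subsequence converges almost everywhere, and Fatou's lemma turns this into convergence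
  in \<open>L\<^sub>2\<close>.\<close>

lemma L2_complete:
  fixes v :: "nat \<Rightarrow> real \<Rightarrow> complex"
  assumes v: "\<And>n. v n \<in> L2 a b"
    and Cauchy: "\<And>e. e > 0 \<Longrightarrow> \<exists>N. \<forall>i\<ge>N. \<forall>j\<ge>N. L2norm a b (\<lambda>x. v i x - v j x) < e"
  shows "\<exists>g\<in>L2 a b. (\<lambda>n. L2norm a b (\<lambda>x. v n x - g x)) \<longlonglongrightarrow> 0"
proof -
  note [measurable] = L2_measurable[OF v]
  interpret finite_measure "leb a b" by (rule finite_measure_leb)
  have one: "(\<lambda>x. 1) \<in> L2 a b" by (rule L2_continuous) auto
  define K where "K = L2norm a b (\<lambda>x. 1) + 1"
  have "K > 0" by (simp add: K_def add_nonneg_pos)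
  have L1: "(LINT x|leb a b. norm (v i x - v j x)) \<le> K * L2norm a b (\<lambda>x. v i x - v j x)" for i j
  proof -
    have "(LINT x|leb a b. norm (v i x - v j x)) \<le>
        L2norm a b (\<lambda>x. v i x - v j x) * L2norm a b (\<lambda>x. 1)"
      using L2_Cauchy_Schwarz_norm[OF L2_diff[OF v v] one, of i j] by simp
    also have "\<dots> \<le> L2norm a b (\<lambda>x. v i x - v j x) * K"
      by (intro mult_left_mono) (auto simp: K_def)
    finally show ?thesis by (simp add: mult.commute)
  qed
  have "\<exists>N. \<forall>i\<ge>N. \<forall>j\<ge>N. (LINT x|leb a b. norm (v i x - v j x)) < e" if "e > 0" for e
  proof -
    obtain N where *: "\<And>i j. i \<ge> N \<Longrightarrow> j \<ge> N \<Longrightarrow> L2norm a b (\<lambda>x. v i x - v j x) < e / K"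
      using Cauchy[of "e / K"] \<open>e > 0\<close> \<open>K > 0\<close> by auto
    show ?thesis
    proof (intro exI[of _ N] allI impI)
      fix i j assume "N \<le> i" "N \<le> j"
      then have "K * L2norm a b (\<lambda>x. v i x - v j x) < e"
        using * \<open>K > 0\<close> by (simp add: field_simps)
      then show "(LINT x|leb a b. norm (v i x - v j x)) < e"
        using L1[of i j] by linarith
    qed
  qed
  then obtain r where r: "strict_mono r" "AE x in leb a b. Cauchy (\<lambda>i. v (r i) x)"
    by (rule cauchy_L1_AE_cauchy_subseq[OF L2_integrable[OF v]])
  define g where "g = (\<lambda>x. lim (\<lambda>i. v (r i) x))"
  have [measurable]: "g \<in> borel_measurable (leb a b)"
    unfolding g_def by measurable
  have conv: "AE x in leb a b. (\<lambda>i. v (r i) x) \<longlonglongrightarrow> g x"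
    using r(2) by eventually_elim (auto simp: g_def Cauchy_convergent_iff convergent_LIMSEQ_iff)
  have Fatou: "(\<integral>\<^sup>+x. ennreal ((cmod (v n x - g x))\<^sup>2) \<partial>leb a b) \<le> ennreal (e\<^sup>2)"
    if N: "\<And>i j. i \<ge> N \<Longrightarrow> j \<ge> N \<Longrightarrow> L2norm a b (\<lambda>x. v i x - v j x) < e" and "n \<ge> N" for N n e
  proof -
    have "(\<integral>\<^sup>+x. ennreal ((cmod (v n x - g x))\<^sup>2) \<partial>leb a b) =
        (\<integral>\<^sup>+x. liminf (\<lambda>k. ennreal ((cmod (v n x - v (r k) x))\<^sup>2)) \<partial>leb a b)"
    proof (intro nn_integral_cong_AE)
      show "AE x in leb a b. ennreal ((cmod (v n x - g x))\<^sup>2) =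
          liminf (\<lambda>k. ennreal ((cmod (v n x - v (r k) x))\<^sup>2))"
        using conv
      proof eventually_elim
        case (elim x)
        have "(\<lambda>k. ennreal ((cmod (v n x - v (r k) x))\<^sup>2)) \<longlonglongrightarrow> ennreal ((cmod (v n x - g x))\<^sup>2)"
          by (intro tendsto_ennrealI tendsto_intros elim)
        from lim_imp_Liminf[OF _ this] show ?case by simp
      qed
    qed
    also have "\<dots> \<le> liminf (\<lambda>k. \<integral>\<^sup>+x. ennreal ((cmod (v n x - v (r k) x))\<^sup>2) \<partial>leb a b)"
      by (rule nn_integral_liminf) measurable
    also have "\<dots> \<le> liminf (\<lambda>k. ennreal (e\<^sup>2))"
    proof (rule Liminf_mono)
      show "\<forall>\<^sub>F k in sequentially.
          (\<integral>\<^sup>+x. ennreal ((cmod (v n x - v (r k) x))\<^sup>2) \<partial>leb a b) \<le> ennreal (e\<^sup>2)"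
        using eventually_ge_at_top[of N]
      proof eventually_elim
        case (elim k)
        then have "r k \<ge> N" using seq_suble[OF r(1), of k] by simp
        then have "L2norm a b (\<lambda>x. v n x - v (r k) x) < e" using N \<open>n \<ge> N\<close> by simp
        then have "(L2norm a b (\<lambda>x. v n x - v (r k) x))\<^sup>2 \<le> e\<^sup>2" by (intro power_mono) auto
        then show ?case
          by (subst nn_integral_eq_integral)
             (auto simp: L2norm_sq intro!: L2_integrable_norm_sq L2_diff v ennreal_leI)
      qed
    qed
    also have "\<dots> = ennreal (e\<^sup>2)" by (simp add: Liminf_const)
    finally show ?thesis .
  qed
  have diff: "(\<lambda>x. v n x - g x) \<in> L2 a b \<and> L2norm a b (\<lambda>x. v n x - g x) \<le> e"
    if N: "\<And>i j. i \<ge> N \<Longrightarrow> j \<ge> N \<Longrightarrow> L2norm a b (\<lambda>x. v i x - v j x) < e" and "n \<ge> N" and "e > 0" for N n e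
  proof
    have "integrable (leb a b) (\<lambda>x. (cmod (v n x - g x))\<^sup>2)"
      by (intro integrableI_bounded) (use Fatou[OF N \<open>n \<ge> N\<close>] in \<open>auto intro: le_less_trans\<close>)
    then show *: "(\<lambda>x. v n x - g x) \<in> L2 a b" by (simp add: L2_def)
    have "(L2norm a b (\<lambda>x. v n x - g x))\<^sup>2 \<le> e\<^sup>2"
      using Fatou[OF N \<open>n \<ge> N\<close>] nn_integral_eq_integral[OF L2_integrable_norm_sq[OF *]]
      by (simp add: L2norm_sq)
    then show "L2norm a b (\<lambda>x. v n x - g x) \<le> e"
      using \<open>e > 0\<close> power2_le_imp_le by fastforce
  qed
  obtain N where N: "\<And>i j. i \<ge> N \<Longrightarrow> j \<ge> N \<Longrightarrow> L2norm a b (\<lambda>x. v i x - v j x) < 1"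
    using Cauchy[of 1] by auto
  have "g \<in> L2 a b"
    using L2_diff[OF v[of N] conjunct1[OF diff[of N 1 N]]] N by simp
  moreover have "(\<lambda>n. L2norm a b (\<lambda>x. v n x - g x)) \<longlonglongrightarrow> 0"
  proof (rule LIMSEQ_I)
    fix e :: real assume "e > 0"
    then obtain N where N: "\<And>i j. i \<ge> N \<Longrightarrow> j \<ge> N \<Longrightarrow> L2norm a b (\<lambda>x. v i x - v j x) < e / 2"
      using Cauchy[of "e / 2"] by auto
    show "\<exists>N. \<forall>n\<ge>N. norm (L2norm a b (\<lambda>x. v n x - g x) - 0) < e"
      using diff[OF N] \<open>e > 0\<close> by (intro exI[of _ N]) (auto intro: le_less_trans[where y = "e / 2"])
  qed
  ultimately show ?thesis by blast
qed

section \<open>Absolutely continuous representatives\<close>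

lemma borel_measurable_leb_ident [measurable]: "(\<lambda>x. x) \<in> borel_measurable (leb a b)"
  by (rule continuous_imp_measurable_on_sets_lebesgue) auto

lemma AE_leb_neq: "AE y in leb a b. y \<noteq> x"
proof -
  have "{x} \<in> null_sets lebesgue" by (simp flip: negligible_iff_null_sets)
  from AE_not_in[OF this] show ?thesis by (auto simp: AE_restrict_space_iff elim: eventually_mono)
qed

text \<open>This connects the Lebesgue integral over the open interval with the gauge integral over
  closed subintervals, for which the differentiability and continuity theorems are stated.\<close>

lemma LINT_indicator_interval:
  fixes h :: "real \<Rightarrow> complex"
  assumes h: "integrable (leb a b) h" and cd: "{c<..<d} \<subseteq> {a<..<b}"
  shows "(LINT x|leb a b. indicator {c<..<d} x * h x) = integral {c..d} h"
    and "h integrable_on {c..d}"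
proof -
  have ind: "indicator {a<..<b} x *\<^sub>R (indicator {c<..<d} x * h x) =
      (indicator {c<..<d} x *\<^sub>R h x :: complex)" for x
    using cd by (auto simp: indicator_def)
  have i: "integrable (leb a b) (\<lambda>x. indicator {c<..<d} x *\<^sub>R h x)"
    by (rule integrable_mult_indicator) (use h cd in \<open>auto simp: sets_restrict_space_iff\<close>)
  have ind2: "indicator {a<..<b} x *\<^sub>R (indicator {c<..<d} x *\<^sub>R h x) = indicator {c<..<d} x *\<^sub>R h x" for x
    using cd by (auto simp: indicator_def)
  from i have "integrable lebesgue (\<lambda>x. indicator {a<..<b} x *\<^sub>R (indicator {c<..<d} x *\<^sub>R h x))"
    by (subst (asm) integrable_restrict_space) auto
  then have "integrable (leb c d) h"
    unfolding ind2 by (subst integrable_restrict_space) auto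
  moreover have "(LINT x|leb a b. indicator {c<..<d} x * h x) = (LINT x|leb c d. h x)"
    using ind by (subst (1 2) integral_restrict_space) auto
  moreover have "integral {c<..<d} h = integral {c..d} h"
    using integral_open_interval[of c d h] by (simp add: box_real)
  moreover have "h integrable_on {c<..<d} \<Longrightarrow> h integrable_on {c..d}"
    using integrable_on_open_interval[of h c d] by (simp add: box_real)
  ultimately show "(LINT x|leb a b. indicator {c<..<d} x * h x) = integral {c..d} h"
    "h integrable_on {c..d}"
    using lebesgue_integral_eq_integral[of "{c<..<d}" h] integrable_on_lebesgue_on[of "{c<..<d}" h] by auto
qed

text \<open>At almost every point a function is the limit of its averages over small intervals.\<close>

lemma AE_zero_if_interval_integrals_zero:
  fixes h :: "real \<Rightarrow> complex"
  assumes h: "integrable (leb a b) h"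
    and zero: "\<And>c d. a < c \<Longrightarrow> c < d \<Longrightarrow> d < b \<Longrightarrow> integral {c..d} h = 0"
  shows "AE x in leb a b. h x = 0"
proof -
  define H where "H x = (if x \<in> {a<..<b} then h x else 0)" for x
  have "h integrable_on {a<..<b}"
    by (rule integrable_on_lebesgue_on[OF h]) auto
  then have "H integrable_on UNIV"
    unfolding H_def by (simp only: integrable_restrict_UNIV)
  then have "H integrable_on cbox u v" for u v
    by (rule integrable_on_subcbox) auto
  then obtain N where N: "negligible N"
    "\<And>x e. x \<notin> N \<Longrightarrow> 0 < e \<Longrightarrow> \<exists>d>0. \<forall>k. 0 < k \<and> k < d \<longrightarrow>
        norm (integral (cbox x (x + k *\<^sub>R One)) H /\<^sub>R k ^ DIM(real) - H x) < e"
    using integrable_ccontinuous_explicit by metis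
  have "h x = 0" if x: "x \<in> {a<..<b}" "x \<notin> N" for x
  proof (rule ccontr)
    assume "h x \<noteq> 0"
    then obtain d where d: "d > 0" "\<And>k. 0 < k \<Longrightarrow> k < d \<Longrightarrow>
        norm (integral (cbox x (x + k *\<^sub>R One)) H /\<^sub>R k ^ DIM(real) - H x) < norm (h x)"
      using N(2)[OF x(2), of "norm (h x)"] by auto
    \<comment> \<open>An interval \<open>[x, x + k]\<close> that is short enough for the average and stays inside \<open>(a, b)\<close>.\<close>
    define k where "k = min d (b - x) / 2"
    have k: "0 < k" "k < d" "x + k < b"
      using d(1) x(1) by (auto simp: k_def min_def field_simps)
    have "integral (cbox x (x + k *\<^sub>R One)) H = integral {x..x + k} h"
      using k x(1) by (auto simp: H_def intro!: integral_cong)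
    also have "\<dots> = 0" using zero[of x "x + k"] k x(1) by auto
    finally show False using d(2)[OF k(1,2)] x(1) by (auto simp: H_def)
  qed
  then have "AE x in lebesgue. x \<in> {a<..<b} \<longrightarrow> h x = 0"
    using AE_not_in[of N lebesgue] N(1) by (auto simp: negligible_iff_null_sets elim: eventually_mono)
  then show ?thesis
    by (simp add: AE_restrict_space_iff)
qed

lemma test_functions_L2: "\<phi> \<in> test_functions a b \<Longrightarrow> \<phi> \<in> L2 a b"
  by (intro L2_continuous smooth_imp_continuous_on test_functions_smooth)

lemma bump_pairing_tendsto:
  fixes h :: "real \<Rightarrow> complex"
  assumes h: "integrable (leb a b) h" and cd: "a < c" "d < b"
  shows "(\<lambda>n. LINT x|leb a b. h x * of_real (bump c d n x)) \<longlonglongrightarrow> integral {c..d} h"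
proof -
  have [measurable]: "h \<in> borel_measurable (leb a b)" using h by simp
  have [measurable]: "(\<lambda>x. complex_of_real (bump c d n x)) \<in> borel_measurable (leb a b)" for n
    by (rule L2_measurable[OF test_functions_L2[OF bump_test_function[OF cd]]])
  have "(\<lambda>n. LINT x|leb a b. h x * of_real (bump c d n x)) \<longlonglongrightarrow>
      (LINT x|leb a b. h x * of_real (indicator {c<..<d} x))"
  proof (rule integral_dominated_convergence[where w = "\<lambda>x. norm (h x)"])
    show "AE x in leb a b. (\<lambda>n. h x * of_real (bump c d n x)) \<longlonglongrightarrow> h x * of_real (indicator {c<..<d} x)"
      by (intro AE_I2 tendsto_intros bump_tendsto)
    show "AE x in leb a b. norm (h x * of_real (bump c d n x)) \<le> norm (h x)" for n
      using bump_bounds[of c d n] by (intro AE_I2) (simp add: norm_mult mult_left_le)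
    have "integrable (leb a b) (\<lambda>x. indicator {c<..<d} x *\<^sub>R h x)"
      by (rule integrable_mult_indicator) (use h cd in \<open>auto simp: sets_restrict_space_iff\<close>)
    then show "(\<lambda>x. h x * complex_of_real (indicator {c<..<d} x)) \<in> borel_measurable (leb a b)"
      by (simp add: scaleR_conv_of_real mult.commute)
  qed (use h in auto)
  also have "(LINT x|leb a b. h x * of_real (indicator {c<..<d} x)) =
      (LINT x|leb a b. indicator {c<..<d} x * h x)"
    by (intro Bochner_Integration.integral_cong) (auto simp: indicator_def)
  also have "\<dots> = integral {c..d} h"
    using cd by (intro LINT_indicator_interval h) auto
  finally show ?thesis .
qed

text \<open>The bumps converge boundedly to indicators of intervals, so testing with them shows that all
  interval integrals of \<open>h\<close> vanish.\<close>

lemma fundamental_lemma_variations: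
  assumes h: "integrable (leb a b) h"
    and zero: "\<And>\<phi>. \<phi> \<in> test_functions a b \<Longrightarrow> (LINT x|leb a b. h x * \<phi> x) = 0"
  shows "AE x in leb a b. h x = 0"
proof (rule AE_zero_if_interval_integrals_zero[OF h])
  fix c d assume cd: "a < c" "c < d" "d < b"
  have vanish: "(LINT x|leb a b. h x * of_real (bump c d n x)) = 0" for n
    by (rule zero[OF bump_test_function[OF cd(1,3)]])
  have "(\<lambda>n::nat. 0) \<longlonglongrightarrow> integral {c..d} h"
    using bump_pairing_tendsto[OF h cd(1,3)] unfolding vanish .
  from LIMSEQ_unique[OF this tendsto_const] show "integral {c..d} h = 0" .
qed

text \<open>The indicator under the integral makes products of primitives accessible to Fubini's
  theorem.\<close>

definition primitive :: "real \<Rightarrow> real \<Rightarrow> (real \<Rightarrow> complex) \<Rightarrow> real \<Rightarrow> complex" where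
  "primitive a b g x = (LINT y|leb a b. indicator {..<x} y * g y)"

lemma primitive_eq_integral:
  assumes g: "integrable (leb a b) g" and x: "x \<in> {a..b}"
  shows "primitive a b g x = integral {a..x} g"
proof -
  have "primitive a b g x = (LINT y|leb a b. indicator {a<..<x} y * g y)"
    unfolding primitive_def by (intro Bochner_Integration.integral_cong) (auto simp: indicator_def)
  moreover have "{a<..<x} \<subseteq> {a<..<b}"
    using x by auto
  ultimately show ?thesis
    using LINT_indicator_interval(1)[OF g, of a x] by simp
qed

lemma primitive_continuous:
  assumes "integrable (leb a b) g"
  shows "continuous_on {a..b} (primitive a b g)"
proof -
  have "continuous_on {a..b} (\<lambda>x. integral {a..x} g)"
    by (intro indefinite_integral_continuous_1 LINT_indicator_interval(2)[OF assms]) simp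
  then show ?thesis
    by (rule continuous_on_eq) (rule primitive_eq_integral[OF assms, symmetric])
qed

lemma primitive_left: "primitive a b g a = 0"
proof -
  have "primitive a b g a = (LINT y|leb a b. 0)"
    unfolding primitive_def by (intro Bochner_Integration.integral_cong) (auto simp: indicator_def)
  then show ?thesis by simp
qed

lemma primitive_right: "primitive a b g b = (LINT y|leb a b. g y)"
  unfolding primitive_def by (intro Bochner_Integration.integral_cong) (auto simp: indicator_def)

lemma primitive_L2: "g \<in> L2 a b \<Longrightarrow> primitive a b g \<in> L2 a b"
  by (rule L2_continuous[OF primitive_continuous[OF L2_integrable]])

text \<open>The two summands are the integrals of \<open>f(x) g(y)\<close> over the triangles \<open>y < x\<close> and \<open>x < y\<close>.
  Together these exhaust the square up to the diagonal, which is a null set.\<close>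

lemma primitive_product_integral:
  assumes f: "f \<in> L2 a b" and g: "g \<in> L2 a b"
  shows "(LINT x|leb a b. f x * primitive a b g x) + (LINT x|leb a b. primitive a b f x * g x) =
     (LINT x|leb a b. f x) * (LINT x|leb a b. g x)"
proof -
  interpret finite_measure "leb a b" by (rule finite_measure_leb)
  interpret pair_sigma_finite "leb a b" "leb a b" ..
  note fi = L2_integrable[OF f] and gi = L2_integrable[OF g]
  note [measurable] = L2_measurable[OF f] L2_measurable[OF g]
  define k where "k = (\<lambda>x y. indicator {..<y} x * f x * g y)"
  have gind: "integrable (leb a b) (\<lambda>y. indicator {..<x} y * g y)"
    "integrable (leb a b) (\<lambda>y. indicator {x<..} y * g y)" for x
    by (rule Bochner_Integration.integrable_bound[OF gi]; auto simp: indicator_def intro!: measurable_If)+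
  have k: "integrable (leb a b \<Otimes>\<^sub>M leb a b) (case_prod k)"
  proof (rule Fubini_integrable)
    have "case_prod k = (\<lambda>p. (if fst p < snd p then 1 else 0) * f (fst p) * g (snd p))"
      by (auto simp: k_def indicator_def)
    then show [measurable]: "case_prod k \<in> borel_measurable (leb a b \<Otimes>\<^sub>M leb a b)"
      by simp
    show "AE x in leb a b. integrable (leb a b) (\<lambda>y. case_prod k (x, y))"
    proof (intro AE_I2)
      fix x
      have "integrable (leb a b) (\<lambda>y. f x * (indicator {x<..} y * g y))"
        by (intro integrable_mult_right gind)
      then show "integrable (leb a b) (\<lambda>y. case_prod k (x, y))"
        by (simp add: k_def indicator_def mult_ac)
    qed
    show "integrable (leb a b) (\<lambda>x. LINT y|leb a b. norm (case_prod k (x, y)))"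
    proof (rule Bochner_Integration.integrable_bound)
      show "integrable (leb a b) (\<lambda>x. norm (f x) * (LINT y|leb a b. norm (g y)))"
        using fi by auto
      show "AE x in leb a b. norm (LINT y|leb a b. norm (case_prod k (x, y))) \<le>
          norm (norm (f x) * (LINT y|leb a b. norm (g y)))"
      proof (intro AE_I2)
        fix x
        have "(LINT y|leb a b. norm (case_prod k (x, y))) \<le> (LINT y|leb a b. norm (f x) * norm (g y))"
          using gi by (intro integral_mono_AE') (auto simp: k_def norm_mult indicator_def)
        then show "norm (LINT y|leb a b. norm (case_prod k (x, y))) \<le>
          norm (norm (f x) * (LINT y|leb a b. norm (g y)))"
          by simp
      qed
    qed measurable
  qed
  have "(LINT y|leb a b. primitive a b f y * g y) = (LINT y|leb a b. LINT x|leb a b. k x y)"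
    by (simp add: primitive_def k_def)
  also have "\<dots> = (LINT x|leb a b. LINT y|leb a b. k x y)"
    by (rule Fubini_integral[OF k])
  also have "\<dots> = (LINT x|leb a b. f x * (LINT y|leb a b. indicator {x<..} y * g y))"
    unfolding integral_mult_right_zero[symmetric]
    by (intro Bochner_Integration.integral_cong) (auto simp: k_def indicator_def)
  finally have swap: "(LINT x|leb a b. primitive a b f x * g x) =
      (LINT x|leb a b. f x * (LINT y|leb a b. indicator {x<..} y * g y))" .
  have split: "(LINT y|leb a b. indicator {x<..} y * g y) = (LINT y|leb a b. g y) - primitive a b g x" for x
  proof -
    have "(LINT y|leb a b. indicator {x<..} y * g y) + primitive a b g x =
        (LINT y|leb a b. indicator {x<..} y * g y + indicator {..<x} y * g y)"
      unfolding primitive_def using gind by simp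
    also have "\<dots> = (LINT y|leb a b. g y)"
      using AE_leb_neq[of x a b] gind[of x]
      by (intro integral_cong_AE) (auto simp: indicator_def elim!: eventually_mono)
    finally show ?thesis by (simp add: algebra_simps)
  qed
  have "(LINT x|leb a b. primitive a b f x * g x) =
      (LINT x|leb a b. f x * (LINT y|leb a b. g y) - f x * primitive a b g x)"
    unfolding swap split by (simp add: algebra_simps)
  also have "\<dots> = (LINT x|leb a b. f x) * (LINT y|leb a b. g y) - (LINT x|leb a b. f x * primitive a b g x)"
    using fi L2_mult_integrable[OF f primitive_L2[OF g]] by simp
  finally show ?thesis by simp
qed

text \<open>That is, \<open>F\<close> is absolutely continuous on \<open>[a, b]\<close> with a square integrable derivative \<open>f\<close>.\<close>

definition is_primitive :: "real \<Rightarrow> real \<Rightarrow> (real \<Rightarrow> complex) \<Rightarrow> (real \<Rightarrow> complex) \<Rightarrow> bool" where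
  "is_primitive a b F f \<longleftrightarrow> f \<in> L2 a b \<and> (\<forall>x\<in>{a..b}. F x = F a + primitive a b f x)"

lemma is_primitive_continuous:
  assumes "is_primitive a b F f" shows "continuous_on {a..b} F"
proof -
  have "continuous_on {a..b} (\<lambda>x. F a + primitive a b f x)"
    using assms by (intro continuous_intros primitive_continuous L2_integrable) (simp add: is_primitive_def)
  then show ?thesis
    using assms unfolding is_primitive_def by (metis (mono_tags, lifting) continuous_on_cong)
qed

lemma is_primitive_L2: "is_primitive a b F f \<Longrightarrow> F \<in> L2 a b"
  by (intro L2_continuous is_primitive_continuous)

lemma is_primitive_by_parts:
  assumes "a \<le> b" and F: "is_primitive a b F f" and G: "is_primitive a b G g"
  shows "(LINT x|leb a b. f x * G x + F x * g x) = F b * G b - F a * G a"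
proof -
  have f: "f \<in> L2 a b" and g: "g \<in> L2 a b"
    using F G by (auto simp: is_primitive_def)
  have Fx: "F x = F a + primitive a b f x" and Gx: "G x = G a + primitive a b g x" if "x \<in> {a..b}" for x
    using F G that unfolding is_primitive_def by blast+
  have Fb: "F b = F a + (LINT x|leb a b. f x)" and Gb: "G b = G a + (LINT x|leb a b. g x)"
    using Fx[of b] Gx[of b] assms(1) by (auto simp: primitive_right)
  have "(LINT x|leb a b. f x * G x + F x * g x) =
    (LINT x|leb a b. (G a * f x + F a * g x) + (f x * primitive a b g x + primitive a b f x * g x))"
  proof (intro Bochner_Integration.integral_cong refl)
    fix x assume "x \<in> space (leb a b)"
    then have x: "x \<in> {a..b}" by simp
    show "f x * G x + F x * g x =
        (G a * f x + F a * g x) + (f x * primitive a b g x + primitive a b f x * g x)"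
      unfolding Fx[OF x] Gx[OF x] by (simp add: algebra_simps)
  qed
  also have "\<dots> = G a * (LINT x|leb a b. f x) + F a * (LINT x|leb a b. g x) +
      ((LINT x|leb a b. f x * primitive a b g x) + (LINT x|leb a b. primitive a b f x * g x))"
    using f g L2_mult_integrable[OF f primitive_L2[OF g]] L2_mult_integrable[OF primitive_L2[OF f] g]
    by (simp add: L2_integrable)
  also have "\<dots> = F b * G b - F a * G a"
    unfolding primitive_product_integral[OF f g] Fb Gb by (simp add: algebra_simps)
  finally show ?thesis .
qed

lemma is_primitive_smooth:
  assumes "smooth \<phi>'" "\<And>x. (\<phi> has_vector_derivative \<phi>' x) (at x)"
  shows "is_primitive a b \<phi> \<phi>'"
  unfolding is_primitive_def
proof (intro conjI ballI)
  show L2: "\<phi>' \<in> L2 a b"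
    by (intro L2_continuous smooth_imp_continuous_on assms)
  fix x assume x: "x \<in> {a..b}"
  have "(\<phi>' has_integral (\<phi> x - \<phi> a)) {a..x}"
    using x assms(2) by (intro fundamental_theorem_of_calculus) (auto intro: has_vector_derivative_at_within)
  then show "\<phi> x = \<phi> a + primitive a b \<phi>' x"
    using primitive_eq_integral[OF L2_integrable[OF L2] x] by (simp add: integral_unique)
qed

section \<open>Weak derivatives and traces\<close>

lemma has_weak_deriv_L2: "has_weak_deriv a b f g \<Longrightarrow> f \<in> L2 a b" "has_weak_deriv a b f g \<Longrightarrow> g \<in> L2 a b"
  by (auto simp: has_weak_deriv_def)

lemma has_weak_deriv_test:
  assumes "has_weak_deriv a b f g" "\<phi> \<in> test_functions a b" "\<And>x. (\<phi> has_vector_derivative \<phi>' x) (at x)"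
  shows "(LINT x|leb a b. f x * \<phi>' x) = - (LINT x|leb a b. g x * \<phi> x)"
proof -
  have "vector_derivative \<phi> (at x) = \<phi>' x" for x
    by (rule vector_derivative_at[OF assms(3)])
  moreover have "(LINT x|leb a b. f x * vector_derivative \<phi> (at x)) = - (LINT x|leb a b. g x * \<phi> x)"
    using assms(1,2) by (simp add: has_weak_deriv_def)
  ultimately show ?thesis by simp
qed

lemma has_weak_derivI:
  assumes "f \<in> L2 a b" "g \<in> L2 a b"
    and "\<And>\<phi> \<phi>'. \<phi> \<in> test_functions a b \<Longrightarrow> \<phi>' \<in> test_functions a b \<Longrightarrow>
        (\<And>x. (\<phi> has_vector_derivative \<phi>' x) (at x)) \<Longrightarrow>
        (LINT x|leb a b. f x * \<phi>' x) = - (LINT x|leb a b. g x * \<phi> x)"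
  shows "has_weak_deriv a b f g"
  unfolding has_weak_deriv_def
proof (intro conjI ballI assms(1,2))
  fix \<phi> assume \<phi>: "\<phi> \<in> test_functions a b"
  then obtain \<phi>' where \<phi>': "\<phi>' \<in> test_functions a b" "\<And>x. (\<phi> has_vector_derivative \<phi>' x) (at x)"
    using test_functions_derivative by blast
  then have "(\<lambda>x. vector_derivative \<phi> (at x)) = \<phi>'"
    by (intro ext vector_derivative_at)
  then show "(LINT x|leb a b. f x * vector_derivative \<phi> (at x)) = - (LINT x|leb a b. g x * \<phi> x)"
    using assms(3)[OF \<phi> \<phi>'] by (simp add: fun_eq_iff)
qed

text \<open>The lemma of du Bois-Reymond. Subtracting from a test function a multiple of a fixed one
  makes the mean zero, and the difference is then the derivative of a test function. Hence \<open>h\<close> pairs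
  with every test function as a constant does.\<close>

lemma weakly_constant_imp_constant:
  assumes "a < b" and h: "h \<in> L2 a b"
    and zero: "\<And>\<phi> \<phi>'. \<phi> \<in> test_functions a b \<Longrightarrow> \<phi>' \<in> test_functions a b \<Longrightarrow>
        (\<And>x. (\<phi> has_vector_derivative \<phi>' x) (at x)) \<Longrightarrow> (LINT x|leb a b. h x * \<phi>' x) = 0"
  obtains c where "AE x in leb a b. h x = c"
proof -
  \<comment> \<open>Some bump on the middle third has nonzero mean, because the means tend to its length.\<close>
  define u v where "u = (2 * a + b) / 3" and "v = (a + 2 * b) / 3"
  have uv: "a < u" "u < v" "v < b" using \<open>a < b\<close> by (auto simp: u_def v_def)
  have "(\<lambda>n. LINT x|leb a b. 1 * of_real (bump u v n x)) \<longlonglongrightarrow> integral {u..v} (\<lambda>x. 1::complex)"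
    using uv by (intro bump_pairing_tendsto L2_integrable L2_continuous) auto
  moreover have "integral {u..v} (\<lambda>x. 1::complex) \<noteq> 0"
    using uv by (simp add: scaleR_conv_of_real)
  ultimately have "\<forall>\<^sub>F n in sequentially. (LINT x|leb a b. 1 * complex_of_real (bump u v n x)) \<noteq> 0"
    by (rule tendsto_imp_eventually_ne)
  then obtain n where n: "(LINT x|leb a b. 1 * complex_of_real (bump u v n x)) \<noteq> 0"
    using eventually_happens sequentially_bot by blast
  define \<rho> where "\<rho> x = complex_of_real (bump u v n x)" for x
  define I where "I = (LINT x|leb a b. \<rho> x)"
  define c where "c = (LINT x|leb a b. h x * \<rho> x) / I"
  have \<rho>: "\<rho> \<in> test_functions a b"
    unfolding \<rho>_def by (rule bump_test_function[OF uv(1,3)])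
  have I: "I \<noteq> 0" using n by (simp add: I_def \<rho>_def)
  have "(LINT x|leb a b. (h x - c) * \<psi> x) = 0" if \<psi>: "\<psi> \<in> test_functions a b" for \<psi>
  proof -
    \<comment> \<open>This multiple of \<open>\<rho>\<close> has the same mean as \<open>\<psi>\<close>.\<close>
    define m where "m = (LINT x|leb a b. \<psi> x) / I"
    have m\<rho>: "(\<lambda>x. m * \<rho> x) \<in> test_functions a b"
      by (rule test_functions_mult[OF smooth_const \<rho>])
    note \<chi> = test_functions_diff[OF \<psi> m\<rho>]
    have L2s: "\<psi> \<in> L2 a b" "\<rho> \<in> L2 a b" "(\<lambda>x. m * \<rho> x) \<in> L2 a b"
      by (rule test_functions_L2, fact)+
    have "integral {a..b} (\<lambda>x. \<psi> x - m * \<rho> x) = (LINT x|leb a b. \<psi> x - m * \<rho> x)"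
      using primitive_eq_integral[OF L2_integrable[OF test_functions_L2[OF \<chi>]], of b] \<open>a < b\<close>
      by (simp add: primitive_right)
    also have "\<dots> = (LINT x|leb a b. \<psi> x) - m * I"
      using L2s by (simp add: I_def L2_integrable)
    also have "\<dots> = 0" using I by (simp add: m_def)
    finally obtain \<phi> where "\<phi> \<in> test_functions a b"
      "\<And>x. (\<phi> has_vector_derivative \<psi> x - m * \<rho> x) (at x)"
      using test_functions_antiderivative[OF \<chi>] by blast
    then have "0 = (LINT x|leb a b. h x * (\<psi> x - m * \<rho> x))"
      using zero[OF _ \<chi>] by simp
    also have "\<dots> = (LINT x|leb a b. h x * \<psi> x - m * (h x * \<rho> x))"
      by (simp add: algebra_simps)
    also have "\<dots> = (LINT x|leb a b. h x * \<psi> x) - m * (LINT x|leb a b. h x * \<rho> x)"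
      using L2_mult_integrable[OF h L2s(1)] L2_mult_integrable[OF h L2s(2)] by simp
    finally have "(LINT x|leb a b. h x * \<psi> x) = m * (LINT x|leb a b. h x * \<rho> x)" by simp
    also have "\<dots> = c * (LINT x|leb a b. \<psi> x)" by (simp add: m_def c_def)
    finally show ?thesis
      using L2_mult_integrable[OF h L2s(1)] L2s(1) by (simp add: left_diff_distrib L2_integrable)
  qed
  then have "AE x in leb a b. h x - c = 0"
    by (intro fundamental_lemma_variations L2_integrable L2_diff h L2_continuous) auto
  then show thesis using that by auto
qed

lemma is_primitive_imp_has_weak_deriv:
  assumes "a \<le> b" "is_primitive a b F f"
  shows "has_weak_deriv a b F f"
proof (rule has_weak_derivI)
  show f: "f \<in> L2 a b" using assms by (simp add: is_primitive_def)
  show F: "F \<in> L2 a b" by (rule is_primitive_L2[OF assms(2)])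
  fix \<phi> \<phi>' assume \<phi>: "\<phi> \<in> test_functions a b" "\<phi>' \<in> test_functions a b"
    "\<And>x. (\<phi> has_vector_derivative \<phi>' x) (at x)"
  have "\<phi> a = 0" "\<phi> b = 0"
    using \<phi>(1) by (fastforce simp: test_functions_iff)+
  moreover have "is_primitive a b \<phi> \<phi>'"
    by (rule is_primitive_smooth[OF test_functions_smooth[OF \<phi>(2)] \<phi>(3)])
  ultimately have "(LINT x|leb a b. f x * \<phi> x + F x * \<phi>' x) = 0"
    using is_primitive_by_parts[OF assms] by simp
  then show "(LINT x|leb a b. F x * \<phi>' x) = - (LINT x|leb a b. f x * \<phi> x)"
    using L2_mult_integrable[OF f test_functions_L2[OF \<phi>(1)]]
      L2_mult_integrable[OF F test_functions_L2[OF \<phi>(2)]]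
    by (simp add: add_eq_0_iff)
qed

text \<open>The difference of \<open>f\<close> and the primitive of its weak derivative is weakly constant.\<close>

lemma has_weak_deriv_representative:
  assumes "a < b" and fg: "has_weak_deriv a b f g"
  obtains F where "is_primitive a b F g" "AE x in leb a b. F x = f x"
proof -
  note L2s = has_weak_deriv_L2[OF fg]
  have P: "is_primitive a b (primitive a b g) g"
    by (simp add: is_primitive_def L2s primitive_left)
  note PL2 = is_primitive_L2[OF P]
  obtain c where c: "AE x in leb a b. f x - primitive a b g x = c"
  proof (rule weakly_constant_imp_constant[OF \<open>a < b\<close>, of "\<lambda>x. f x - primitive a b g x"])
    show "(\<lambda>x. f x - primitive a b g x) \<in> L2 a b"
      by (rule L2_diff[OF L2s(1) PL2])
    fix \<phi> \<phi>' assume \<phi>: "\<phi> \<in> test_functions a b" "\<phi>' \<in> test_functions a b"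
      "\<And>x. (\<phi> has_vector_derivative \<phi>' x) (at x)"
    have "(LINT x|leb a b. (f x - primitive a b g x) * \<phi>' x) =
        (LINT x|leb a b. f x * \<phi>' x) - (LINT x|leb a b. primitive a b g x * \<phi>' x)"
      using L2_mult_integrable[OF L2s(1) test_functions_L2[OF \<phi>(2)]]
        L2_mult_integrable[OF PL2 test_functions_L2[OF \<phi>(2)]]
      by (simp add: left_diff_distrib)
    also have "\<dots> = 0"
      using has_weak_deriv_test[OF fg \<phi>(1,3)] \<open>a < b\<close>
        has_weak_deriv_test[OF is_primitive_imp_has_weak_deriv[OF _ P] \<phi>(1,3)] by simp
    finally show "(LINT x|leb a b. (f x - primitive a b g x) * \<phi>' x) = 0" .
  qed
  show thesis
  proof
    show "is_primitive a b (\<lambda>x. c + primitive a b g x) g"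
      by (simp add: is_primitive_def L2s primitive_left)
    show "AE x in leb a b. c + primitive a b g x = f x"
      using c by eventually_elim (auto simp: algebra_simps)
  qed
qed

lemma has_weak_deriv_unique:
  assumes "has_weak_deriv a b f g" "has_weak_deriv a b f g'"
  shows "AE x in leb a b. g x = g' x"
proof -
  note L2s = has_weak_deriv_L2[OF assms(1)] has_weak_deriv_L2[OF assms(2)]
  have "(LINT x|leb a b. (g x - g' x) * \<phi> x) = 0" if \<phi>: "\<phi> \<in> test_functions a b" for \<phi>
  proof -
    obtain \<phi>' where "\<And>x. (\<phi> has_vector_derivative \<phi>' x) (at x)"
      using test_functions_derivative[OF \<phi>] by blast
    then have "(LINT x|leb a b. g x * \<phi> x) = (LINT x|leb a b. g' x * \<phi> x)"
      using has_weak_deriv_test[OF assms(1) \<phi>] has_weak_deriv_test[OF assms(2) \<phi>] by fastforce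
    then show ?thesis
      using L2_mult_integrable[OF L2s(2) test_functions_L2[OF \<phi>]]
        L2_mult_integrable[OF L2s(4) test_functions_L2[OF \<phi>]]
      by (simp add: left_diff_distrib)
  qed
  then have "AE x in leb a b. g x - g' x = 0"
    by (intro fundamental_lemma_variations L2_integrable L2_diff L2s) auto
  then show ?thesis by simp
qed

lemma has_weak_deriv_weak_deriv: "f \<in> H1 a b \<Longrightarrow> has_weak_deriv a b f (weak_deriv a b f)"
  unfolding H1_def weak_deriv_def by (simp add: someI_ex)

lemma has_weak_deriv_H1: "has_weak_deriv a b f g \<Longrightarrow> f \<in> H1 a b"
  by (auto simp: H1_def)

lemma weak_deriv_AE_eq:
  assumes "has_weak_deriv a b f g"
  shows "AE x in leb a b. weak_deriv a b f x = g x"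
  by (rule has_weak_deriv_unique[OF has_weak_deriv_weak_deriv[OF has_weak_deriv_H1[OF assms]] assms])

lemma L2norm_weak_deriv:
  assumes "has_weak_deriv a b f g"
  shows "L2norm a b (weak_deriv a b f) = L2norm a b g"
  using weak_deriv_AE_eq[OF assms] has_weak_deriv_L2(2) assms
    has_weak_deriv_weak_deriv[OF has_weak_deriv_H1[OF assms]] by (blast intro: L2norm_cong_AE)

lemma has_weak_deriv_cong:
  assumes "has_weak_deriv a b f g" "AE x in leb a b. f x = f2 x" "f2 \<in> L2 a b"
  shows "has_weak_deriv a b f2 g"
proof (rule has_weak_derivI)
  show "g \<in> L2 a b" using assms(1) has_weak_deriv_L2 by blast
  fix \<phi> \<phi>' assume \<phi>: "\<phi> \<in> test_functions a b" "\<phi>' \<in> test_functions a b"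
      "\<And>x. (\<phi> has_vector_derivative \<phi>' x) (at x)"
  note [measurable] = L2_measurable[OF assms(3)] L2_measurable[OF has_weak_deriv_L2(1)[OF assms(1)]]
     L2_measurable[OF test_functions_L2[OF \<phi>(2)]]
  have "(LINT x|leb a b. f2 x * \<phi>' x) = (LINT x|leb a b. f x * \<phi>' x)"
    using assms(2) by (intro integral_cong_AE) auto
  then show "(LINT x|leb a b. f2 x * \<phi>' x) = - (LINT x|leb a b. g x * \<phi> x)"
    using has_weak_deriv_test[OF assms(1) \<phi>(1,3)] by simp
qed (fact assms)

lemma has_weak_deriv_add:
  assumes f: "has_weak_deriv a b f f'" and g: "has_weak_deriv a b g g'"
  shows "has_weak_deriv a b (\<lambda>x. f x + g x) (\<lambda>x. f' x + g' x)"
proof (rule has_weak_derivI)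
  note L2s = has_weak_deriv_L2[OF f] has_weak_deriv_L2[OF g]
  show "(\<lambda>x. f x + g x) \<in> L2 a b" "(\<lambda>x. f' x + g' x) \<in> L2 a b"
    by (intro L2_add L2s)+
  fix \<phi> \<phi>' assume \<phi>: "\<phi> \<in> test_functions a b" "\<phi>' \<in> test_functions a b"
      "\<And>x. (\<phi> has_vector_derivative \<phi>' x) (at x)"
  note i = L2_mult_integrable[OF _ test_functions_L2[OF \<phi>(1)]]
     L2_mult_integrable[OF _ test_functions_L2[OF \<phi>(2)]]
  show "(LINT x|leb a b. (f x + g x) * \<phi>' x) = - (LINT x|leb a b. (f' x + g' x) * \<phi> x)"
    using has_weak_deriv_test[OF f \<phi>(1,3)] has_weak_deriv_test[OF g \<phi>(1,3)]
    by (simp add: distrib_right i L2s)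
qed

text \<open>The factor is moved onto the test function, which stays a test function because affine
  functions are smooth.\<close>

lemma has_weak_deriv_mult_affine:
  assumes f: "has_weak_deriv a b f f'"
  shows "has_weak_deriv a b (\<lambda>x. of_real (c * x + d) * f x)
           (\<lambda>x. of_real c * f x + of_real (c * x + d) * f' x)"
proof (rule has_weak_derivI)
  note L2s = has_weak_deriv_L2[OF f]
  show "(\<lambda>x. of_real (c * x + d) * f x) \<in> L2 a b"
    "(\<lambda>x. of_real c * f x + of_real (c * x + d) * f' x) \<in> L2 a b"
    by (intro L2_add L2_mult_affine L2_cmult L2s)+
  fix \<phi> \<phi>' assume \<phi>: "\<phi> \<in> test_functions a b" "\<phi>' \<in> test_functions a b"
      "\<And>x. (\<phi> has_vector_derivative \<phi>' x) (at x)"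
  define q where "q = (\<lambda>x. complex_of_real (c * x + d))"
  have q: "(q has_vector_derivative of_real c) (at x)" for x
    unfolding q_def by (intro has_vector_derivative_of_real) (auto intro!: derivative_eq_intros)
  note q\<phi> = test_functions_mult[OF smooth_affine \<phi>(1), of c d]
  have "((\<lambda>x. q x * \<phi> x) has_vector_derivative q x * \<phi>' x + of_real c * \<phi> x) (at x)" for x
    by (intro has_vector_derivative_mult q \<phi>(3))
  from has_weak_deriv_test[OF f q\<phi> this[unfolded q_def]]
  have "(LINT x|leb a b. f x * (q x * \<phi>' x + of_real c * \<phi> x)) = - (LINT x|leb a b. f' x * (q x * \<phi> x))"
    by (simp add: q_def)
  moreover have "(LINT x|leb a b. f x * (q x * \<phi>' x + of_real c * \<phi> x)) =
     (LINT x|leb a b. q x * f x * \<phi>' x) + (LINT x|leb a b. of_real c * (f x * \<phi> x))"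
  proof -
    have "(\<lambda>x. f x * (q x * \<phi>' x + of_real c * \<phi> x)) = (\<lambda>x. q x * f x * \<phi>' x + of_real c * (f x * \<phi> x))"
      by (auto simp: algebra_simps)
    moreover have "integrable (leb a b) (\<lambda>x. q x * f x * \<phi>' x)"
      unfolding q_def by (intro L2_mult_integrable L2_mult_affine L2s test_functions_L2 \<phi>)
    moreover have "integrable (leb a b) (\<lambda>x. of_real c * (f x * \<phi> x))"
      by (intro integrable_mult_right L2_mult_integrable L2s test_functions_L2 \<phi>)
    ultimately show ?thesis by (simp only: Bochner_Integration.integral_add)
  qed
  moreover have "(LINT x|leb a b. (of_real c * f x + q x * f' x) * \<phi> x) =
     (LINT x|leb a b. of_real c * (f x * \<phi> x)) + (LINT x|leb a b. f' x * (q x * \<phi> x))"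
  proof -
    have "(\<lambda>x. (of_real c * f x + q x * f' x) * \<phi> x) = (\<lambda>x. of_real c * (f x * \<phi> x) + f' x * (q x * \<phi> x))"
      by (auto simp: algebra_simps)
    moreover have "integrable (leb a b) (\<lambda>x. f' x * (q x * \<phi> x))"
      unfolding q_def by (intro L2_mult_integrable L2_mult_affine L2s test_functions_L2 \<phi>)
    moreover have "integrable (leb a b) (\<lambda>x. of_real c * (f x * \<phi> x))"
      by (intro integrable_mult_right L2_mult_integrable L2s test_functions_L2 \<phi>)
    ultimately show ?thesis by (simp only: Bochner_Integration.integral_add)
  qed
  ultimately show "(LINT x|leb a b. of_real (c * x + d) * f x * \<phi>' x) =
      - (LINT x|leb a b. (of_real c * f x + of_real (c * x + d) * f' x) * \<phi> x)"
    unfolding q_def by (simp add: algebra_simps add_eq_0_iff)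
qed

lemma has_weak_deriv_cmult:
  assumes f: "has_weak_deriv a b f f'"
  shows "has_weak_deriv a b (\<lambda>x. c * f x) (\<lambda>x. c * f' x)"
proof (rule has_weak_derivI)
  fix \<phi> \<phi>' assume \<phi>: "\<phi> \<in> test_functions a b" "\<phi>' \<in> test_functions a b"
      "\<And>x. (\<phi> has_vector_derivative \<phi>' x) (at x)"
  show "(LINT x|leb a b. c * f x * \<phi>' x) = - (LINT x|leb a b. c * f' x * \<phi> x)"
    using has_weak_deriv_test[OF f \<phi>(1,3)] by (simp add: mult.assoc)
qed (intro L2_cmult has_weak_deriv_L2[OF f])+

lemma has_weak_deriv_diff:
  assumes f: "has_weak_deriv a b f f'" and g: "has_weak_deriv a b g g'"
  shows "has_weak_deriv a b (\<lambda>x. f x - g x) (\<lambda>x. f' x - g' x)"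
  using has_weak_deriv_add[OF f has_weak_deriv_cmult[OF g, of "-1"]] by simp

lemma has_weak_deriv_cnj:
  assumes f: "has_weak_deriv a b f f'"
  shows "has_weak_deriv a b (\<lambda>x. cnj (f x)) (\<lambda>x. cnj (f' x))"
proof (rule has_weak_derivI)
  fix \<phi> \<phi>' assume \<phi>: "\<phi> \<in> test_functions a b" "\<phi>' \<in> test_functions a b"
      "\<And>x. (\<phi> has_vector_derivative \<phi>' x) (at x)"
  have "((\<lambda>x. cnj (\<phi> x)) has_vector_derivative cnj (\<phi>' x)) (at x)" for x
    by (intro has_vector_derivative_cnj \<phi>)
  from has_weak_deriv_test[OF f test_functions_cnj[OF \<phi>(1)] this]
  have "cnj (LINT x|leb a b. f x * cnj (\<phi>' x)) = - cnj (LINT x|leb a b. f' x * cnj (\<phi> x))"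
    by simp
  moreover have "(LINT x|leb a b. cnj (u x) * v x) = cnj (LINT x|leb a b. u x * cnj (v x))" for u v
    using Bochner_Integration.integral_cnj[of "leb a b" "\<lambda>x. u x * cnj (v x)"] by simp
  ultimately show "(LINT x|leb a b. cnj (f x) * \<phi>' x) = - (LINT x|leb a b. cnj (f' x) * \<phi> x)"
    by (simp only:)
qed (intro L2_cnj has_weak_deriv_L2[OF f])+

lemma has_weak_deriv_smooth:
  assumes "a \<le> b" "smooth \<phi>'" "\<And>x. (\<phi> has_vector_derivative \<phi>' x) (at x)"
  shows "has_weak_deriv a b \<phi> \<phi>'"
  by (intro is_primitive_imp_has_weak_deriv is_primitive_smooth assms)

text \<open>The set where two continuous functions differ is open, and an open null set is empty; the
  end points follow by continuity.\<close>

lemma continuous_AE_eq_imp_eq: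
  fixes F G :: "real \<Rightarrow> complex"
  assumes "a < b" and F: "continuous_on {a..b} F" and G: "continuous_on {a..b} G"
    and AE: "AE x in leb a b. F x = G x" and p: "p \<in> {a..b}"
  shows "F p = G p"
proof -
  define U where "U = {a<..<b} \<inter> (\<lambda>x. F x - G x) -` (- {0})"
  have "continuous_on {a<..<b} (\<lambda>x. F x - G x)"
    by (intro continuous_intros continuous_on_subset[OF F] continuous_on_subset[OF G]) auto
  then have U: "open U"
    unfolding U_def by (intro continuous_open_preimage) auto
  have "AE x in lebesgue. x \<in> {a<..<b} \<longrightarrow> F x = G x"
    using AE by (simp add: AE_restrict_space_iff)
  then have "AE x in lebesgue. x \<notin> U"
    by eventually_elim (auto simp: U_def)
  moreover have "U \<in> sets lebesgue" using U by auto
  ultimately have "U \<in> null_sets lebesgue"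
    using AE_iff_null_sets by blast
  then have "U = {}"
    using open_not_negligible[OF U] by (auto simp: negligible_iff_null_sets)
  then have eq: "F x - G x = 0" if "x \<in> {a<..<b}" for x
    using that by (auto simp: U_def)
  have "F p - G p = 0"
  proof (rule continuous_constant_on_closure[of "{a<..<b}"])
    show "continuous_on (closure {a<..<b}) (\<lambda>x. F x - G x)"
      using F G \<open>a < b\<close> by (auto intro!: continuous_intros)
  qed (use eq p \<open>a < b\<close> in auto)
  then show ?thesis by simp
qed

lemma trace_at_eq:
  assumes "a < b" "continuous_on {a..b} F" "AE x in leb a b. F x = f x" "p \<in> {a..b}"
  shows "trace_at a b f p = F p"
  unfolding trace_at_def
proof (rule the_equality)
  show "\<exists>v. continuous_on {a..b} v \<and> (AE x in leb a b. v x = f x) \<and> v p = F p"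
    using assms by blast
  fix c assume "\<exists>v. continuous_on {a..b} v \<and> (AE x in leb a b. v x = f x) \<and> v p = c"
  then obtain v where v: "continuous_on {a..b} v" "AE x in leb a b. v x = f x" "v p = c"
    by blast
  have "AE x in leb a b. v x = F x"
    using v(2) assms(3) by eventually_elim simp
  then show "c = F p"
    using continuous_AE_eq_imp_eq[OF assms(1) v(1) assms(2) _ assms(4)] v(3) by simp
qed

lemma trace_at_cong:
  assumes "AE x in leb a b. f x = g x"
  shows "trace_at a b f p = trace_at a b g p"
proof -
  have "(AE x in leb a b. v x = f x) \<longleftrightarrow> (AE x in leb a b. v x = g x)" for v
    using assms by (intro eventually_subst) (auto elim: eventually_mono)
  then show ?thesis by (simp add: trace_at_def)
qed

lemma trace_at_representative:
  assumes "a < b" "has_weak_deriv a b f f'"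
  obtains F where "is_primitive a b F f'" "AE x in leb a b. F x = f x"
    "\<And>p. p \<in> {a..b} \<Longrightarrow> trace_at a b f p = F p"
proof -
  obtain F where F: "is_primitive a b F f'" "AE x in leb a b. F x = f x"
    using has_weak_deriv_representative[OF assms] by blast
  show thesis
    by (rule that[OF F trace_at_eq[OF assms(1) is_primitive_continuous[OF F(1)] F(2)]])
qed

lemma H1_by_parts:
  assumes "a < b" and f: "has_weak_deriv a b f f'" and g: "has_weak_deriv a b g g'"
  shows "(LINT x|leb a b. f' x * g x + f x * g' x) =
     trace_at a b f b * trace_at a b g b - trace_at a b f a * trace_at a b g a"
proof -
  obtain F where F: "is_primitive a b F f'" "AE x in leb a b. F x = f x"
    "\<And>p. p \<in> {a..b} \<Longrightarrow> trace_at a b f p = F p"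
    using trace_at_representative[OF \<open>a < b\<close> f] by blast
  obtain G where G: "is_primitive a b G g'" "AE x in leb a b. G x = g x"
    "\<And>p. p \<in> {a..b} \<Longrightarrow> trace_at a b g p = G p"
    using trace_at_representative[OF \<open>a < b\<close> g] by blast
  note [measurable] = has_weak_deriv_L2[OF f, THEN L2_measurable] has_weak_deriv_L2[OF g, THEN L2_measurable]
    is_primitive_L2[OF F(1), THEN L2_measurable] is_primitive_L2[OF G(1), THEN L2_measurable]
  have "(LINT x|leb a b. f' x * g x + f x * g' x) = (LINT x|leb a b. f' x * G x + F x * g' x)"
    using F(2) G(2) by (intro integral_cong_AE) auto
  then show ?thesis
    using is_primitive_by_parts[OF _ F(1) G(1)] F(3) G(3) \<open>a < b\<close> by simp
qed

lemma trace_at_add: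
  assumes "a < b" "has_weak_deriv a b f f'" "has_weak_deriv a b g g'" "p \<in> {a..b}"
  shows "trace_at a b (\<lambda>x. f x + g x) p = trace_at a b f p + trace_at a b g p"
proof -
  obtain F where F: "is_primitive a b F f'" "AE x in leb a b. F x = f x"
    "\<And>p. p \<in> {a..b} \<Longrightarrow> trace_at a b f p = F p"
    using trace_at_representative[OF assms(1,2)] by blast
  obtain G where G: "is_primitive a b G g'" "AE x in leb a b. G x = g x"
    "\<And>p. p \<in> {a..b} \<Longrightarrow> trace_at a b g p = G p"
    using trace_at_representative[OF assms(1,3)] by blast
  have "AE x in leb a b. F x + G x = f x + g x"
    using F(2) G(2) by eventually_elim simp
  then have "trace_at a b (\<lambda>x. f x + g x) p = F p + G p"
    by (intro trace_at_eq assms continuous_on_add is_primitive_continuous[OF F(1)]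
        is_primitive_continuous[OF G(1)])
  then show ?thesis using F(3) G(3) assms(4) by simp
qed

lemma trace_at_mult:
  assumes "a < b" "has_weak_deriv a b f f'" "continuous_on {a..b} q" "p \<in> {a..b}"
  shows "trace_at a b (\<lambda>x. q x * f x) p = q p * trace_at a b f p"
proof -
  obtain F where F: "is_primitive a b F f'" "AE x in leb a b. F x = f x"
    "\<And>p. p \<in> {a..b} \<Longrightarrow> trace_at a b f p = F p"
    using trace_at_representative[OF assms(1,2)] by blast
  have "AE x in leb a b. q x * F x = q x * f x"
    using F(2) by eventually_elim simp
  then have "trace_at a b (\<lambda>x. q x * f x) p = q p * F p"
    by (intro trace_at_eq assms continuous_on_mult is_primitive_continuous[OF F(1)])
  then show ?thesis using F(3) assms(4) by simp
qed

lemma trace_at_diff: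
  assumes "a < b" "has_weak_deriv a b f f'" "has_weak_deriv a b g g'" "p \<in> {a..b}"
  shows "trace_at a b (\<lambda>x. f x - g x) p = trace_at a b f p - trace_at a b g p"
proof -
  have "trace_at a b (\<lambda>x. f x + (-1) * g x) p = trace_at a b f p + trace_at a b (\<lambda>x. (-1) * g x) p"
    by (rule trace_at_add[OF assms(1,2) has_weak_deriv_cmult[OF assms(3)] assms(4)])
  moreover have "trace_at a b (\<lambda>x. (-1) * g x) p = (-1) * trace_at a b g p"
    by (rule trace_at_mult[OF assms(1,3) _ assms(4)]) simp
  ultimately show ?thesis by simp
qed

lemma trace_at_cnj:
  assumes "a < b" "has_weak_deriv a b f f'" "p \<in> {a..b}"
  shows "trace_at a b (\<lambda>x. cnj (f x)) p = cnj (trace_at a b f p)"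
proof -
  obtain F where F: "is_primitive a b F f'" "AE x in leb a b. F x = f x"
    "\<And>p. p \<in> {a..b} \<Longrightarrow> trace_at a b f p = F p"
    using trace_at_representative[OF assms(1,2)] by blast
  have "AE x in leb a b. cnj (F x) = cnj (f x)"
    using F(2) by eventually_elim simp
  then have "trace_at a b (\<lambda>x. cnj (f x)) p = cnj (F p)"
    by (intro trace_at_eq assms continuous_on_cnj is_primitive_continuous[OF F(1)])
  then show ?thesis using F(3) assms(3) by simp
qed

section \<open>Estimates on the unit interval\<close>

lemma L2norm_affine_le:
  assumes f: "f \<in> L2 0 1" and q: "\<And>x. x \<in> {0<..<1} \<Longrightarrow> \<bar>c * x + d\<bar> \<le> 1"
  shows "L2norm 0 1 (\<lambda>x. of_real (c * x + d) * f x) \<le> L2norm 0 1 f"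
  unfolding L2norm_def
proof (intro real_sqrt_le_mono integral_mono L2_integrable_norm_sq L2_mult_affine f)
  fix x assume "x \<in> space (leb 0 1)"
  then have "\<bar>c * x + d\<bar> \<le> 1" using q by simp
  then have "cmod (of_real (c * x + d) * f x) \<le> cmod (f x)"
    unfolding norm_mult norm_of_real by (intro mult_left_le_one_le) auto
  then show "(cmod (of_real (c * x + d) * f x))\<^sup>2 \<le> (cmod (f x))\<^sup>2"
    by (intro power_mono) auto
qed

text \<open>Integration by parts for \<open>q f\<close> and \<open>cnj f\<close> with \<open>q(x) = c x + d\<close>, in other words the fundamental
  theorem of calculus for \<open>q \<bar>f\<bar>\<^sup>2\<close>. Different weights yield the trace bound, Poincare's inequality and
  the multiplier identities.\<close>

lemma weighted_energy_identity:
  assumes f: "has_weak_deriv 0 1 f f'"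
  shows "of_real c * (LINT x|leb 0 1. f x * cnj (f x))
      + (LINT x|leb 0 1. (of_real (c * x + d) * f' x) * cnj (f x))
      + (LINT x|leb 0 1. (of_real (c * x + d) * f x) * cnj (f' x))
    = of_real (c + d) * trace_at 0 1 f 1 * cnj (trace_at 0 1 f 1)
      - of_real d * trace_at 0 1 f 0 * cnj (trace_at 0 1 f 0)"
proof -
  note L2s = has_weak_deriv_L2[OF f]
  have "(LINT x|leb 0 1. (of_real c * f x + of_real (c * x + d) * f' x) * cnj (f x)
      + (of_real (c * x + d) * f x) * cnj (f' x)) =
    trace_at 0 1 (\<lambda>x. of_real (c * x + d) * f x) 1 * trace_at 0 1 (\<lambda>x. cnj (f x)) 1 -
    trace_at 0 1 (\<lambda>x. of_real (c * x + d) * f x) 0 * trace_at 0 1 (\<lambda>x. cnj (f x)) 0"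
    by (intro H1_by_parts has_weak_deriv_mult_affine has_weak_deriv_cnj f) simp
  also have "\<dots> = of_real (c + d) * trace_at 0 1 f 1 * cnj (trace_at 0 1 f 1)
      - of_real d * trace_at 0 1 f 0 * cnj (trace_at 0 1 f 0)"
  proof -
    have q: "trace_at 0 1 (\<lambda>x. of_real (c * x + d) * f x) p = of_real (c * p + d) * trace_at 0 1 f p"
      if "p \<in> {0..1}" for p
      using that by (intro trace_at_mult[OF _ f]) (auto intro!: continuous_intros)
    show ?thesis
      using q[of 1] q[of 0] trace_at_cnj[OF _ f, of 1] trace_at_cnj[OF _ f, of 0]
      by (simp del: of_real_add of_real_mult)
  qed
  also have "(LINT x|leb 0 1. (of_real c * f x + of_real (c * x + d) * f' x) * cnj (f x)
      + (of_real (c * x + d) * f x) * cnj (f' x)) =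
     (LINT x|leb 0 1. of_real c * (f x * cnj (f x)) + (of_real (c * x + d) * f' x) * cnj (f x)
      + (of_real (c * x + d) * f x) * cnj (f' x))"
    by (intro Bochner_Integration.integral_cong) (auto simp: algebra_simps)
  also have "\<dots> = (LINT x|leb 0 1. of_real c * (f x * cnj (f x)))
      + (LINT x|leb 0 1. (of_real (c * x + d) * f' x) * cnj (f x))
      + (LINT x|leb 0 1. (of_real (c * x + d) * f x) * cnj (f' x))"
  proof -
    have "integrable (leb 0 1) (\<lambda>x. of_real c * (f x * cnj (f x)))"
      "integrable (leb 0 1) (\<lambda>x. (of_real (c * x + d) * f' x) * cnj (f x))"
      "integrable (leb 0 1) (\<lambda>x. (of_real (c * x + d) * f x) * cnj (f' x))"
      by (intro integrable_mult_right L2_mult_integrable L2_mult_affine L2_cnj L2s)+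
    then show ?thesis
      by (simp only: Bochner_Integration.integral_add Bochner_Integration.integrable_add)
  qed
  finally show ?thesis by simp
qed

lemma LINT_mult_cnj_self:
  assumes "f \<in> L2 a b"
  shows "(LINT x|leb a b. f x * cnj (f x)) = of_real ((L2norm a b f)\<^sup>2)"
proof -
  have "(LINT x|leb a b. f x * cnj (f x)) = (LINT x|leb a b. complex_of_real ((cmod (f x))\<^sup>2))"
    by (simp only: complex_norm_square)
  also have "\<dots> = of_real ((L2norm a b f)\<^sup>2)"
    by (subst integral_complex_of_real) (simp add: L2norm_sq)
  finally show ?thesis .
qed

lemma weighted_pairing_le:
  assumes "f \<in> L2 0 1" "g \<in> L2 0 1" "\<And>x. x \<in> {0<..<1} \<Longrightarrow> \<bar>c * x + d\<bar> \<le> 1"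
  shows "cmod (LINT x|leb 0 1. (of_real (c * x + d) * f x) * cnj (g x)) \<le> L2norm 0 1 f * L2norm 0 1 g"
proof -
  have "cmod (LINT x|leb 0 1. (of_real (c * x + d) * f x) * cnj (g x)) \<le>
      L2norm 0 1 (\<lambda>x. of_real (c * x + d) * f x) * L2norm 0 1 (\<lambda>x. cnj (g x))"
    by (intro L2_Cauchy_Schwarz L2_mult_affine L2_cnj assms)
  also have "\<dots> \<le> L2norm 0 1 f * L2norm 0 1 g"
    unfolding L2norm_cnj by (intro mult_right_mono L2norm_affine_le assms) auto
  finally show ?thesis .
qed

text \<open>The weight is chosen to be \<open>1\<close> at \<open>p\<close> and \<open>0\<close> at the opposite end, so that only the trace at \<open>p\<close>
  remains in the identity.\<close>

lemma trace_at_bound: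
  assumes f: "has_weak_deriv 0 1 f f'" and p: "p \<in> {0, 1}"
  shows "cmod (trace_at 0 1 f p) \<le> L2norm 0 1 f + L2norm 0 1 f'"
proof (rule power2_le_imp_le)
  note L2s = has_weak_deriv_L2[OF f]
  define c d :: real where "c = (if p = 0 then -1 else 1)" and "d = (if p = 0 then 1 else 0)"
  have q: "\<bar>c * x + d\<bar> \<le> 1" if "x \<in> {0<..<1}" for x
    using that by (auto simp: c_def d_def)
  have c: "\<bar>c\<bar> = 1" by (simp add: c_def)
  have "of_real (c + d) * trace_at 0 1 f 1 * cnj (trace_at 0 1 f 1)
      - of_real d * trace_at 0 1 f 0 * cnj (trace_at 0 1 f 0) =
      of_real ((if p = 0 then -1 else 1) * (cmod (trace_at 0 1 f p))\<^sup>2)"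
    using p by (auto simp: c_def d_def complex_norm_square simp flip: of_real_power)
  then have "(cmod (trace_at 0 1 f p))\<^sup>2 =
      cmod (of_real (c + d) * trace_at 0 1 f 1 * cnj (trace_at 0 1 f 1)
      - of_real d * trace_at 0 1 f 0 * cnj (trace_at 0 1 f 0))"
    by (simp only: norm_of_real abs_mult) simp
  also have "\<dots> \<le> cmod (of_real c * (LINT x|leb 0 1. f x * cnj (f x)))
      + cmod (LINT x|leb 0 1. (of_real (c * x + d) * f' x) * cnj (f x))
      + cmod (LINT x|leb 0 1. (of_real (c * x + d) * f x) * cnj (f' x))"
    unfolding weighted_energy_identity[OF f, symmetric]
    by (intro norm_triangle_mono order_refl)
  also have "\<dots> \<le> (L2norm 0 1 f)\<^sup>2 + L2norm 0 1 f' * L2norm 0 1 f + L2norm 0 1 f * L2norm 0 1 f'"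
    by (intro add_mono weighted_pairing_le L2s q)
       (auto simp: LINT_mult_cnj_self[OF L2s(1)] norm_mult norm_power c)
  also have "\<dots> \<le> (L2norm 0 1 f + L2norm 0 1 f')\<^sup>2"
    by (simp add: power2_sum)
  finally show "(cmod (trace_at 0 1 f p))\<^sup>2 \<le> (L2norm 0 1 f + L2norm 0 1 f')\<^sup>2" .
qed simp

text \<open>With the weight \<open>x\<close> the boundary terms vanish, and the identity bounds \<open>\<parallel>f\<parallel>\<^sup>2\<close> by
  \<open>2 \<parallel>f\<parallel> \<parallel>f'\<parallel>\<close>.\<close>

lemma Poincare_inequality:
  assumes f: "has_weak_deriv 0 1 f f'" and zero: "trace_at 0 1 f 1 = 0"
  shows "L2norm 0 1 f \<le> 2 * L2norm 0 1 f'"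
proof -
  note L2s = has_weak_deriv_L2[OF f]
  have norm_eq: "cmod x = cmod (u + v)" if "x + u + v = 0" for x u v :: complex
  proof -
    have "x = - (u + v)" using that by (simp only: add.assoc add_eq_0_iff2)
    then show ?thesis by (simp only: norm_minus_cancel)
  qed
  have "of_real ((L2norm 0 1 f)\<^sup>2)
      + (LINT x|leb 0 1. (of_real (1 * x + 0) * f' x) * cnj (f x))
      + (LINT x|leb 0 1. (of_real (1 * x + 0) * f x) * cnj (f' x)) = 0"
    using weighted_energy_identity[OF f, of 1 0] zero by (simp add: LINT_mult_cnj_self[OF L2s(1)])
  then have "cmod (of_real ((L2norm 0 1 f)\<^sup>2)) =
      cmod ((LINT x|leb 0 1. (of_real (1 * x + 0) * f' x) * cnj (f x))
      + (LINT x|leb 0 1. (of_real (1 * x + 0) * f x) * cnj (f' x)))"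
    by (rule norm_eq)
  also have "\<dots> \<le> L2norm 0 1 f' * L2norm 0 1 f + L2norm 0 1 f * L2norm 0 1 f'"
    by (intro norm_triangle_mono weighted_pairing_le L2s) auto
  finally have "L2norm 0 1 f * L2norm 0 1 f \<le> L2norm 0 1 f * (2 * L2norm 0 1 f')"
    by (simp add: power2_eq_square norm_mult)
  then show ?thesis
    using L2norm_nonneg[of 0 1 f] L2norm_nonneg[of 0 1 f'] mult_le_cancel_left_pos[of "L2norm 0 1 f"]
    by (metis less_eq_real_def mult_nonneg_nonneg zero_le_numeral)
qed

lemma test_function_has_weak_deriv:
  assumes "a \<le> b" "\<phi> \<in> test_functions a b"
  obtains \<phi>' where "\<phi>' \<in> test_functions a b" "has_weak_deriv a b \<phi> \<phi>'"
proof -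
  obtain \<phi>' where "\<phi>' \<in> test_functions a b" "\<And>x. (\<phi> has_vector_derivative \<phi>' x) (at x)"
    using test_functions_derivative[OF assms(2)] by blast
  then show thesis
    using that has_weak_deriv_smooth[OF assms(1) test_functions_smooth] by blast
qed

lemma trace_at_test_function:
  assumes "a < b" "\<phi> \<in> test_functions a b" "p \<in> {a, b}"
  shows "trace_at a b \<phi> p = 0"
proof -
  have "trace_at a b \<phi> p = \<phi> p"
    using assms by (intro trace_at_eq smooth_imp_continuous_on test_functions_smooth) auto
  also have "\<phi> p = 0"
    using assms(2,3) by (fastforce simp: test_functions_iff)
  finally show ?thesis .
qed

lemma H01_H1: "f \<in> H01 a b \<Longrightarrow> f \<in> H1 a b"
  by (simp add: H01_def)

text \<open>Traces are continuous in the \<open>H\<^sup>1\<close> norm and vanish for test functions.\<close>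

lemma H01_trace_zero:
  assumes f: "f \<in> H01 0 1" and p: "p \<in> {0, 1}"
  shows "trace_at 0 1 f p = 0"
proof (rule ccontr)
  assume "trace_at 0 1 f p \<noteq> 0"
  define \<epsilon> where "\<epsilon> = cmod (trace_at 0 1 f p) / 2"
  have "\<epsilon> > 0" using \<open>trace_at 0 1 f p \<noteq> 0\<close> by (simp add: \<epsilon>_def)
  then obtain \<phi> where \<phi>: "\<phi> \<in> test_functions 0 1" "H1norm 0 1 (\<lambda>x. f x - \<phi> x) < \<epsilon>"
    using f unfolding H01_def by auto
  obtain \<phi>' where \<phi>': "has_weak_deriv 0 1 \<phi> \<phi>'"
    using test_function_has_weak_deriv[OF _ \<phi>(1)] by auto
  note ff' = has_weak_deriv_weak_deriv[OF H01_H1[OF f]]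
  define h where "h = (\<lambda>x. f x - \<phi> x)"
  have h: "has_weak_deriv 0 1 h (weak_deriv 0 1 h)"
    using has_weak_deriv_diff[OF ff' \<phi>'] has_weak_deriv_H1 has_weak_deriv_weak_deriv
    unfolding h_def by blast
  have "trace_at 0 1 f p = trace_at 0 1 h p"
    unfolding h_def using trace_at_diff[OF _ ff' \<phi>', of p] trace_at_test_function[OF _ \<phi>(1) p] p by auto
  then have "2 * \<epsilon> \<le> L2norm 0 1 h + L2norm 0 1 (weak_deriv 0 1 h)"
    using trace_at_bound[OF h p] by (simp add: \<epsilon>_def)
  moreover have "L2norm 0 1 h \<le> H1norm 0 1 h" "L2norm 0 1 (weak_deriv 0 1 h) \<le> H1norm 0 1 h"
    unfolding H1norm_def by (auto intro!: real_le_rsqrt)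
  ultimately show False using \<phi>(2) by (simp add: h_def)
qed

section \<open>Dilations\<close>

lemma dilation_measurable [measurable]:
  assumes "k > 0" shows "(\<lambda>y. k * y) \<in> leb 0 c \<rightarrow>\<^sub>M leb 0 (k * c)"
proof (rule measurable_restrict_space3)
  show "(\<lambda>y. k * y) \<in> lebesgue \<rightarrow>\<^sub>M lebesgue"
    using lebesgue_measurable_scaling[of k, where ?'a = real] by (simp add: real_scaleR_def[abs_def])
  show "(\<lambda>y. k * y) \<in> {0<..<c} \<rightarrow> {0<..<k * c}"
    using assms by auto
qed

text \<open>Stated as an equality of measures, so that integrals, integrability and null sets can all be
  transported along it.\<close>

lemma leb_dilation:
  assumes "k > 0"
  shows "leb 0 (k * c) = density (distr (leb 0 c) (leb 0 (k * c)) (\<lambda>y. k * y)) (\<lambda>_. ennreal k)"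
proof (rule measure_eqI)
  fix A assume A: "A \<in> sets (leb 0 (k * c))"
  define B where "B = (\<lambda>y. k * y) -` A \<inter> space (leb 0 c)"
  have "B \<in> sets (leb 0 c)"
    unfolding B_def using A assms by (intro measurable_sets[OF dilation_measurable])
  then have B: "B \<subseteq> {0<..<c}" "B \<in> sets lebesgue"
    by (auto simp: sets_restrict_space_iff)
  have A': "A \<subseteq> {0<..<k * c}" "A \<in> sets lebesgue"
    using A by (auto simp: sets_restrict_space_iff)
  have "A = (\<lambda>y. k *\<^sub>R y + 0) ` B"
  proof (intro equalityI subsetI)
    fix x assume "x \<in> A"
    then have "x / k \<in> B" "x = k *\<^sub>R (x / k) + 0"
      using A' assms by (auto simp: B_def field_simps)
    then show "x \<in> (\<lambda>y. k *\<^sub>R y + 0) ` B" by (rule rev_image_eqI)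
  qed (auto simp: B_def)
  then have "emeasure lebesgue A = ennreal k * emeasure lebesgue B"
    using emeasure_lebesgue_affine[of k 0 B] assms by simp
  also have "\<dots> = ennreal k * emeasure (leb 0 c) B"
    using B by (simp add: emeasure_restrict_space)
  also have "\<dots> = emeasure (density (distr (leb 0 c) (leb 0 (k * c)) (\<lambda>y. k * y)) (\<lambda>_. ennreal k)) A"
    using A assms by (simp add: emeasure_density_const emeasure_distr B_def)
  finally show "emeasure (leb 0 (k * c)) A =
      emeasure (density (distr (leb 0 c) (leb 0 (k * c)) (\<lambda>y. k * y)) (\<lambda>_. ennreal k)) A"
    using A' by (simp add: emeasure_restrict_space)
qed simp

lemma LINT_dilation:
  fixes h :: "real \<Rightarrow> complex"
  assumes "k > 0" and h: "h \<in> borel_measurable (leb 0 (k * c))"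
  shows "(LINT x|leb 0 (k * c). h x) = of_real k * (LINT y|leb 0 c. h (k * y))"
proof -
  note [measurable] = h
  have "(LINT x|leb 0 (k * c). h x) =
      (LINT x|density (distr (leb 0 c) (leb 0 (k * c)) (\<lambda>y. k * y)) (\<lambda>_. ennreal k). h x)"
    using leb_dilation[OF \<open>k > 0\<close>, of c] by simp
  also have "\<dots> = (LINT x|distr (leb 0 c) (leb 0 (k * c)) (\<lambda>y. k * y). k *\<^sub>R h x)"
    using assms by (intro integral_density) auto
  also have "\<dots> = (LINT y|leb 0 c. k *\<^sub>R h (k * y))"
    using assms by (intro integral_distr) auto
  finally show ?thesis by (simp add: scaleR_conv_of_real)
qed

lemma AE_dilation:
  assumes "k > 0" "AE x in leb 0 (k * c). P x"
  shows "AE y in leb 0 c. P (k * y)"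
proof -
  have "AE x in density (distr (leb 0 c) (leb 0 (k * c)) (\<lambda>y. k * y)) (\<lambda>_. ennreal k). P x"
    using assms(2) by (subst (asm) leb_dilation[OF \<open>k > 0\<close>])
  then have "AE x in distr (leb 0 c) (leb 0 (k * c)) (\<lambda>y. k * y). P x"
    using assms by (subst (asm) AE_density) auto
  then show ?thesis
    by (rule AE_distrD[OF dilation_measurable[OF assms(1)]])
qed

lemma L2_dilation:
  assumes "k > 0" "f \<in> L2 0 (k * c)"
  shows "(\<lambda>y. f (k * y)) \<in> L2 0 c"
proof -
  note [measurable] = L2_measurable[OF assms(2)] dilation_measurable[OF assms(1)]
  have "integrable (density (distr (leb 0 c) (leb 0 (k * c)) (\<lambda>y. k * y)) (\<lambda>_. ennreal k))
      (\<lambda>x. (cmod (f x))\<^sup>2)"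
    using L2_integrable_norm_sq[OF assms(2)] leb_dilation[OF \<open>k > 0\<close>, of c] by simp
  then have "integrable (distr (leb 0 c) (leb 0 (k * c)) (\<lambda>y. k * y)) (\<lambda>x. k * (cmod (f x))\<^sup>2)"
    using assms by (subst (asm) integrable_density) auto
  then have "integrable (leb 0 c) (\<lambda>y. k * (cmod (f (k * y)))\<^sup>2)"
    by (subst (asm) integrable_distr_eq) auto
  then show ?thesis
    using assms(1) by (simp add: L2_def)
qed

lemma has_weak_deriv_dilation:
  assumes "k > 0" and f: "has_weak_deriv 0 1 f f'"
  shows "has_weak_deriv 0 k (\<lambda>x. f (x / k)) (\<lambda>x. of_real (1 / k) * f' (x / k))"
proof (rule has_weak_derivI)
  have L2k: "(\<lambda>x. g (x / k)) \<in> L2 0 k" if "g \<in> L2 0 1" for g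
    using L2_dilation[of "1 / k" g k] assms(1) that by simp
  note L2s = L2k[OF has_weak_deriv_L2(1)[OF f]]
    L2_cmult[OF L2k[OF has_weak_deriv_L2(2)[OF f]], of "of_real (1 / k)"]
  show "(\<lambda>x. f (x / k)) \<in> L2 0 k" "(\<lambda>x. of_real (1 / k) * f' (x / k)) \<in> L2 0 k"
    by (rule L2s)+
  fix \<phi> \<phi>' assume \<phi>: "\<phi> \<in> test_functions 0 k" "\<phi>' \<in> test_functions 0 k"
      "\<And>x. (\<phi> has_vector_derivative \<phi>' x) (at x)"
  have "((\<lambda>y. \<phi> (k * y)) has_vector_derivative k *\<^sub>R \<phi>' (k * y)) (at y)" for y
  proof -
    have "((\<lambda>y. k * y) has_vector_derivative k) (at y)"
      by (auto intro!: derivative_eq_intros simp flip: has_real_derivative_iff_has_vector_derivative)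
    from vector_diff_chain_at[OF this \<phi>(3)] show ?thesis by (simp add: o_def)
  qed
  from has_weak_deriv_test[OF f test_functions_scale[OF \<phi>(1) \<open>k > 0\<close>] this]
  have *: "of_real k * (LINT y|leb 0 1. f y * \<phi>' (k * y)) = - (LINT y|leb 0 1. f' y * \<phi> (k * y))"
    by (simp add: scaleR_conv_of_real mult.left_commute)
  have "(LINT x|leb 0 k. f (x / k) * \<phi>' x) = of_real k * (LINT y|leb 0 1. f y * \<phi>' (k * y))"
    using LINT_dilation[of k "\<lambda>x. f (x / k) * \<phi>' x" 1] assms(1)
      borel_measurable_integrable[OF L2_mult_integrable[OF L2s(1) test_functions_L2[OF \<phi>(2)]]] by simp
  moreover have "(LINT x|leb 0 k. of_real (1 / k) * f' (x / k) * \<phi> x) =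
      of_real k * (LINT y|leb 0 1. of_real (1 / k) * f' y * \<phi> (k * y))"
    using LINT_dilation[of k "\<lambda>x. of_real (1 / k) * f' (x / k) * \<phi> x" 1] assms(1)
      borel_measurable_integrable[OF L2_mult_integrable[OF L2s(2) test_functions_L2[OF \<phi>(1)]]] by simp
  moreover have "of_real k * (LINT y|leb 0 1. of_real (1 / k) * f' y * \<phi> (k * y)) =
      (LINT y|leb 0 1. f' y * \<phi> (k * y))"
    using assms(1) by (simp add: mult.assoc)
  ultimately show "(LINT x|leb 0 k. f (x / k) * \<phi>' x) = - (LINT x|leb 0 k. of_real (1 / k) * f' (x / k) * \<phi> x)"
    using * by simp
qed

text \<open>In the moving coordinate \<open>x = l(t) y\<close> the chain rule gives \<open>u\<^sub>x = w\<^sub>y / l(t)\<close>, also for boundary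
  traces.\<close>

lemma trace_at_weak_deriv_dilation:
  assumes "k > 0" and f: "has_weak_deriv 0 1 f f'" and f': "has_weak_deriv 0 1 f' f''" and p: "p \<in> {0..1}"
  shows "trace_at 0 k (weak_deriv 0 k (\<lambda>x. f (x / k))) (k * p) = trace_at 0 1 f' p / of_real k"
proof -
  obtain F where F: "is_primitive 0 1 F f''" "AE x in leb 0 1. F x = f' x"
    "\<And>p. p \<in> {0..1} \<Longrightarrow> trace_at 0 1 f' p = F p"
    using trace_at_representative[OF _ f'] by auto
  have one: "1 / k * k = 1" using \<open>k > 0\<close> by simp
  have "AE x in leb 0 k. F (x / k) = f' (x / k)"
    using AE_dilation[where k = "1 / k" and c = k and P = "\<lambda>x. F x = f' x", unfolded one] F(2) \<open>k > 0\<close>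
    by simp
  moreover have "AE x in leb 0 k. weak_deriv 0 k (\<lambda>x. f (x / k)) x = of_real (1 / k) * f' (x / k)"
    by (rule weak_deriv_AE_eq[OF has_weak_deriv_dilation[OF \<open>k > 0\<close> f]])
  ultimately have "AE x in leb 0 k. F (x / k) / of_real k = weak_deriv 0 k (\<lambda>x. f (x / k)) x"
    by eventually_elim simp
  moreover have "continuous_on {0..k} (\<lambda>x. F (x / k) / of_real k)"
    using \<open>k > 0\<close>
    by (intro continuous_intros continuous_on_compose2[OF is_primitive_continuous[OF F(1)]]) auto
  ultimately have "trace_at 0 k (weak_deriv 0 k (\<lambda>x. f (x / k))) (k * p) = F (k * p / k) / of_real k"
    using \<open>k > 0\<close> p by (intro trace_at_eq) auto
  then show ?thesis using F(3)[OF p] \<open>k > 0\<close> by simp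
qed

section \<open>The inner product on the unit interval\<close>

definition L2_inner :: "(real \<Rightarrow> complex) \<Rightarrow> (real \<Rightarrow> complex) \<Rightarrow> complex" where
  "L2_inner f g = (LINT x|leb 0 1. f x * cnj (g x))"

definition affine_mult :: "real \<Rightarrow> real \<Rightarrow> (real \<Rightarrow> complex) \<Rightarrow> real \<Rightarrow> complex" where
  "affine_mult c d f x = of_real (c * x + d) * f x"

lemma affine_mult_L2: "f \<in> L2 0 1 \<Longrightarrow> affine_mult c d f \<in> L2 0 1"
  unfolding affine_mult_def by (rule L2_mult_affine)

lemma L2_inner_integrable: "f \<in> L2 0 1 \<Longrightarrow> g \<in> L2 0 1 \<Longrightarrow> integrable (leb 0 1) (\<lambda>x. f x * cnj (g x))"
  by (intro L2_mult_integrable L2_cnj)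

lemma L2_inner_add_left:
  "f \<in> L2 0 1 \<Longrightarrow> g \<in> L2 0 1 \<Longrightarrow> h \<in> L2 0 1 \<Longrightarrow>
    L2_inner (\<lambda>x. f x + g x) h = L2_inner f h + L2_inner g h"
  by (simp add: L2_inner_def distrib_right L2_inner_integrable)

lemma L2_inner_diff_left:
  "f \<in> L2 0 1 \<Longrightarrow> g \<in> L2 0 1 \<Longrightarrow> h \<in> L2 0 1 \<Longrightarrow>
    L2_inner (\<lambda>x. f x - g x) h = L2_inner f h - L2_inner g h"
  by (simp add: L2_inner_def left_diff_distrib L2_inner_integrable)

lemma L2_inner_add_right:
  "f \<in> L2 0 1 \<Longrightarrow> g \<in> L2 0 1 \<Longrightarrow> h \<in> L2 0 1 \<Longrightarrow>
    L2_inner f (\<lambda>x. g x + h x) = L2_inner f g + L2_inner f h"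
  by (simp add: L2_inner_def distrib_left L2_inner_integrable)

lemma L2_inner_cmult_left: "L2_inner (\<lambda>x. c * f x) g = c * L2_inner f g"
  by (simp add: L2_inner_def mult.assoc)

lemma L2_inner_cmult_right: "L2_inner f (\<lambda>x. c * g x) = cnj c * L2_inner f g"
  by (simp add: L2_inner_def mult.left_commute)

lemma L2_inner_cnj: "cnj (L2_inner f g) = L2_inner g f"
  using Bochner_Integration.integral_cnj[of "leb 0 1" "\<lambda>x. f x * cnj (g x)"]
  by (simp add: L2_inner_def mult.commute)

lemma L2_inner_Re_commute: "Re (L2_inner f g) = Re (L2_inner g f)"
  by (subst L2_inner_cnj[symmetric]) simp

lemma L2_inner_Im_commute: "Im (L2_inner f g) = - Im (L2_inner g f)"
  by (subst L2_inner_cnj[symmetric]) simp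

lemma L2_inner_self: "f \<in> L2 0 1 \<Longrightarrow> L2_inner f f = of_real ((L2norm 0 1 f)\<^sup>2)"
  unfolding L2_inner_def by (rule LINT_mult_cnj_self)

lemma L2_inner_affine_mult: "L2_inner (affine_mult c d f) g = L2_inner f (affine_mult c d g)"
  unfolding L2_inner_def affine_mult_def
  by (intro Bochner_Integration.integral_cong) (auto simp: algebra_simps)

lemma Im_L2_inner_affine_mult_self: "Im (L2_inner (affine_mult c d f) (affine_mult c' d' f)) = 0"
proof -
  have "L2_inner (affine_mult c d f) (affine_mult c' d' f) =
      L2_inner (affine_mult c' d' f) (affine_mult c d f)"
    unfolding L2_inner_def affine_mult_def
    by (intro Bochner_Integration.integral_cong) (auto simp: algebra_simps)
  then show ?thesis
    using L2_inner_Im_commute[of "affine_mult c d f" "affine_mult c' d' f"] by simp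
qed

lemma Re_L2_inner_diff_add:
  assumes "f \<in> L2 0 1" "g \<in> L2 0 1"
  shows "Re (L2_inner (\<lambda>x. f x - g x) (\<lambda>x. f x + g x)) = (L2norm 0 1 f)\<^sup>2 - (L2norm 0 1 g)\<^sup>2"
proof -
  have "L2_inner (\<lambda>x. f x - g x) (\<lambda>x. f x + g x) =
     L2_inner f f - L2_inner g f + (L2_inner f g - L2_inner g g)"
    using assms L2_diff[OF assms] by (simp add: L2_inner_add_right L2_inner_diff_left)
  then show ?thesis
    using L2_inner_Re_commute[of f g] assms by (simp add: L2_inner_self)
qed

lemma L2_inner_by_parts:
  assumes f: "has_weak_deriv 0 1 f f'" and g: "has_weak_deriv 0 1 g g'"
    and zero: "trace_at 0 1 f 0 = 0" "trace_at 0 1 f 1 = 0"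
  shows "L2_inner f' g = - L2_inner f g'"
proof -
  have "(LINT x|leb 0 1. f' x * cnj (g x) + f x * cnj (g' x)) = 0"
    using H1_by_parts[OF _ f has_weak_deriv_cnj[OF g]] zero by simp
  then show ?thesis
    using has_weak_deriv_L2[OF f] has_weak_deriv_L2[OF g]
    by (simp add: L2_inner_def L2_inner_integrable add_eq_0_iff2)
qed

text \<open>The source of every boundary term in the evolution identities below, applied to \<open>f = w\<close> and
  \<open>f = w\<^sub>y\<close>.\<close>

lemma Re_L2_inner_affine_mult_weak_deriv:
  assumes f: "has_weak_deriv 0 1 f f'"
  shows "2 * Re (L2_inner (affine_mult c d f') f) =
    (c + d) * (cmod (trace_at 0 1 f 1))\<^sup>2 - d * (cmod (trace_at 0 1 f 0))\<^sup>2 - c * (L2norm 0 1 f)\<^sup>2"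
proof -
  have "of_real (c * (L2norm 0 1 f)\<^sup>2) + L2_inner (affine_mult c d f') f + L2_inner (affine_mult c d f) f' =
      of_real ((c + d) * (cmod (trace_at 0 1 f 1))\<^sup>2 - d * (cmod (trace_at 0 1 f 0))\<^sup>2)"
    using weighted_energy_identity[OF f, of c d]
    by (simp add: L2_inner_def affine_mult_def LINT_mult_cnj_self[OF has_weak_deriv_L2(1)[OF f]]
        complex_norm_square mult.assoc del: of_real_power)
  from arg_cong[where f = Re, OF this] show ?thesis
    using L2_inner_Re_commute[of f "affine_mult c d f'"] L2_inner_affine_mult[of c d f f'] by simp
qed

section \<open>Energy identities along classical solutions\<close>

lemma dom_A_derivs:
  assumes "f \<in> dom_A"
  shows "has_weak_deriv 0 1 f (weak_deriv 0 1 f)"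
    "has_weak_deriv 0 1 (weak_deriv 0 1 f) (weak_deriv 0 1 (weak_deriv 0 1 f))"
    "trace_at 0 1 f 0 = 0" "trace_at 0 1 f 1 = 0"
  using assms by (auto simp: dom_A_def H2_def intro: has_weak_deriv_weak_deriv H01_trace_zero)

text \<open>For arbitrary weak derivatives \<open>f'\<close>, \<open>f''\<close>, so that for a difference of two functions the
  differences of their weak derivatives can be used.\<close>

lemma L2norm_le_H2norm:
  assumes f: "has_weak_deriv 0 1 f f'" and f': "has_weak_deriv 0 1 f' f''"
  shows "L2norm 0 1 f \<le> H2norm 0 1 f" "L2norm 0 1 f' \<le> H2norm 0 1 f" "L2norm 0 1 f'' \<le> H2norm 0 1 f"
proof -
  have "AE x in leb 0 1. f' x = weak_deriv 0 1 f x"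
    using weak_deriv_AE_eq[OF f] by eventually_elim simp
  then have "has_weak_deriv 0 1 (weak_deriv 0 1 f) f''"
    using has_weak_deriv_cong[OF f'] has_weak_deriv_L2(2)[OF has_weak_deriv_weak_deriv[OF has_weak_deriv_H1[OF f]]]
    by blast
  then have "H2norm 0 1 f = sqrt ((L2norm 0 1 f)\<^sup>2 + (L2norm 0 1 f')\<^sup>2 + (L2norm 0 1 f'')\<^sup>2)"
    by (simp add: H2norm_def L2norm_weak_deriv f)
  then show "L2norm 0 1 f \<le> H2norm 0 1 f" "L2norm 0 1 f' \<le> H2norm 0 1 f" "L2norm 0 1 f'' \<le> H2norm 0 1 f"
    by (auto intro!: real_le_rsqrt)
qed

locale classical_moving_solution =
  fixes \<tau> :: real and l l' :: "real \<Rightarrow> real" and w :: "real \<Rightarrow> real \<Rightarrow> complex"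
  assumes solution: "classical_solution \<tau> l l' 0 w"
begin

abbreviation "wy t \<equiv> weak_deriv 0 1 (w t)"
abbreviation "wyy t \<equiv> weak_deriv 0 1 (wy t)"

lemma w_dom: "t \<in> {0..\<tau>} \<Longrightarrow> w t \<in> dom_A"
  using solution by (simp add: classical_solution_def)

lemmas w_deriv = dom_A_derivs(1)[OF w_dom]
lemmas wy_deriv = dom_A_derivs(2)[OF w_dom]
lemmas w_trace = dom_A_derivs(3,4)[OF w_dom]

lemma w_L2: "t \<in> {0..\<tau>} \<Longrightarrow> w t \<in> L2 0 1"
  by (rule has_weak_deriv_L2(1)[OF w_deriv])

lemma wy_L2: "t \<in> {0..\<tau>} \<Longrightarrow> wy t \<in> L2 0 1"
  by (rule has_weak_deriv_L2(2)[OF w_deriv])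

lemma wyy_L2: "t \<in> {0..\<tau>} \<Longrightarrow> wyy t \<in> L2 0 1"
  by (rule has_weak_deriv_L2(2)[OF wy_deriv])

lemma w_tendsto:
  assumes t: "t \<in> {0..\<tau>}"
  shows "((\<lambda>r. L2norm 0 1 (\<lambda>y. w r y - w t y)) \<longlongrightarrow> 0) (at t within {0..\<tau>})"
    "((\<lambda>r. L2norm 0 1 (\<lambda>y. wy r y - wy t y)) \<longlongrightarrow> 0) (at t within {0..\<tau>})"
    "((\<lambda>r. L2norm 0 1 (\<lambda>y. wyy r y - wyy t y)) \<longlongrightarrow> 0) (at t within {0..\<tau>})"
proof -
  have lim: "((\<lambda>r. H2norm 0 1 (\<lambda>y. w r y - w t y)) \<longlongrightarrow> 0) (at t within {0..\<tau>})"
    using solution t by (simp add: classical_solution_def)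
  have bound: "\<forall>\<^sub>F r in at t within {0..\<tau>}. norm (L2norm 0 1 (\<lambda>y. w r y - w t y)) \<le> H2norm 0 1 (\<lambda>y. w r y - w t y) \<and>
      norm (L2norm 0 1 (\<lambda>y. wy r y - wy t y)) \<le> H2norm 0 1 (\<lambda>y. w r y - w t y) \<and>
      norm (L2norm 0 1 (\<lambda>y. wyy r y - wyy t y)) \<le> H2norm 0 1 (\<lambda>y. w r y - w t y)"
    unfolding eventually_at_filter
  proof (intro always_eventually allI impI)
    fix r assume r: "r \<in> {0..\<tau>}"
    show "norm (L2norm 0 1 (\<lambda>y. w r y - w t y)) \<le> H2norm 0 1 (\<lambda>y. w r y - w t y) \<and>
      norm (L2norm 0 1 (\<lambda>y. wy r y - wy t y)) \<le> H2norm 0 1 (\<lambda>y. w r y - w t y) \<and>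
      norm (L2norm 0 1 (\<lambda>y. wyy r y - wyy t y)) \<le> H2norm 0 1 (\<lambda>y. w r y - w t y)"
      using L2norm_le_H2norm[OF has_weak_deriv_diff[OF w_deriv[OF r] w_deriv[OF t]]
          has_weak_deriv_diff[OF wy_deriv[OF r] wy_deriv[OF t]]] by simp
  qed
  show "((\<lambda>r. L2norm 0 1 (\<lambda>y. w r y - w t y)) \<longlongrightarrow> 0) (at t within {0..\<tau>})"
    "((\<lambda>r. L2norm 0 1 (\<lambda>y. wy r y - wy t y)) \<longlongrightarrow> 0) (at t within {0..\<tau>})"
    "((\<lambda>r. L2norm 0 1 (\<lambda>y. wyy r y - wyy t y)) \<longlongrightarrow> 0) (at t within {0..\<tau>})"
    by (rule Lim_null_comparison[OF _ lim]; use bound in \<open>auto elim: eventually_mono\<close>)+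
qed

lemma continuous_trace_wy:
  assumes p: "p \<in> {0, 1}"
  shows "continuous_on {0..\<tau>} (\<lambda>t. trace_at 0 1 (wy t) p)"
  unfolding continuous_on
proof
  fix t assume t: "t \<in> {0..\<tau>}"
  have "((\<lambda>r. L2norm 0 1 (\<lambda>y. wy r y - wy t y) + L2norm 0 1 (\<lambda>y. wyy r y - wyy t y)) \<longlongrightarrow> 0 + 0)
      (at t within {0..\<tau>})"
    by (intro tendsto_add w_tendsto t)
  moreover have "\<forall>\<^sub>F r in at t within {0..\<tau>}. norm (trace_at 0 1 (wy r) p - trace_at 0 1 (wy t) p) \<le>
      L2norm 0 1 (\<lambda>y. wy r y - wy t y) + L2norm 0 1 (\<lambda>y. wyy r y - wyy t y)"
    unfolding eventually_at_filter
  proof (intro always_eventually allI impI)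
    fix r assume r: "r \<in> {0..\<tau>}"
    have "trace_at 0 1 (\<lambda>y. wy r y - wy t y) p = trace_at 0 1 (wy r) p - trace_at 0 1 (wy t) p"
      using p by (intro trace_at_diff[OF _ wy_deriv[OF r] wy_deriv[OF t]]) auto
    then show "norm (trace_at 0 1 (wy r) p - trace_at 0 1 (wy t) p) \<le>
        L2norm 0 1 (\<lambda>y. wy r y - wy t y) + L2norm 0 1 (\<lambda>y. wyy r y - wyy t y)"
      using trace_at_bound[OF has_weak_deriv_diff[OF wy_deriv[OF r] wy_deriv[OF t]] p] by simp
  qed
  ultimately have "((\<lambda>r. trace_at 0 1 (wy r) p - trace_at 0 1 (wy t) p) \<longlongrightarrow> 0) (at t within {0..\<tau>})"
    using Lim_null_comparison by force
  then show "((\<lambda>r. trace_at 0 1 (wy r) p) \<longlongrightarrow> trace_at 0 1 (wy t) p) (at t within {0..\<tau>})"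
    by (rule LIM_zero_cancel)
qed

lemma A_op_eq:
  "A_op l l' t (w t) = (\<lambda>y. (\<i> * of_real (1 / (l t)\<^sup>2)) * wyy t y + of_real (l' t / l t) * affine_mult 1 0 (wy t) y)"
  by (auto simp: A_op_def affine_mult_def)

lemma A_op_L2: "t \<in> {0..\<tau>} \<Longrightarrow> A_op l l' t (w t) \<in> L2 0 1"
  unfolding A_op_eq by (intro L2_add L2_cmult affine_mult_L2 wy_L2 wyy_L2)

lemma L2_inner_A_op:
  assumes "t \<in> {0..\<tau>}" "v \<in> L2 0 1"
  shows "L2_inner (A_op l l' t (w t)) v =
    \<i> * of_real (1 / (l t)\<^sup>2) * L2_inner (wyy t) v + of_real (l' t / l t) * L2_inner (affine_mult 1 0 (wy t)) v"
proof -
  have "L2_inner (A_op l l' t (w t)) v =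
     L2_inner (\<lambda>y. (\<i> * of_real (1 / (l t)\<^sup>2)) * wyy t y) v +
     L2_inner (\<lambda>y. of_real (l' t / l t) * affine_mult 1 0 (wy t) y) v"
    unfolding A_op_eq
    by (intro L2_inner_add_left L2_cmult affine_mult_L2 wy_L2[OF assms(1)] wyy_L2[OF assms(1)] assms(2))
  then show ?thesis by (simp only: L2_inner_cmult_left)
qed

text \<open>The difference quotients of \<open>w\<close> converge only in \<open>L\<^sub>2\<close>. A real function of time is thus
  differentiable if its increment is a pairing of \<open>w r - w t\<close> with some \<open>v r\<close> that is continuous at
  \<open>t\<close> in \<open>L\<^sub>2\<close>. Below, \<open>v\<close> involves at most \<open>w\<^sub>y\<^sub>y\<close>, which is continuous since \<open>w\<close> is continuous
  into \<open>H\<^sup>2\<close>.\<close>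

lemma pairing_has_derivative:
  assumes t: "t \<in> {0..\<tau>}"
    and v: "\<And>r. r \<in> {0..\<tau>} \<Longrightarrow> v r \<in> L2 0 1"
    and lim: "((\<lambda>r. L2norm 0 1 (\<lambda>y. v r y - v t y)) \<longlongrightarrow> 0) (at t within {0..\<tau>})"
    and Q: "\<And>r. r \<in> {0..\<tau>} \<Longrightarrow> Q r - Q t = Re (L2_inner (\<lambda>y. w r y - w t y) (v r))"
  shows "(Q has_real_derivative Re (L2_inner (A_op l l' t (w t)) (v t))) (at t within {0..\<tau>})"
  unfolding has_field_derivative_iff
proof (rule Lim_transform_eventually)
  have ev: "\<forall>\<^sub>F r in at t within {0..\<tau>}. P r" if "\<And>r. r \<in> {0..\<tau>} \<Longrightarrow> r \<noteq> t \<Longrightarrow> P r" for P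
    unfolding eventually_at_filter using that by (intro always_eventually) auto
  have quotient: "(\<lambda>y. (w r y - w t y) / of_real (r - t)) \<in> L2 0 1" if "r \<in> {0..\<tau>}" for r
    using L2_cmult[OF L2_diff[OF w_L2[OF that] w_L2[OF t]], of "1 / of_real (r - t)"] by simp
  have "((\<lambda>r. LINT y|leb 0 1. (w r y - w t y) / of_real (r - t) * cnj (v r y)) \<longlongrightarrow>
      (LINT y|leb 0 1. A_op l l' t (w t) y * cnj (v t y))) (at t within {0..\<tau>})"
  proof (rule L2_pairing_tendsto)
    show "((\<lambda>r. L2norm 0 1 (\<lambda>y. (w r y - w t y) / of_real (r - t) - A_op l l' t (w t) y)) \<longlongrightarrow> 0)
        (at t within {0..\<tau>})"
      using solution t by (simp add: classical_solution_def)
    have "L2norm 0 1 (\<lambda>y. cnj (v r y) - cnj (v t y)) = L2norm 0 1 (\<lambda>y. v r y - v t y)" for r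
      using L2norm_cnj[of 0 1 "\<lambda>y. v r y - v t y"] by simp
    then show "((\<lambda>r. L2norm 0 1 (\<lambda>y. cnj (v r y) - cnj (v t y))) \<longlongrightarrow> 0) (at t within {0..\<tau>})"
      using lim by simp
    show "\<forall>\<^sub>F r in at t within {0..\<tau>}. (\<lambda>y. (w r y - w t y) / of_real (r - t)) \<in> L2 0 1"
      by (rule ev) (rule quotient)
    show "\<forall>\<^sub>F r in at t within {0..\<tau>}. (\<lambda>y. cnj (v r y)) \<in> L2 0 1"
      by (rule ev) (intro L2_cnj v)
  qed (intro A_op_L2 L2_cnj v t)+
  then show "((\<lambda>r. Re (LINT y|leb 0 1. (w r y - w t y) / of_real (r - t) * cnj (v r y))) \<longlongrightarrow>
      Re (L2_inner (A_op l l' t (w t)) (v t))) (at t within {0..\<tau>})"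
    unfolding L2_inner_def by (rule tendsto_Re)
  show "\<forall>\<^sub>F r in at t within {0..\<tau>}.
      Re (LINT y|leb 0 1. (w r y - w t y) / of_real (r - t) * cnj (v r y)) = (Q r - Q t) / (r - t)"
  proof (rule ev)
    fix r assume r: "r \<in> {0..\<tau>}" "r \<noteq> t"
    have "(LINT y|leb 0 1. (w r y - w t y) / of_real (r - t) * cnj (v r y)) =
        (LINT y|leb 0 1. of_real (1 / (r - t)) * ((w r y - w t y) * cnj (v r y)))"
      by (intro Bochner_Integration.integral_cong) auto
    also have "\<dots> = of_real (1 / (r - t)) * L2_inner (\<lambda>y. w r y - w t y) (v r)"
      unfolding L2_inner_def by (rule integral_mult_right_zero)
    finally have "(LINT y|leb 0 1. (w r y - w t y) / of_real (r - t) * cnj (v r y)) =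
        of_real (1 / (r - t)) * L2_inner (\<lambda>y. w r y - w t y) (v r)" .
    then show "Re (LINT y|leb 0 1. (w r y - w t y) / of_real (r - t) * cnj (v r y)) = (Q r - Q t) / (r - t)"
      unfolding Q[OF r(1)] by (simp only: times_complex.simps Re_complex_of_real Im_complex_of_real) simp
  qed
qed

definition mass :: "real \<Rightarrow> real" where
  "mass t = (L2norm 0 1 (w t))\<^sup>2"

definition energy :: "real \<Rightarrow> real" where
  "energy t = (L2norm 0 1 (wy t))\<^sup>2"

text \<open>Up to sign the quantum mechanical momentum, localized by the multiplier \<open>c y + d\<close>.\<close>

definition momentum :: "real \<Rightarrow> real \<Rightarrow> real \<Rightarrow> real" where
  "momentum c d t = Im (L2_inner (w t) (affine_mult c d (wy t)))"

text \<open>Taken in the fixed coordinate; division by \<open>(l t)\<^sup>2\<close> gives \<open>\<bar>u\<^sub>x\<bar>\<^sup>2\<close> at the end points.\<close>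

definition flux0 :: "real \<Rightarrow> real" where
  "flux0 t = (cmod (trace_at 0 1 (wy t) 0))\<^sup>2"

definition flux1 :: "real \<Rightarrow> real" where
  "flux1 t = (cmod (trace_at 0 1 (wy t) 1))\<^sup>2"

lemma L2_inner_wyy_w:
  assumes t: "t \<in> {0..\<tau>}"
  shows "L2_inner (wyy t) (w t) = - of_real (energy t)"
proof -
  have "L2_inner (w t) (wyy t) = - of_real (energy t)"
    using L2_inner_by_parts[OF w_deriv[OF t] wy_deriv[OF t] w_trace[OF t]] L2_inner_self[OF wy_L2[OF t]]
    by (simp add: energy_def equation_minus_iff[of _ "L2_inner _ _"])
  then show ?thesis
    using L2_inner_cnj[of "w t" "wyy t"] by simp
qed

text \<open>The second order term is skew-adjoint and drops out; the transport term contributes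
  \<open>l'/l\<close> times \<open>\<integral> y (\<bar>w\<bar>\<^sup>2)\<^sub>y = - \<parallel>w\<parallel>\<^sup>2\<close>.\<close>

lemma mass_has_derivative:
  assumes t: "t \<in> {0..\<tau>}"
  shows "(mass has_real_derivative - (l' t / l t) * mass t) (at t within {0..\<tau>})"
proof -
  have "(mass has_real_derivative Re (L2_inner (A_op l l' t (w t)) (\<lambda>y. w t y + w t y))) (at t within {0..\<tau>})"
  proof (rule pairing_has_derivative[OF t, where v = "\<lambda>r y. w r y + w t y"])
    show "((\<lambda>r. L2norm 0 1 (\<lambda>y. w r y + w t y - (w t y + w t y))) \<longlongrightarrow> 0) (at t within {0..\<tau>})"
      using w_tendsto(1)[OF t] by simp
    show "mass r - mass t = Re (L2_inner (\<lambda>y. w r y - w t y) (\<lambda>y. w r y + w t y))" if "r \<in> {0..\<tau>}" for r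
      unfolding mass_def Re_L2_inner_diff_add[OF w_L2[OF that] w_L2[OF t]] ..
  qed (intro L2_add w_L2 t; assumption)
  moreover have "Re (L2_inner (A_op l l' t (w t)) (\<lambda>y. w t y + w t y)) = - (l' t / l t) * mass t"
  proof -
    have 1: "Im (L2_inner (wyy t) (w t)) = 0"
      by (simp add: L2_inner_wyy_w[OF t])
    have 2: "2 * Re (L2_inner (affine_mult 1 0 (wy t)) (w t)) = - mass t"
      using Re_L2_inner_affine_mult_weak_deriv[OF w_deriv[OF t], of 1 0] w_trace[OF t]
      by (simp add: mass_def)
    have "Re (L2_inner (A_op l l' t (w t)) (\<lambda>y. w t y + w t y)) = 2 * Re (L2_inner (A_op l l' t (w t)) (w t))"
      using L2_inner_add_right[OF A_op_L2[OF t] w_L2[OF t] w_L2[OF t]] by simp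
    also have "\<dots> = l' t / l t * (2 * Re (L2_inner (affine_mult 1 0 (wy t)) (w t)))"
      using 1 by (simp add: L2_inner_A_op[OF t w_L2[OF t]])
    finally show ?thesis unfolding 2 by simp
  qed
  ultimately show ?thesis by simp
qed

text \<open>An integration by parts puts the increment of the energy into the form of a pairing of
  \<open>w r - w t\<close> with \<open>- (w\<^sub>y\<^sub>y(r) + w\<^sub>y\<^sub>y(t))\<close>. In the limit the term \<open>\<i> \<parallel>w\<^sub>y\<^sub>y\<parallel>\<^sup>2\<close> is imaginary, and the
  transport term produces the flux at the moving end, since its weight \<open>y\<close> vanishes at \<open>0\<close>.\<close>

lemma energy_has_derivative:
  assumes t: "t \<in> {0..\<tau>}"
  shows "(energy has_real_derivative (l' t / l t) * (energy t - flux1 t)) (at t within {0..\<tau>})"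
proof -
  define v where "v r y = - 1 * (wyy r y + wyy t y)" for r y
  have vL2: "v r \<in> L2 0 1" if "r \<in> {0..\<tau>}" for r
    unfolding v_def by (intro L2_cmult L2_add wyy_L2 that t)
  have "(energy has_real_derivative Re (L2_inner (A_op l l' t (w t)) (v t))) (at t within {0..\<tau>})"
  proof (rule pairing_has_derivative[OF t vL2])
    have "L2norm 0 1 (\<lambda>y. v r y - v t y) = L2norm 0 1 (\<lambda>y. wyy r y - wyy t y)" for r
      using L2norm_minus_commute[of 0 1 "wyy r" "wyy t"] by (simp add: v_def)
    then show "((\<lambda>r. L2norm 0 1 (\<lambda>y. v r y - v t y)) \<longlongrightarrow> 0) (at t within {0..\<tau>})"
      using w_tendsto(3)[OF t] by simp
    fix r assume r: "r \<in> {0..\<tau>}"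
    have "L2_inner (\<lambda>y. wy r y - wy t y) (\<lambda>y. wy r y + wy t y) =
        - L2_inner (\<lambda>y. w r y - w t y) (\<lambda>y. wyy r y + wyy t y)"
    proof (rule L2_inner_by_parts)
      show "trace_at 0 1 (\<lambda>y. w r y - w t y) 0 = 0" "trace_at 0 1 (\<lambda>y. w r y - w t y) 1 = 0"
        using trace_at_diff[OF _ w_deriv[OF r] w_deriv[OF t], of 0]
          trace_at_diff[OF _ w_deriv[OF r] w_deriv[OF t], of 1] w_trace[OF t] w_trace[OF r] by auto
    qed (intro has_weak_deriv_diff has_weak_deriv_add w_deriv wy_deriv r t)+
    also have "\<dots> = L2_inner (\<lambda>y. w r y - w t y) (v r)"
      unfolding v_def L2_inner_cmult_right by simp
    finally show "energy r - energy t = Re (L2_inner (\<lambda>y. w r y - w t y) (v r))"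
      unfolding energy_def using Re_L2_inner_diff_add[OF wy_L2[OF r] wy_L2[OF t]] by simp
  qed
  moreover have "Re (L2_inner (A_op l l' t (w t)) (v t)) = (l' t / l t) * (energy t - flux1 t)"
  proof -
    have v: "v t = (\<lambda>y. - 2 * wyy t y)" by (auto simp: v_def)
    have 1: "Im (L2_inner (wyy t) (wyy t)) = 0"
      using L2_inner_self[OF wyy_L2[OF t]] by simp
    have 2: "2 * Re (L2_inner (affine_mult 1 0 (wy t)) (wyy t)) = flux1 t - energy t"
      using Re_L2_inner_affine_mult_weak_deriv[OF wy_deriv[OF t], of 1 0]
        L2_inner_Re_commute[of "affine_mult 1 0 (wy t)" "wyy t"]
        L2_inner_affine_mult[of 1 0 "wyy t" "wy t"]
      by (simp add: energy_def flux1_def)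
    have "Re (L2_inner (A_op l l' t (w t)) (v t)) = - 2 * Re (L2_inner (A_op l l' t (w t)) (wyy t))"
      unfolding v L2_inner_cmult_right by simp
    also have "\<dots> = - (l' t / l t) * (2 * Re (L2_inner (affine_mult 1 0 (wy t)) (wyy t)))"
      using 1 by (simp add: L2_inner_A_op[OF t wyy_L2[OF t]])
    finally show ?thesis unfolding 2 by (simp add: algebra_simps)
  qed
  ultimately show ?thesis by simp
qed

text \<open>The multiplier identity. The increment is a pairing with
  \<open>q w\<^sub>y(r) + q w\<^sub>y(t) + q' w(t)\<close>, after one integration by parts; the factor \<open>\<i>\<close> in \<open>v\<close>
  below turns its imaginary part into a real part.\<close>

lemma momentum_has_derivative:
  assumes t: "t \<in> {0..\<tau>}"
  shows "(momentum c d has_real_derivative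
      ((c + d) * flux1 t - d * flux0 t - 2 * c * energy t) / (l t)\<^sup>2
        - c * (l' t / l t) * momentum 1 0 t) (at t within {0..\<tau>})"
proof -
  define z where "z r y = affine_mult c d (wy r) y + (affine_mult c d (wy t) y + of_real c * w t y)" for r y
  define v where "v r y = \<i> * z r y" for r y
  have zL2: "z r \<in> L2 0 1" if "r \<in> {0..\<tau>}" for r
    unfolding z_def by (intro L2_cmult L2_add affine_mult_L2 wy_L2 w_L2 that t)
  have vL2: "v r \<in> L2 0 1" if "r \<in> {0..\<tau>}" for r
    unfolding v_def by (intro L2_cmult zL2 that)
  have Re_v: "Re (L2_inner f (v r)) = Im (L2_inner f (z r))" for f r
    unfolding v_def L2_inner_cmult_right by simp
  have "(momentum c d has_real_derivative Re (L2_inner (A_op l l' t (w t)) (v t))) (at t within {0..\<tau>})"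
  proof (rule pairing_has_derivative[OF t vL2])
    define K where "K = \<bar>c\<bar> + \<bar>d\<bar>"
    have bound: "L2norm 0 1 (\<lambda>y. v r y - v t y) \<le> K * L2norm 0 1 (\<lambda>y. wy r y - wy t y)" if r: "r \<in> {0..\<tau>}" for r
    proof -
      have "(L2norm 0 1 (\<lambda>y. v r y - v t y))\<^sup>2 \<le> (K * L2norm 0 1 (\<lambda>y. wy r y - wy t y))\<^sup>2"
        unfolding power_mult_distrib L2norm_sq integral_mult_right_zero[symmetric]
      proof (intro integral_mono integrable_mult_right L2_integrable_norm_sq L2_diff vL2 wy_L2 r t)
        fix y assume "y \<in> space (leb 0 1)"
        then have y: "0 < y" "y < 1" by auto
        have "\<bar>c * y + d\<bar> \<le> \<bar>c\<bar> * \<bar>y\<bar> + \<bar>d\<bar>" by (metis abs_mult abs_triangle_ineq)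
        also have "\<dots> \<le> K" using y by (simp add: K_def mult_left_le)
        finally have K: "\<bar>c * y + d\<bar> \<le> K" .
        have "v r y - v t y = \<i> * (of_real (c * y + d) * (wy r y - wy t y))"
          by (simp add: v_def z_def affine_mult_def algebra_simps)
        then have "cmod (v r y - v t y) = \<bar>c * y + d\<bar> * cmod (wy r y - wy t y)"
          by (simp only: norm_mult norm_of_real) simp
        then have "cmod (v r y - v t y) \<le> K * cmod (wy r y - wy t y)"
          using K by (simp add: mult_right_mono)
        then show "(cmod (v r y - v t y))\<^sup>2 \<le> K\<^sup>2 * (cmod (wy r y - wy t y))\<^sup>2"
          unfolding power_mult_distrib[symmetric] by (intro power_mono) auto
      qed
      then show ?thesis
        by (rule power2_le_imp_le) (simp add: K_def)
    qed
    show "((\<lambda>r. L2norm 0 1 (\<lambda>y. v r y - v t y)) \<longlongrightarrow> 0) (at t within {0..\<tau>})"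
    proof (rule Lim_null_comparison)
      show "((\<lambda>r. K * L2norm 0 1 (\<lambda>y. wy r y - wy t y)) \<longlongrightarrow> 0) (at t within {0..\<tau>})"
        by (rule tendsto_mult_right_zero[OF w_tendsto(2)[OF t]])
      show "\<forall>\<^sub>F r in at t within {0..\<tau>}. norm (L2norm 0 1 (\<lambda>y. v r y - v t y)) \<le> K * L2norm 0 1 (\<lambda>y. wy r y - wy t y)"
        unfolding eventually_at_filter using bound by (intro always_eventually) auto
    qed
    fix r assume r: "r \<in> {0..\<tau>}"
    note rt = w_L2[OF r] w_L2[OF t] wy_L2[OF r] wy_L2[OF t]
    have parts: "L2_inner (\<lambda>y. of_real c * w t y + affine_mult c d (wy t) y) (\<lambda>y. w r y - w t y) =
        - L2_inner (affine_mult c d (w t)) (\<lambda>y. wy r y - wy t y)"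
    proof (rule L2_inner_by_parts)
      show "has_weak_deriv 0 1 (affine_mult c d (w t)) (\<lambda>y. of_real c * w t y + affine_mult c d (wy t) y)"
        unfolding affine_mult_def by (rule has_weak_deriv_mult_affine[OF w_deriv[OF t]])
      have "trace_at 0 1 (affine_mult c d (w t)) p = of_real (c * p + d) * trace_at 0 1 (w t) p"
        if "p \<in> {0..1}" for p
        unfolding affine_mult_def using that
        by (intro trace_at_mult[OF _ w_deriv[OF t]]) (auto intro!: continuous_intros)
      then show "trace_at 0 1 (affine_mult c d (w t)) 0 = 0" "trace_at 0 1 (affine_mult c d (w t)) 1 = 0"
        using w_trace[OF t] by auto
    qed (intro has_weak_deriv_diff w_deriv r t)
    have "L2_inner (affine_mult c d (w t)) (\<lambda>y. wy r y - wy t y) =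
        L2_inner (w t) (affine_mult c d (wy r)) - L2_inner (w t) (affine_mult c d (wy t))"
      using L2_inner_diff_left[OF rt(3,4) affine_mult_L2[OF rt(2)], of c d]
        L2_inner_cnj[of "affine_mult c d (w t)" "\<lambda>y. wy r y - wy t y"]
        L2_inner_cnj[of "wy r" "affine_mult c d (w t)"] L2_inner_cnj[of "wy t" "affine_mult c d (w t)"]
        L2_inner_affine_mult[of c d "w t"]
      by (metis complex_cnj_cnj complex_cnj_diff)
    then have second: "Im (L2_inner (w t) (affine_mult c d (wy r))) - Im (L2_inner (w t) (affine_mult c d (wy t))) =
        Im (L2_inner (\<lambda>y. w r y - w t y) (\<lambda>y. of_real c * w t y + affine_mult c d (wy t) y))"
      using parts L2_inner_Im_commute[of "\<lambda>y. w r y - w t y" "\<lambda>y. of_real c * w t y + affine_mult c d (wy t) y"]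
      by simp
    have first: "Im (L2_inner (w r) (affine_mult c d (wy r))) - Im (L2_inner (w t) (affine_mult c d (wy r))) =
        Im (L2_inner (\<lambda>y. w r y - w t y) (affine_mult c d (wy r)))"
      using L2_inner_diff_left[OF rt(1,2) affine_mult_L2[OF rt(3)], of c d] by simp
    have "L2_inner (\<lambda>y. w r y - w t y) (z r) = L2_inner (\<lambda>y. w r y - w t y) (affine_mult c d (wy r)) +
        L2_inner (\<lambda>y. w r y - w t y) (\<lambda>y. of_real c * w t y + affine_mult c d (wy t) y)"
      unfolding z_def
      by (subst L2_inner_add_right)
         (auto intro!: L2_diff L2_add L2_cmult affine_mult_L2 rt simp: add.commute)
    then show "momentum c d r - momentum c d t = Re (L2_inner (\<lambda>y. w r y - w t y) (v r))"
      unfolding Re_v momentum_def using first second by simp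
  qed
  moreover have "Re (L2_inner (A_op l l' t (w t)) (v t)) =
      ((c + d) * flux1 t - d * flux0 t - 2 * c * energy t) / (l t)\<^sup>2 - c * (l' t / l t) * momentum 1 0 t"
  proof -
    note L2s = w_L2[OF t] wy_L2[OF t] wyy_L2[OF t]
    have zt: "z t = (\<lambda>y. 2 * affine_mult c d (wy t) y + of_real c * w t y)"
      by (auto simp: z_def)
    have split: "L2_inner f (z t) = 2 * L2_inner f (affine_mult c d (wy t)) + of_real c * L2_inner f (w t)"
      if "f \<in> L2 0 1" for f
      unfolding zt
      using L2_inner_add_right[OF that L2_cmult[OF affine_mult_L2[OF L2s(2)]] L2_cmult[OF L2s(1)], of 2 c d "of_real c"]
      by (simp add: L2_inner_cmult_right)
    have 1: "2 * Re (L2_inner (wyy t) (affine_mult c d (wy t))) = (c + d) * flux1 t - d * flux0 t - c * energy t"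
      using Re_L2_inner_affine_mult_weak_deriv[OF wy_deriv[OF t], of c d] L2_inner_affine_mult[of c d "wyy t" "wy t"]
      by (simp add: flux0_def flux1_def energy_def)
    have 2: "Re (L2_inner (wyy t) (w t)) = - energy t"
      by (simp add: L2_inner_wyy_w[OF t])
    have 3: "Im (L2_inner (affine_mult 1 0 (wy t)) (w t)) = - momentum 1 0 t"
      unfolding momentum_def by (rule L2_inner_Im_commute)
    have "Re (L2_inner (wyy t) (z t)) = (c + d) * flux1 t - d * flux0 t - 2 * c * energy t"
      unfolding split[OF L2s(3)] using 1 2 by simp
    moreover have "Im (L2_inner (affine_mult 1 0 (wy t)) (z t)) = - c * momentum 1 0 t"
      unfolding split[OF affine_mult_L2[OF L2s(2)]] using 3 Im_L2_inner_affine_mult_self by simp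
    ultimately show ?thesis
      unfolding Re_v L2_inner_A_op[OF t zL2[OF t]] by simp
  qed
  ultimately show ?thesis by simp
qed

lemma mass_le_energy: "t \<in> {0..\<tau>} \<Longrightarrow> mass t \<le> 4 * energy t"
proof -
  assume t: "t \<in> {0..\<tau>}"
  have "(L2norm 0 1 (w t))\<^sup>2 \<le> (2 * L2norm 0 1 (wy t))\<^sup>2"
    by (intro power_mono Poincare_inequality w_deriv w_trace t) auto
  then show ?thesis by (simp add: mass_def energy_def power_mult_distrib)
qed

lemma momentum_bound:
  assumes t: "t \<in> {0..\<tau>}" and q: "\<And>x. x \<in> {0<..<1} \<Longrightarrow> \<bar>c * x + d\<bar> \<le> 1"
  shows "\<bar>momentum c d t\<bar> \<le> sqrt (mass t) * sqrt (energy t)"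
proof -
  have "\<bar>momentum c d t\<bar> \<le> cmod (L2_inner (affine_mult c d (w t)) (wy t))"
    unfolding momentum_def L2_inner_affine_mult by (rule abs_Im_le_cmod)
  also have "\<dots> \<le> L2norm 0 1 (w t) * L2norm 0 1 (wy t)"
    unfolding L2_inner_def affine_mult_def by (intro weighted_pairing_le w_L2 wy_L2 t q)
  finally show ?thesis by (simp add: mass_def energy_def)
qed

lemma momentum_le_energy:
  assumes t: "t \<in> {0..\<tau>}" and q: "\<And>x. x \<in> {0<..<1} \<Longrightarrow> \<bar>c * x + d\<bar> \<le> 1"
  shows "\<bar>momentum c d t\<bar> \<le> 2 * energy t"
proof -
  have "sqrt (mass t) \<le> sqrt (4 * energy t)"
    using mass_le_energy[OF t] by simp
  then have "sqrt (mass t) * sqrt (energy t) \<le> sqrt (4 * energy t) * sqrt (energy t)"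
    by (intro mult_right_mono) (auto simp: energy_def)
  also have "\<dots> = 2 * energy t"
    by (simp add: real_sqrt_mult energy_def power2_eq_square)
  finally show ?thesis
    using momentum_bound[OF assms] by simp
qed

end

section \<open>Growth of the energy and the boundary flux\<close>

context classical_moving_solution
begin

lemma energy_nonneg: "0 \<le> energy t" and mass_nonneg: "0 \<le> mass t"
  by (simp_all add: energy_def mass_def)

text \<open>The weight \<open>y\<close> vanishes at \<open>0\<close> and equals \<open>1\<close> at \<open>1\<close>, so the derivative of \<open>l l' momentum 1 0\<close>
  contains \<open>(l'/l) flux1\<close>, which cancels the flux in the derivative of the energy. The terms with
  \<open>l'\<^sup>2\<close> cancel as well.\<close>

lemma modified_energy_has_derivative:
  assumes t: "t \<in> {0..\<tau>}" and "l t \<noteq> 0"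
    and l: "(l has_real_derivative l' t) (at t within {0..\<tau>})"
    and l': "(l' has_real_derivative l'' t) (at t within {0..\<tau>})"
  shows "((\<lambda>t. energy t + l t * l' t * momentum 1 0 t) has_real_derivative
      - (l' t / l t) * energy t + l t * l'' t * momentum 1 0 t) (at t within {0..\<tau>})"
proof -
  have "((\<lambda>t. energy t + l t * l' t * momentum 1 0 t) has_real_derivative
      (l' t / l t) * (energy t - flux1 t) +
      ((l t * l'' t + l' t * l' t) * momentum 1 0 t + ((flux1 t - 2 * energy t) / (l t)\<^sup>2
        - (l' t / l t) * momentum 1 0 t) * (l t * l' t)))
      (at t within {0..\<tau>})"
    using momentum_has_derivative[OF t, of 1 0]
    by (intro DERIV_add energy_has_derivative[OF t] DERIV_mult DERIV_mult' l l') simp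
  also have "(l' t / l t) * (energy t - flux1 t) +
      ((l t * l'' t + l' t * l' t) * momentum 1 0 t + ((flux1 t - 2 * energy t) / (l t)\<^sup>2
        - (l' t / l t) * momentum 1 0 t) * (l t * l' t)) =
      - (l' t / l t) * energy t + l t * l'' t * momentum 1 0 t"
    using \<open>l t \<noteq> 0\<close> by (simp add: field_simps power2_eq_square)
  finally show ?thesis .
qed

text \<open>Gronwall's argument for the modified energy. The constant is explicit to make it visible
  that it depends on \<open>l\<close> and \<open>\<tau>\<close> only.\<close>

lemma energy_growth:
  assumes l_nz: "\<And>t. t \<in> {0..\<tau>} \<Longrightarrow> l t \<noteq> 0"
    and l: "\<And>t. t \<in> {0..\<tau>} \<Longrightarrow> (l has_real_derivative l' t) (at t within {0..\<tau>})"
    and l': "\<And>t. t \<in> {0..\<tau>} \<Longrightarrow> (l' has_real_derivative l'' t) (at t within {0..\<tau>})"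
    and b: "\<And>t. t \<in> {0..\<tau>} \<Longrightarrow> \<bar>l' t / l t\<bar> \<le> b"
    and B1: "\<And>t. t \<in> {0..\<tau>} \<Longrightarrow> \<bar>l t * l' t\<bar> \<le> B1"
    and B2: "\<And>t. t \<in> {0..\<tau>} \<Longrightarrow> \<bar>l t * l'' t\<bar> \<le> B2"
    and s: "s \<in> {0..\<tau>}"
  shows "energy s \<le> 2 * exp (2 * (b + 2 * B2 + 4 * B1\<^sup>2 * b) * \<tau>) * (1 + 2 * B1 + 4 * B1\<^sup>2) * energy 0"
proof -
  define K where "K = b + 2 * B2 + 4 * B1\<^sup>2 * b"
  \<comment> \<open>The multiple of the mass absorbs the momentum term, whose size is at most \<open>B1 sqrt (mass) sqrt (energy)\<close>.\<close>
  define \<Phi> where "\<Phi> t = energy t + l t * l' t * momentum 1 0 t + B1\<^sup>2 * mass t" for t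
  have pos: "0 \<le> b" "0 \<le> B1" "0 \<le> B2"
    using b[OF s] B1[OF s] B2[OF s] by linarith+
  have "0 \<le> K" using pos by (simp add: K_def)
  have J1: "\<bar>momentum 1 0 t\<bar> \<le> sqrt (mass t) * sqrt (energy t)" "\<bar>momentum 1 0 t\<bar> \<le> 2 * energy t"
    if "t \<in> {0..\<tau>}" for t
    using momentum_bound[OF that, of 1 0] momentum_le_energy[OF that, of 1 0] by auto
  have lower: "energy t \<le> 2 * \<Phi> t" if t: "t \<in> {0..\<tau>}" for t
  proof -
    have "\<bar>l t * l' t * momentum 1 0 t\<bar> \<le> B1 * (sqrt (mass t) * sqrt (energy t))"
      unfolding abs_mult[of "l t * l' t"] by (intro mult_mono B1 J1 t) (auto simp: pos)
    also have "\<dots> = (B1 * sqrt (mass t)) * sqrt (energy t)" by simp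
    also have "\<dots> \<le> ((B1 * sqrt (mass t))\<^sup>2 + (sqrt (energy t))\<^sup>2) / 2"
      using sum_squares_bound[of "B1 * sqrt (mass t)" "sqrt (energy t)"] by simp
    also have "\<dots> = (B1\<^sup>2 * mass t + energy t) / 2"
      using energy_nonneg mass_nonneg by (simp add: power_mult_distrib)
    finally show ?thesis
      using mult_nonneg_nonneg[OF zero_le_power2[of B1] mass_nonneg[of t]] unfolding \<Phi>_def by simp
  qed
  have deriv: "(\<Phi> has_real_derivative - (l' t / l t) * energy t + l t * l'' t * momentum 1 0 t
      + B1\<^sup>2 * (- (l' t / l t) * mass t)) (at t within {0..\<tau>})" if t: "t \<in> {0..\<tau>}" for t
    unfolding \<Phi>_def
    by (intro DERIV_add DERIV_cmult modified_energy_has_derivative mass_has_derivative t l_nz l l')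
  have slope: "- (l' t / l t) * energy t + l t * l'' t * momentum 1 0 t + B1\<^sup>2 * (- (l' t / l t) * mass t)
      \<le> 2 * K * \<Phi> t" if t: "t \<in> {0..\<tau>}" for t
  proof -
    have \<beta>: "- (l' t / l t) \<le> b"
      using b[OF t] by linarith
    have 1: "- (l' t / l t) * energy t \<le> b * energy t"
      by (intro mult_right_mono energy_nonneg \<beta>)
    have "\<bar>l t * l'' t * momentum 1 0 t\<bar> \<le> B2 * (2 * energy t)"
      unfolding abs_mult[of "l t * l'' t"] by (intro mult_mono B2 J1 t) (auto simp: pos)
    then have 2: "l t * l'' t * momentum 1 0 t \<le> B2 * (2 * energy t)"
      by linarith
    have "- (l' t / l t) * mass t \<le> b * (4 * energy t)"
      by (intro mult_mono mass_le_energy[OF t] mass_nonneg pos \<beta>)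
    then have 3: "B1\<^sup>2 * (- (l' t / l t) * mass t) \<le> B1\<^sup>2 * (b * (4 * energy t))"
      by (intro mult_left_mono) auto
    have "- (l' t / l t) * energy t + l t * l'' t * momentum 1 0 t + B1\<^sup>2 * (- (l' t / l t) * mass t)
        \<le> K * energy t"
      using 1 2 3 by (simp add: K_def algebra_simps)
    also have "\<dots> \<le> K * (2 * \<Phi> t)"
      by (intro mult_left_mono lower t \<open>0 \<le> K\<close>)
    finally show ?thesis by simp
  qed
  have d: "((\<lambda>t. \<Phi> t * exp (- (2 * K) * t)) has_real_derivative
      ((- (l' t / l t) * energy t + l t * l'' t * momentum 1 0 t + B1\<^sup>2 * (- (l' t / l t) * mass t))
        - 2 * K * \<Phi> t) * exp (- (2 * K) * t)) (at t within {0..\<tau>})" if "t \<in> {0..\<tau>}" for t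
    by (rule derivative_eq_intros deriv[OF that] refl | simp add: algebra_simps)+
  have "\<Phi> s * exp (- (2 * K) * s) \<le> \<Phi> 0 * exp (- (2 * K) * 0)"
  proof (rule DERIV_nonpos_imp_decreasing_open[where f = "\<lambda>t. \<Phi> t * exp (- (2 * K) * t)"])
    show "0 \<le> s" using s by auto
    show "\<exists>y. ((\<lambda>t. \<Phi> t * exp (- (2 * K) * t)) has_real_derivative y) (at t) \<and> y \<le> 0"
      if t: "0 < t" "t < s" for t
    proof -
      have t': "t \<in> {0..\<tau>}" "at t within {0..\<tau>} = at t"
        using s t by (auto simp: at_within_Icc_at)
      show ?thesis
        using d[OF t'(1)] slope[OF t'(1)] unfolding t'(2)
        by (intro exI conjI) (assumption, simp add: mult_nonpos_nonneg)
    qed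
    have "continuous_on {0..\<tau>} (\<lambda>t. \<Phi> t * exp (- (2 * K) * t))"
      by (rule DERIV_continuous_on[OF d])
    then show "continuous_on {0..s} (\<lambda>t. \<Phi> t * exp (- (2 * K) * t))"
      by (rule continuous_on_subset) (use s in auto)
  qed
  then have "\<Phi> s \<le> exp (2 * K * s) * \<Phi> 0"
    by (simp add: exp_minus field_simps)
  also have "\<dots> \<le> exp (2 * K * \<tau>) * \<Phi> 0"
    using s lower[of 0] energy_nonneg[of 0] \<open>0 \<le> K\<close>
    by (intro mult_right_mono) (auto intro!: mult_left_mono)
  also have "\<Phi> 0 \<le> (1 + 2 * B1 + 4 * B1\<^sup>2) * energy 0"
  proof -
    have 0: "0 \<in> {0..\<tau>}" using s by auto
    have "\<bar>l 0 * l' 0 * momentum 1 0 0\<bar> \<le> B1 * (2 * energy 0)"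
      unfolding abs_mult[of "l 0 * l' 0"] by (intro mult_mono B1 J1 0) (auto simp: pos)
    moreover have "B1\<^sup>2 * mass 0 \<le> B1\<^sup>2 * (4 * energy 0)"
      by (intro mult_left_mono mass_le_energy 0) auto
    ultimately show ?thesis unfolding \<Phi>_def by (simp add: algebra_simps)
  qed
  finally have "\<Phi> s \<le> exp (2 * K * \<tau>) * ((1 + 2 * B1 + 4 * B1\<^sup>2) * energy 0)"
    by simp
  then have "energy s \<le> 2 * (exp (2 * K * \<tau>) * ((1 + 2 * B1 + 4 * B1\<^sup>2) * energy 0))"
    using lower[OF s] by linarith
  then show ?thesis
    by (simp only: K_def mult.assoc)
qed

text \<open>The weight \<open>2 y - 1\<close> is \<open>1\<close> at the right end and \<open>-1\<close> at the left end, so both fluxes enter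
  the derivative of the momentum with a plus sign.\<close>

lemma flux_estimate:
  assumes "\<tau> > 0"
    and l_nz: "\<And>t. t \<in> {0..\<tau>} \<Longrightarrow> l t \<noteq> 0" and l: "continuous_on {0..\<tau>} l"
    and b: "\<And>t. t \<in> {0..\<tau>} \<Longrightarrow> \<bar>l' t / l t\<bar> \<le> b"
    and A: "\<And>t. t \<in> {0..\<tau>} \<Longrightarrow> 1 / (l t)\<^sup>2 \<le> A"
    and E: "\<And>t. t \<in> {0..\<tau>} \<Longrightarrow> energy t \<le> E"
  shows "(LINT t|leb 0 \<tau>. (cmod (trace_at 0 1 (wy t) 0 / of_real (l t)))\<^sup>2)
      + (LINT t|leb 0 \<tau>. (cmod (trace_at 0 1 (wy t) 1 / of_real (l t)))\<^sup>2) \<le> (4 + 4 * (A + b) * \<tau>) * E"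
proof -
  define g where "g t = (flux0 t + flux1 t) / (l t)\<^sup>2" for t
  \<comment> \<open>The derivative of the momentum with weight \<open>2 y - 1\<close>.\<close>
  define X' where "X' t = (flux0 t + flux1 t - 4 * energy t) / (l t)\<^sup>2 - 2 * (l' t / l t) * momentum 1 0 t" for t
  have 0: "0 \<in> {0..\<tau>}" and T: "\<tau> \<in> {0..\<tau>}" using \<open>\<tau> > 0\<close> by auto
  have pos: "0 \<le> b" "0 \<le> A" "0 \<le> E"
  proof -
    show "0 \<le> b" using b[OF 0] by linarith
    have "0 \<le> 1 / (l 0)\<^sup>2" by simp
    then show "0 \<le> A" using A[OF 0] by linarith
    show "0 \<le> E" using E[OF 0] energy_nonneg[of 0] by linarith
  qed
  have cont: "continuous_on {0..\<tau>} (\<lambda>t. trace_at 0 1 (wy t) p / of_real (l t))" if "p \<in> {0, 1}" for p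
    using l_nz by (intro continuous_intros continuous_trace_wy that l) auto
  note L2 = L2_integrable_norm_sq[OF L2_continuous[OF cont]]
  have sq: "(cmod (trace_at 0 1 (wy t) 0 / of_real (l t)))\<^sup>2 + (cmod (trace_at 0 1 (wy t) 1 / of_real (l t)))\<^sup>2 = g t" for t
    by (simp add: g_def flux0_def flux1_def norm_divide power_divide add_divide_distrib)
  have gi: "integrable (leb 0 \<tau>) g"
    using Bochner_Integration.integrable_add[OF L2[of 0] L2[of 1]] by (simp add: sq)
  have "(LINT t|leb 0 \<tau>. (cmod (trace_at 0 1 (wy t) 0 / of_real (l t)))\<^sup>2)
      + (LINT t|leb 0 \<tau>. (cmod (trace_at 0 1 (wy t) 1 / of_real (l t)))\<^sup>2) = (LINT t|leb 0 \<tau>. g t)"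
    using Bochner_Integration.integral_add[OF L2[of 0] L2[of 1]] by (simp add: sq)
  also have "\<dots> = integral {0..\<tau>} g"
    using lebesgue_integral_eq_integral[OF gi] by (simp add: integral_open_interval_real)
  also have "\<dots> \<le> momentum 2 (-1) \<tau> - momentum 2 (-1) 0 + 4 * (A + b) * E * \<tau>"
  proof (rule has_integral_le)
    have "g integrable_on {0<..<\<tau>}"
      by (rule integrable_on_lebesgue_on[OF gi]) auto
    then show "(g has_integral integral {0..\<tau>} g) {0..\<tau>}"
      by (simp add: integrable_integral integrable_on_open_interval_real)
    have "(momentum 2 (-1) has_vector_derivative X' t) (at t within {0..\<tau>})" if "t \<in> {0..\<tau>}" for t
      using momentum_has_derivative[OF that, of 2 "-1"]
      by (simp add: X'_def has_real_derivative_iff_has_vector_derivative add.commute)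
    then have "(X' has_integral (momentum 2 (-1) \<tau> - momentum 2 (-1) 0)) {0..\<tau>}"
      using \<open>\<tau> > 0\<close> by (intro fundamental_theorem_of_calculus) auto
    moreover have "((\<lambda>t. 4 * (A + b) * E) has_integral 4 * (A + b) * E * \<tau>) {0..\<tau>}"
      using has_integral_const_real[of "4 * (A + b) * E" 0 \<tau>] \<open>\<tau> > 0\<close> by (simp add: mult.commute)
    ultimately show "((\<lambda>t. X' t + 4 * (A + b) * E) has_integral
        momentum 2 (-1) \<tau> - momentum 2 (-1) 0 + 4 * (A + b) * E * \<tau>) {0..\<tau>}"
      by (rule has_integral_add)
    fix t assume t: "t \<in> {0..\<tau>}"
    have "1 / (l t)\<^sup>2 * energy t \<le> A * E"
      by (intro mult_mono A E t energy_nonneg pos)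
    moreover have "\<bar>l' t / l t * momentum 1 0 t\<bar> \<le> b * (2 * E)"
      unfolding abs_mult[of "l' t / l t"]
      using momentum_le_energy[OF t, of 1 0] E[OF t] by (intro mult_mono b t pos) auto
    moreover have "g t = X' t + 4 * (1 / (l t)\<^sup>2 * energy t) + 2 * (l' t / l t * momentum 1 0 t)"
      by (simp add: g_def X'_def diff_divide_distrib)
    moreover have "4 * (A + b) * E = 4 * (A * E) + 2 * (b * (2 * E))"
      by (simp add: algebra_simps)
    ultimately show "g t \<le> X' t + 4 * (A + b) * E"
      by linarith
  qed
  also have "\<dots> \<le> 2 * E + 2 * E + 4 * (A + b) * E * \<tau>"
  proof -
    have q: "\<bar>2 * x + - 1\<bar> \<le> 1" if "x \<in> {0<..<1}" for x :: real
      using that by auto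
    show ?thesis
      using momentum_le_energy[OF T q] momentum_le_energy[OF 0 q] E[OF T] E[OF 0] by linarith
  qed
  finally show ?thesis by (simp add: algebra_simps)
qed

end

lemma classical_flux_bound:
  fixes \<tau> :: real and l l' l'' :: "real \<Rightarrow> real"
  assumes "\<tau> > 0"
    and l_pos: "\<And>t. t \<in> {0..\<tau>} \<Longrightarrow> l t > 0"
    and l: "\<And>t. t \<in> {0..\<tau>} \<Longrightarrow> (l has_real_derivative l' t) (at t within {0..\<tau>})"
    and l': "\<And>t. t \<in> {0..\<tau>} \<Longrightarrow> (l' has_real_derivative l'' t) (at t within {0..\<tau>})"
    and l'': "continuous_on {0..\<tau>} l''"
  obtains C where "C \<ge> 0" "\<And>w. classical_solution \<tau> l l' 0 w \<Longrightarrow>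
      (L2norm 0 \<tau> (\<lambda>t. trace_at 0 1 (weak_deriv 0 1 (w t)) 0 / of_real (l t)))\<^sup>2
      + (L2norm 0 \<tau> (\<lambda>t. trace_at 0 1 (weak_deriv 0 1 (w t)) 1 / of_real (l t)))\<^sup>2
      \<le> C * (L2norm 0 1 (weak_deriv 0 1 (w 0)))\<^sup>2"
proof -
  have bounded: "\<exists>K. \<forall>t\<in>{0..\<tau>}. \<bar>f t\<bar> \<le> K" if "continuous_on {0..\<tau>} f" for f :: "real \<Rightarrow> real"
    using compact_imp_bounded[OF compact_continuous_image[OF that compact_Icc]]
    by (auto simp: bounded_iff)
  have cl: "continuous_on {0..\<tau>} l" and cl': "continuous_on {0..\<tau>} l'"
    using DERIV_continuous_on l l' by blast+
  have l_nz: "l t \<noteq> 0" if "t \<in> {0..\<tau>}" for t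
    using l_pos[OF that] by simp
  obtain b where b: "\<And>t. t \<in> {0..\<tau>} \<Longrightarrow> \<bar>l' t / l t\<bar> \<le> b"
    using bounded[OF continuous_on_divide[OF cl' cl]] l_nz by blast
  obtain B1 where B1: "\<And>t. t \<in> {0..\<tau>} \<Longrightarrow> \<bar>l t * l' t\<bar> \<le> B1"
    using bounded[OF continuous_on_mult[OF cl cl']] by blast
  obtain B2 where B2: "\<And>t. t \<in> {0..\<tau>} \<Longrightarrow> \<bar>l t * l'' t\<bar> \<le> B2"
    using bounded[OF continuous_on_mult[OF cl l'']] by blast
  obtain A where A: "\<And>t. t \<in> {0..\<tau>} \<Longrightarrow> \<bar>1 / (l t)\<^sup>2\<bar> \<le> A"
    using bounded[OF continuous_on_divide[OF continuous_on_const continuous_on_power[OF cl]], of 2 1] l_nz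
    by (metis power_not_zero)
  define G where "G = 2 * exp (2 * (b + 2 * B2 + 4 * B1\<^sup>2 * b) * \<tau>) * (1 + 2 * B1 + 4 * B1\<^sup>2)"
  define C where "C = (4 + 4 * (A + b) * \<tau>) * G"
  have 0: "0 \<in> {0..\<tau>}" using \<open>\<tau> > 0\<close> by auto
  have "0 \<le> b" "0 \<le> B1" "0 \<le> A"
    using b[OF 0] B1[OF 0] A[OF 0] by (meson abs_ge_zero order_trans)+
  then have "C \<ge> 0"
    using \<open>\<tau> > 0\<close> unfolding C_def G_def by (intro mult_nonneg_nonneg add_nonneg_nonneg) auto
  moreover have "(L2norm 0 \<tau> (\<lambda>t. trace_at 0 1 (weak_deriv 0 1 (w t)) 0 / of_real (l t)))\<^sup>2
      + (L2norm 0 \<tau> (\<lambda>t. trace_at 0 1 (weak_deriv 0 1 (w t)) 1 / of_real (l t)))\<^sup>2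
      \<le> C * (L2norm 0 1 (weak_deriv 0 1 (w 0)))\<^sup>2" if "classical_solution \<tau> l l' 0 w" for w
  proof -
    interpret classical_moving_solution \<tau> l l' w by unfold_locales (rule that)
    have "energy t \<le> G * energy 0" if "t \<in> {0..\<tau>}" for t
      unfolding G_def by (rule energy_growth[OF l_nz l l' b B1 B2 that])
    from flux_estimate[OF \<open>\<tau> > 0\<close> l_nz cl b _ this, of A] A
    show ?thesis
      unfolding L2norm_sq C_def energy_def by (simp add: mult.assoc)
  qed
  ultimately show thesis using that by blast
qed

section \<open>Density of the domain\<close>

lemma L2norm_le_H1norm: "L2norm a b f \<le> H1norm a b f" "L2norm a b (weak_deriv a b f) \<le> H1norm a b f"
  unfolding H1norm_def by (auto intro!: real_le_rsqrt)

lemma H1norm_diff_le: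
  assumes f: "f \<in> H1 a b" and g: "g \<in> H1 a b"
  shows "H1norm a b (\<lambda>x. f x - g x) \<le> 2 * (H1norm a b f + H1norm a b g)"
proof -
  note df = has_weak_deriv_weak_deriv[OF f] and dg = has_weak_deriv_weak_deriv[OF g]
  have tri: "L2norm a b (\<lambda>x. u x - v x) \<le> L2norm a b u + L2norm a b v" if "u \<in> L2 a b" "v \<in> L2 a b" for u v
    using L2norm_triangle[OF that(1) L2_cmult[OF that(2)], of "-1"] L2norm_cmult[of a b "-1" v] by simp
  have "H1norm a b (\<lambda>x. f x - g x) \<le>
      L2norm a b (\<lambda>x. f x - g x) + L2norm a b (\<lambda>x. weak_deriv a b f x - weak_deriv a b g x)"
    unfolding H1norm_def L2norm_weak_deriv[OF has_weak_deriv_diff[OF df dg]]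
    by (rule sqrt_sum_squares_le_sum) auto
  also have "\<dots> \<le> 2 * (H1norm a b f + H1norm a b g)"
    using tri[OF has_weak_deriv_L2(1)[OF df] has_weak_deriv_L2(1)[OF dg]]
      tri[OF has_weak_deriv_L2(2)[OF df] has_weak_deriv_L2(2)[OF dg]]
      L2norm_le_H1norm[of a b f] L2norm_le_H1norm[of a b g] by simp
  finally show ?thesis .
qed

lemma H1_diff: "f \<in> H1 a b \<Longrightarrow> g \<in> H1 a b \<Longrightarrow> (\<lambda>x. f x - g x) \<in> H1 a b"
  by (rule has_weak_deriv_H1[OF has_weak_deriv_diff[OF has_weak_deriv_weak_deriv has_weak_deriv_weak_deriv]])

text \<open>The definition of \<open>H2\<close> refers to a chosen weak derivative; any other one serves as well.\<close>

lemma H2I: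
  assumes "has_weak_deriv a b f f'" "has_weak_deriv a b f' f''"
  shows "f \<in> H2 a b"
proof -
  have "f \<in> H1 a b" by (rule has_weak_deriv_H1[OF assms(1)])
  moreover have "AE x in leb a b. f' x = weak_deriv a b f x"
    using weak_deriv_AE_eq[OF assms(1)] by eventually_elim simp
  ultimately show ?thesis
    unfolding H2_def
    using has_weak_deriv_H1[OF has_weak_deriv_cong[OF assms(2)]]
      has_weak_deriv_L2(2)[OF has_weak_deriv_weak_deriv] by blast
qed

lemma test_functions_H1: "a \<le> b \<Longrightarrow> \<phi> \<in> test_functions a b \<Longrightarrow> \<phi> \<in> H1 a b"
  using test_function_has_weak_deriv has_weak_deriv_H1 by metis

lemma test_functions_H01:
  assumes "a \<le> b" "\<phi> \<in> test_functions a b"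
  shows "\<phi> \<in> H01 a b"
proof -
  have "has_weak_deriv a b (\<lambda>x. 0) (\<lambda>x. 0)"
    using has_weak_deriv_cmult[OF has_weak_deriv_weak_deriv[OF test_functions_H1[OF assms]], of 0] by simp
  then have "L2norm a b (weak_deriv a b (\<lambda>x. 0)) = L2norm a b (\<lambda>x. 0)"
    by (rule L2norm_weak_deriv)
  moreover have "L2norm a b (\<lambda>x. 0) = 0"
    by (simp add: L2norm_def)
  ultimately have "H1norm a b (\<lambda>x. \<phi> x - \<phi> x) = 0"
    by (simp add: H1norm_def)
  then have "\<exists>\<psi>\<in>test_functions a b. H1norm a b (\<lambda>x. \<phi> x - \<psi> x) < \<epsilon>" if "\<epsilon> > 0" for \<epsilon>
    using assms(2) that by (intro bexI[of _ \<phi>]) simp_all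
  then show ?thesis
    using test_functions_H1[OF assms] by (simp add: H01_def)
qed

lemma H01_diff:
  assumes "a \<le> b" and f: "f \<in> H01 a b" and g: "g \<in> H01 a b"
  shows "(\<lambda>x. f x - g x) \<in> H01 a b"
  unfolding H01_def
proof (intro CollectI conjI allI impI)
  show "(\<lambda>x. f x - g x) \<in> H1 a b"
    by (intro H1_diff H01_H1 f g)
  fix \<epsilon> :: real assume "\<epsilon> > 0"
  then have "\<epsilon> / 4 > 0" by simp
  then obtain \<phi> \<psi> where \<phi>: "\<phi> \<in> test_functions a b" "H1norm a b (\<lambda>x. f x - \<phi> x) < \<epsilon> / 4"
    and \<psi>: "\<psi> \<in> test_functions a b" "H1norm a b (\<lambda>x. g x - \<psi> x) < \<epsilon> / 4"
    using f g unfolding H01_def by blast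
  have "H1norm a b (\<lambda>x. (f x - \<phi> x) - (g x - \<psi> x)) \<le>
      2 * (H1norm a b (\<lambda>x. f x - \<phi> x) + H1norm a b (\<lambda>x. g x - \<psi> x))"
    by (intro H1norm_diff_le H1_diff H01_H1 f g test_functions_H1 \<phi> \<psi> \<open>a \<le> b\<close>)
  also have "\<dots> < \<epsilon>" using \<phi>(2) \<psi>(2) by simp
  finally have "H1norm a b (\<lambda>x. (f x - g x) - (\<phi> x - \<psi> x)) < \<epsilon>"
    by (simp add: algebra_simps)
  then show "\<exists>\<rho>\<in>test_functions a b. H1norm a b (\<lambda>x. (f x - g x) - \<rho> x) < \<epsilon>"
    by (intro bexI[of _ "\<lambda>x. \<phi> x - \<psi> x"] test_functions_diff \<phi> \<psi>)
qed

lemma dom_A_diff: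
  assumes "f \<in> dom_A" "g \<in> dom_A"
  shows "(\<lambda>x. f x - g x) \<in> dom_A"
  unfolding dom_A_def
proof
  show "(\<lambda>x. f x - g x) \<in> H2 0 1"
    by (rule H2I[OF has_weak_deriv_diff[OF dom_A_derivs(1) dom_A_derivs(1)]
          has_weak_deriv_diff[OF dom_A_derivs(2) dom_A_derivs(2)]]) (fact assms)+
  show "(\<lambda>x. f x - g x) \<in> H01 0 1"
    using assms by (intro H01_diff) (auto simp: dom_A_def)
qed

lemma test_functions_dom_A:
  assumes "\<phi> \<in> test_functions 0 1"
  shows "\<phi> \<in> dom_A"
proof -
  obtain \<phi>' where \<phi>': "\<phi>' \<in> test_functions 0 1" "has_weak_deriv 0 1 \<phi> \<phi>'"
    using test_function_has_weak_deriv[OF _ assms] by auto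
  obtain \<phi>'' where "has_weak_deriv 0 1 \<phi>' \<phi>''"
    using test_function_has_weak_deriv[OF _ \<phi>'(1)] by auto
  then show ?thesis
    using H2I[OF \<phi>'(2)] test_functions_H01[OF _ assms] by (simp add: dom_A_def)
qed

lemma dom_A_H1: "f \<in> dom_A \<Longrightarrow> f \<in> H1 0 1"
  by (simp add: dom_A_def H2_def)

lemma dom_A_L2: "f \<in> dom_A \<Longrightarrow> f \<in> L2 0 1"
  by (rule has_weak_deriv_L2(1)[OF has_weak_deriv_weak_deriv[OF dom_A_H1]])

lemma H01norm_diff:
  assumes "f \<in> H1 0 1" "g \<in> H1 0 1"
  shows "H01norm 0 1 (\<lambda>x. f x - g x) = L2norm 0 1 (\<lambda>x. weak_deriv 0 1 f x - weak_deriv 0 1 g x)"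
  unfolding H01norm_def
  by (rule L2norm_weak_deriv[OF has_weak_deriv_diff[OF has_weak_deriv_weak_deriv has_weak_deriv_weak_deriv]])
     (fact assms)+

lemma H01norm_diff_triangle:
  assumes "f \<in> H1 0 1" "g \<in> H1 0 1" "h \<in> H1 0 1"
  shows "H01norm 0 1 (\<lambda>x. f x - g x) \<le> H01norm 0 1 (\<lambda>x. f x - h x) + H01norm 0 1 (\<lambda>x. g x - h x)"
  using L2norm_triangle_diff3[of "weak_deriv 0 1 f" 0 1 "weak_deriv 0 1 h" "weak_deriv 0 1 g"]
    L2norm_minus_commute[of 0 1 "weak_deriv 0 1 g" "weak_deriv 0 1 h"]
    has_weak_deriv_L2(2)[OF has_weak_deriv_weak_deriv] assms
  by (simp add: H01norm_diff)

lemma dom_A_dense: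
  assumes u0: "u0 \<in> H01 0 1"
  obtains v where "\<And>n::nat. v n \<in> dom_A" "(\<lambda>n. H01norm 0 1 (\<lambda>y. v n y - u0 y)) \<longlonglongrightarrow> 0"
proof -
  have "\<exists>\<phi>\<in>test_functions 0 1. H1norm 0 1 (\<lambda>x. u0 x - \<phi> x) < inverse (real (Suc n))" for n
    using u0 unfolding H01_def by simp
  then obtain v where v: "\<And>n. v n \<in> test_functions 0 1"
    "\<And>n. H1norm 0 1 (\<lambda>x. u0 x - v n x) < inverse (real (Suc n))"
    by metis
  have "norm (H01norm 0 1 (\<lambda>y. v n y - u0 y)) \<le> inverse (real (Suc n))" for n
  proof -
    have "H01norm 0 1 (\<lambda>y. v n y - u0 y) = H01norm 0 1 (\<lambda>y. u0 y - v n y)"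
      using H01norm_diff[OF test_functions_H1[OF _ v(1)[of n]] H01_H1[OF u0]]
        H01norm_diff[OF H01_H1[OF u0] test_functions_H1[OF _ v(1)[of n]]]
        L2norm_minus_commute by simp
    also have "\<dots> \<le> inverse (real (Suc n))"
      using L2norm_le_H1norm(2)[of 0 1 "\<lambda>y. u0 y - v n y"] v(2)[of n] by (simp add: H01norm_def)
    finally show ?thesis by (simp add: H01norm_def)
  qed
  then have "(\<lambda>n. H01norm 0 1 (\<lambda>y. v n y - u0 y)) \<longlonglongrightarrow> 0"
    by (intro Lim_null_comparison[OF _ LIMSEQ_inverse_real_of_nat] always_eventually allI)
  then show thesis
    using that test_functions_dom_A[OF v(1)] by blast
qed

section \<open>Boundary traces\<close>

lemma generates_classical_solution:
  assumes "generates_evolution_family \<tau> l l' U" "0 \<le> \<tau>" "f \<in> dom_A"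
  shows "classical_solution \<tau> l l' 0 (\<lambda>t. U t 0 f)"
  using assms by (auto simp: generates_evolution_family_def)

lemma generates_initial_norm:
  assumes gen: "generates_evolution_family \<tau> l l' U" and "0 \<le> \<tau>" and f: "f \<in> dom_A"
  shows "L2norm 0 1 (weak_deriv 0 1 (U 0 0 f)) = H01norm 0 1 f"
proof -
  have "AE y in leb 0 1. U 0 0 f y = f y"
    using gen \<open>0 \<le> \<tau>\<close> dom_A_L2[OF f] by (auto simp: generates_evolution_family_def evolution_family_def)
  then have "AE y in leb 0 1. f y = U 0 0 f y"
    by eventually_elim simp
  moreover have "U 0 0 f \<in> dom_A"
    using generates_classical_solution[OF assms] \<open>0 \<le> \<tau>\<close> by (auto simp: classical_solution_def)
  ultimately have "has_weak_deriv 0 1 (U 0 0 f) (weak_deriv 0 1 f)"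
    using has_weak_deriv_cong[OF has_weak_deriv_weak_deriv[OF dom_A_H1[OF f]]] dom_A_L2 by blast
  then show ?thesis by (simp add: L2norm_weak_deriv H01norm_def)
qed

lemma generates_diff:
  assumes gen: "generates_evolution_family \<tau> l l' U" and t: "t \<in> {0..\<tau>}"
    and f: "f \<in> L2 0 1" and g: "g \<in> L2 0 1"
  shows "AE y in leb 0 1. U t 0 (\<lambda>x. f x - g x) y = U t 0 f y - U t 0 g y"
proof -
  have lin: "bounded_operator_L2 (U t 0)"
    using gen t by (auto simp: generates_evolution_family_def evolution_family_def)
  then have add: "\<forall>f\<in>L2 0 1. \<forall>g\<in>L2 0 1. AE y in leb 0 1. U t 0 (\<lambda>x. f x + g x) y = U t 0 f y + U t 0 g y"
    and scale: "\<forall>c. \<forall>f\<in>L2 0 1. AE y in leb 0 1. U t 0 (\<lambda>x. c * f x) y = c * U t 0 f y"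
    by (auto simp: bounded_operator_L2_def)
  have "AE y in leb 0 1. U t 0 (\<lambda>x. f x + (-1) * g x) y = U t 0 f y + U t 0 (\<lambda>x. (-1) * g x) y"
    using add[rule_format, OF f L2_cmult[OF g, of "-1"]] .
  moreover have "AE y in leb 0 1. U t 0 (\<lambda>x. (-1) * g x) y = (-1) * U t 0 g y"
    using scale[rule_format, OF g, of "-1"] .
  ultimately have "AE y in leb 0 1. U t 0 (\<lambda>x. f x + (-1) * g x) y = U t 0 f y - U t 0 g y"
    by eventually_elim simp
  then show ?thesis by simp
qed

text \<open>Both ends are treated at once: \<open>p\<close> is the end point \<open>0\<close> or \<open>1\<close> of the fixed interval, and
  \<open>P t = l t * p\<close> is the corresponding boundary curve.\<close>

locale boundary_trace =
  fixes \<tau> :: real and l l' :: "real \<Rightarrow> real"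
    and U :: "real \<Rightarrow> real \<Rightarrow> (real \<Rightarrow> complex) \<Rightarrow> real \<Rightarrow> complex" and C :: real
    and P :: "real \<Rightarrow> real" and p :: real
  assumes \<tau>: "\<tau> > 0"
    and l_pos: "\<And>t. t \<in> {0..\<tau>} \<Longrightarrow> l t > 0"
    and l_cont: "continuous_on {0..\<tau>} l"
    and gen: "generates_evolution_family \<tau> l l' U"
    and C: "C \<ge> 0" "\<And>w. classical_solution \<tau> l l' 0 w \<Longrightarrow>
      (L2norm 0 \<tau> (\<lambda>t. trace_at 0 1 (weak_deriv 0 1 (w t)) p / of_real (l t)))\<^sup>2
      \<le> C * (L2norm 0 1 (weak_deriv 0 1 (w 0)))\<^sup>2"
    and P: "\<And>t. P t = l t * p" and p: "p \<in> {0, 1}"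
begin

lemma solution: "f \<in> dom_A \<Longrightarrow> classical_solution \<tau> l l' 0 (\<lambda>t. U t 0 f)"
  using generates_classical_solution[OF gen] \<tau> by simp

lemma solution_dom_A: "f \<in> dom_A \<Longrightarrow> t \<in> {0..\<tau>} \<Longrightarrow> U t 0 f \<in> dom_A"
  using solution by (auto simp: classical_solution_def)

lemma classical_trace_x_eq:
  assumes f: "f \<in> dom_A" and t: "t \<in> {0..\<tau>}"
  shows "classical_trace_x l U P f t = trace_at 0 1 (weak_deriv 0 1 (U t 0 f)) p / of_real (l t)"
  unfolding classical_trace_x_def moving_solution_def P
  using trace_at_weak_deriv_dilation[OF l_pos[OF t] dom_A_derivs(1,2)[OF solution_dom_A[OF f t]], of p] p
  by auto

lemma classical_trace_x_L2:
  assumes f: "f \<in> dom_A"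
  shows "classical_trace_x l U P f \<in> L2 0 \<tau>"
proof -
  interpret classical_moving_solution \<tau> l l' "\<lambda>t. U t 0 f"
    by unfold_locales (rule solution[OF f])
  have "continuous_on {0..\<tau>} (\<lambda>t. trace_at 0 1 (weak_deriv 0 1 (U t 0 f)) p / of_real (l t))"
    using l_pos by (intro continuous_intros continuous_trace_wy p l_cont) force
  then have "continuous_on {0..\<tau>} (classical_trace_x l U P f)"
    by (rule continuous_on_eq) (rule classical_trace_x_eq[OF f, symmetric])
  then show ?thesis by (rule L2_continuous)
qed

lemma classical_trace_x_bound:
  assumes f: "f \<in> dom_A"
  shows "L2norm 0 \<tau> (classical_trace_x l U P f) \<le> sqrt C * H01norm 0 1 f"
proof -
  have "L2norm 0 \<tau> (classical_trace_x l U P f) =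
      L2norm 0 \<tau> (\<lambda>t. trace_at 0 1 (weak_deriv 0 1 (U t 0 f)) p / of_real (l t))"
    unfolding L2norm_def
    by (intro arg_cong[where f = sqrt] Bochner_Integration.integral_cong) (auto simp: classical_trace_x_eq[OF f])
  then have "(L2norm 0 \<tau> (classical_trace_x l U P f))\<^sup>2 \<le> C * (H01norm 0 1 f)\<^sup>2"
    using C(2)[OF solution[OF f]] generates_initial_norm[OF gen _ f] \<tau> by simp
  also have "\<dots> = (sqrt C * H01norm 0 1 f)\<^sup>2"
    using C(1) by (simp add: power_mult_distrib)
  finally show ?thesis
    by (rule power2_le_imp_le) (simp add: C(1) H01norm_def)
qed

lemma classical_trace_x_diff:
  assumes f: "f \<in> dom_A" and g: "g \<in> dom_A" and t: "t \<in> {0..\<tau>}"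
  shows "classical_trace_x l U P (\<lambda>x. f x - g x) t = classical_trace_x l U P f t - classical_trace_x l U P g t"
proof -
  note fg = dom_A_diff[OF f g]
  note df = dom_A_derivs[OF solution_dom_A[OF f t]] and dg = dom_A_derivs[OF solution_dom_A[OF g t]]
    and dfg = dom_A_derivs[OF solution_dom_A[OF fg t]]
  have "has_weak_deriv 0 1 (\<lambda>y. U t 0 f y - U t 0 g y) (weak_deriv 0 1 (U t 0 (\<lambda>x. f x - g x)))"
    using generates_diff[OF gen t dom_A_L2[OF f] dom_A_L2[OF g]] has_weak_deriv_L2(1)[OF df(1)] has_weak_deriv_L2(1)[OF dg(1)]
    by (intro has_weak_deriv_cong[OF dfg(1)] L2_diff)
  from has_weak_deriv_unique[OF this has_weak_deriv_diff[OF df(1) dg(1)]]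
  have "trace_at 0 1 (weak_deriv 0 1 (U t 0 (\<lambda>x. f x - g x))) p =
      trace_at 0 1 (\<lambda>y. weak_deriv 0 1 (U t 0 f) y - weak_deriv 0 1 (U t 0 g) y) p"
    by (rule trace_at_cong)
  also have "\<dots> = trace_at 0 1 (weak_deriv 0 1 (U t 0 f)) p - trace_at 0 1 (weak_deriv 0 1 (U t 0 g)) p"
    using p by (intro trace_at_diff[OF _ df(2) dg(2)]) auto
  finally show ?thesis
    unfolding classical_trace_x_eq[OF f t] classical_trace_x_eq[OF g t] classical_trace_x_eq[OF fg t]
    by (simp add: diff_divide_distrib)
qed

text \<open>The evolution family is linear only almost everywhere in \<open>y\<close>, which is enough because traces do
  not see null sets; so the bound for one solution bounds differences.\<close>

lemma classical_trace_x_Lipschitz: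
  assumes f: "f \<in> dom_A" and g: "g \<in> dom_A"
  shows "L2norm 0 \<tau> (\<lambda>t. classical_trace_x l U P f t - classical_trace_x l U P g t)
      \<le> sqrt C * H01norm 0 1 (\<lambda>x. f x - g x)"
proof -
  have "L2norm 0 \<tau> (\<lambda>t. classical_trace_x l U P f t - classical_trace_x l U P g t) =
      L2norm 0 \<tau> (classical_trace_x l U P (\<lambda>x. f x - g x))"
    unfolding L2norm_def
    by (intro arg_cong[where f = sqrt] Bochner_Integration.integral_cong)
       (auto simp: classical_trace_x_diff[OF f g])
  also have "\<dots> \<le> sqrt C * H01norm 0 1 (\<lambda>x. f x - g x)"
    by (rule classical_trace_x_bound[OF dom_A_diff[OF f g]])
  finally show ?thesis .
qed

lemma classical_trace_x_diff_tendsto: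
  assumes u0: "u0 \<in> H01 0 1"
    and v: "\<And>n::nat. v n \<in> dom_A" "(\<lambda>n. H01norm 0 1 (\<lambda>y. v n y - u0 y)) \<longlonglongrightarrow> 0"
    and v': "\<And>n::nat. v' n \<in> dom_A" "(\<lambda>n. H01norm 0 1 (\<lambda>y. v' n y - u0 y)) \<longlonglongrightarrow> 0"
  shows "(\<lambda>n. L2norm 0 \<tau> (\<lambda>t. classical_trace_x l U P (v n) t - classical_trace_x l U P (v' n) t)) \<longlonglongrightarrow> 0"
proof (rule Lim_null_comparison)
  show "(\<lambda>n. sqrt C * (H01norm 0 1 (\<lambda>y. v n y - u0 y) + H01norm 0 1 (\<lambda>y. v' n y - u0 y))) \<longlonglongrightarrow> 0"
    using tendsto_mult_right_zero[OF tendsto_add_zero[OF v(2) v'(2)]] .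
  show "\<forall>\<^sub>F n in sequentially. norm (L2norm 0 \<tau> (\<lambda>t. classical_trace_x l U P (v n) t - classical_trace_x l U P (v' n) t))
      \<le> sqrt C * (H01norm 0 1 (\<lambda>y. v n y - u0 y) + H01norm 0 1 (\<lambda>y. v' n y - u0 y))"
  proof (intro always_eventually allI)
    fix n
    have "sqrt C * H01norm 0 1 (\<lambda>x. v n x - v' n x) \<le>
        sqrt C * (H01norm 0 1 (\<lambda>y. v n y - u0 y) + H01norm 0 1 (\<lambda>y. v' n y - u0 y))"
      by (intro mult_left_mono H01norm_diff_triangle dom_A_H1 v v' H01_H1 u0) (simp add: C(1))
    then show "norm (L2norm 0 \<tau> (\<lambda>t. classical_trace_x l U P (v n) t - classical_trace_x l U P (v' n) t))
      \<le> sqrt C * (H01norm 0 1 (\<lambda>y. v n y - u0 y) + H01norm 0 1 (\<lambda>y. v' n y - u0 y))"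
      using classical_trace_x_Lipschitz[OF v(1) v'(1), of n n] by simp
  qed
qed

text \<open>The trace is the limit along one approximating sequence; any other such sequence has traces
  that come arbitrarily close to those of the first.\<close>

lemma is_trace_x_exists:
  assumes u0: "u0 \<in> H01 0 1"
  obtains g where "is_trace_x \<tau> l U P u0 g"
proof -
  obtain v where v: "\<And>n::nat. v n \<in> dom_A" "(\<lambda>n. H01norm 0 1 (\<lambda>y. v n y - u0 y)) \<longlonglongrightarrow> 0"
    using dom_A_dense[OF u0] by blast
  have "\<exists>g\<in>L2 0 \<tau>. (\<lambda>n. L2norm 0 \<tau> (\<lambda>t. classical_trace_x l U P (v n) t - g t)) \<longlonglongrightarrow> 0"
  proof (rule L2_complete)
    show "classical_trace_x l U P (v n) \<in> L2 0 \<tau>" for n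
      by (rule classical_trace_x_L2[OF v(1)])
    fix e :: real assume "e > 0"
    \<comment> \<open>The added \<open>1\<close> keeps the denominator positive when \<open>C = 0\<close>.\<close>
    define \<delta> where "\<delta> = e / (2 * (sqrt C + 1))"
    have "sqrt C + 1 > 0" using C(1) by (simp add: add_nonneg_pos)
    then have "\<delta> > 0" using \<open>e > 0\<close> by (simp add: \<delta>_def)
    then obtain N where N: "\<And>n. n \<ge> N \<Longrightarrow> H01norm 0 1 (\<lambda>y. v n y - u0 y) < \<delta>"
      using LIMSEQ_D[OF v(2)] by (force simp: H01norm_def)
    have "L2norm 0 \<tau> (\<lambda>t. classical_trace_x l U P (v i) t - classical_trace_x l U P (v j) t) < e"
      if "i \<ge> N" "j \<ge> N" for i j
    proof -
      have "L2norm 0 \<tau> (\<lambda>t. classical_trace_x l U P (v i) t - classical_trace_x l U P (v j) t)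
          \<le> sqrt C * (2 * \<delta>)"
      proof (rule order_trans[OF classical_trace_x_Lipschitz[OF v(1) v(1)]], rule mult_left_mono)
        show "H01norm 0 1 (\<lambda>x. v i x - v j x) \<le> 2 * \<delta>"
          using H01norm_diff_triangle[OF dom_A_H1[OF v(1)] dom_A_H1[OF v(1)] H01_H1[OF u0], of i j]
            N[OF that(1)] N[OF that(2)] by linarith
      qed (simp add: C(1))
      also have "\<dots> < (sqrt C + 1) * (2 * \<delta>)"
        using \<open>\<delta> > 0\<close> by (intro mult_strict_right_mono) auto
      also have "\<dots> = e" using \<open>sqrt C + 1 > 0\<close> by (simp add: \<delta>_def field_simps)
      finally show ?thesis .
    qed
    then show "\<exists>N. \<forall>i\<ge>N. \<forall>j\<ge>N.
        L2norm 0 \<tau> (\<lambda>t. classical_trace_x l U P (v i) t - classical_trace_x l U P (v j) t) < e"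
      by blast
  qed
  then obtain g where g: "g \<in> L2 0 \<tau>"
    "(\<lambda>n. L2norm 0 \<tau> (\<lambda>t. classical_trace_x l U P (v n) t - g t)) \<longlonglongrightarrow> 0"
    by blast
  have "(\<lambda>n. L2norm 0 \<tau> (\<lambda>t. classical_trace_x l U P (v' n) t - g t)) \<longlonglongrightarrow> 0"
    if v': "\<And>n::nat. v' n \<in> dom_A" "(\<lambda>n. H01norm 0 1 (\<lambda>y. v' n y - u0 y)) \<longlonglongrightarrow> 0" for v'
  proof (rule Lim_null_comparison[OF _ tendsto_add_zero[OF classical_trace_x_diff_tendsto[OF u0 v' v] g(2)]])
    show "\<forall>\<^sub>F n in sequentially. norm (L2norm 0 \<tau> (\<lambda>t. classical_trace_x l U P (v' n) t - g t)) \<le>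
        L2norm 0 \<tau> (\<lambda>t. classical_trace_x l U P (v' n) t - classical_trace_x l U P (v n) t) +
        L2norm 0 \<tau> (\<lambda>t. classical_trace_x l U P (v n) t - g t)"
      using L2norm_triangle_diff3[OF classical_trace_x_L2[OF v'(1)] classical_trace_x_L2[OF v(1)] g(1)]
      by (intro always_eventually) simp
  qed
  then have "is_trace_x \<tau> l U P u0 g"
    unfolding is_trace_x_def using g(1) classical_trace_x_L2 by blast
  then show thesis by (rule that)
qed

end

lemma H01norm_tendsto:
  assumes u0: "u0 \<in> H01 0 1"
    and v: "\<And>n::nat. v n \<in> dom_A" "(\<lambda>n. H01norm 0 1 (\<lambda>y. v n y - u0 y)) \<longlonglongrightarrow> 0"
  shows "(\<lambda>n. H01norm 0 1 (v n)) \<longlonglongrightarrow> H01norm 0 1 u0"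
  unfolding H01norm_def
proof (rule L2norm_tendsto)
  show "\<forall>\<^sub>F n in sequentially. weak_deriv 0 1 (v n) \<in> L2 0 1"
    by (intro always_eventually allI has_weak_deriv_L2(2)[OF has_weak_deriv_weak_deriv] dom_A_H1 v)
  show "weak_deriv 0 1 u0 \<in> L2 0 1"
    by (intro has_weak_deriv_L2(2)[OF has_weak_deriv_weak_deriv] H01_H1 u0)
  show "(\<lambda>n. L2norm 0 1 (\<lambda>x. weak_deriv 0 1 (v n) x - weak_deriv 0 1 u0 x)) \<longlonglongrightarrow> 0"
    using v(2) by (simp add: H01norm_diff[OF dom_A_H1[OF v(1)] H01_H1[OF u0]])
qed

lemma is_trace_x_norm_tendsto:
  assumes "is_trace_x \<tau> l U P u0 g"
    and v: "\<And>n::nat. v n \<in> dom_A" "(\<lambda>n. H01norm 0 1 (\<lambda>y. v n y - u0 y)) \<longlonglongrightarrow> 0"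
  shows "(\<lambda>n. L2norm 0 \<tau> (classical_trace_x l U P (v n))) \<longlonglongrightarrow> L2norm 0 \<tau> g"
  using assms unfolding is_trace_x_def by (intro L2norm_tendsto always_eventually) auto

theorem theorem2p1:
  fixes \<tau> :: real and l l' l'' :: "real \<Rightarrow> real"
  assumes "\<tau> > 0"
    and "\<And>t. t \<in> {0..\<tau>} \<Longrightarrow> l t > 0"
    and "\<And>t. t \<in> {0..\<tau>} \<Longrightarrow> (l has_real_derivative l' t) (at t within {0..\<tau>})"
    and "\<And>t. t \<in> {0..\<tau>} \<Longrightarrow> (l' has_real_derivative l'' t) (at t within {0..\<tau>})"
    and "continuous_on {0..\<tau>} l''"
    and "(\<lambda>t. l' t / l t) \<in> borel_measurable (leb 0 \<tau>)"
    and "\<exists>K. AE t in leb 0 \<tau>. \<bar>l' t / l t\<bar> \<le> K"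
    and "l 0 = 1"
  shows "\<exists>C :: real. \<forall>U. generates_evolution_family \<tau> l l' U \<longrightarrow>
    (\<forall>u0\<in>H01 0 1.
      (\<exists>g0 g1. is_trace_x \<tau> l U (\<lambda>t. 0) u0 g0 \<and> is_trace_x \<tau> l U l u0 g1) \<and>
      (\<forall>g0 g1. is_trace_x \<tau> l U (\<lambda>t. 0) u0 g0 \<and> is_trace_x \<tau> l U l u0 g1 \<longrightarrow>
        (LINT t|leb 0 \<tau>. (cmod (g0 t))\<^sup>2 + (cmod (g1 t))\<^sup>2) \<le> C * (H01norm 0 1 u0)\<^sup>2))"
proof -
  obtain C where C: "C \<ge> 0" "\<And>w. classical_solution \<tau> l l' 0 w \<Longrightarrow>
      (L2norm 0 \<tau> (\<lambda>t. trace_at 0 1 (weak_deriv 0 1 (w t)) 0 / of_real (l t)))\<^sup>2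
      + (L2norm 0 \<tau> (\<lambda>t. trace_at 0 1 (weak_deriv 0 1 (w t)) 1 / of_real (l t)))\<^sup>2
      \<le> C * (L2norm 0 1 (weak_deriv 0 1 (w 0)))\<^sup>2"
    using classical_flux_bound[OF assms(1-5)] by blast
  have l_cont: "continuous_on {0..\<tau>} l"
    using DERIV_continuous_on assms(3) by blast
  show ?thesis
  proof (rule exI[of _ C], intro allI impI ballI conjI)
    fix U u0 assume gen: "generates_evolution_family \<tau> l l' U" and u0: "u0 \<in> H01 0 1"
    have part: "(L2norm 0 \<tau> (\<lambda>t. trace_at 0 1 (weak_deriv 0 1 (w t)) p / of_real (l t)))\<^sup>2
      \<le> C * (L2norm 0 1 (weak_deriv 0 1 (w 0)))\<^sup>2" if "classical_solution \<tau> l l' 0 w" "p \<in> {0, 1}" for w p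
      using C(2)[OF that(1)] that(2)
        zero_le_power2[of "L2norm 0 \<tau> (\<lambda>t. trace_at 0 1 (weak_deriv 0 1 (w t)) 0 / of_real (l t))"]
        zero_le_power2[of "L2norm 0 \<tau> (\<lambda>t. trace_at 0 1 (weak_deriv 0 1 (w t)) 1 / of_real (l t))"]
      by (elim insertE emptyE) (hypsubst, linarith)+
    interpret left: boundary_trace \<tau> l l' U C "\<lambda>t. 0" 0
      by unfold_locales (use assms C(1) part gen l_cont in auto)
    interpret right: boundary_trace \<tau> l l' U C l 1
      by unfold_locales (use assms C(1) part gen l_cont in auto)
    obtain g0 where "is_trace_x \<tau> l U (\<lambda>t. 0) u0 g0"
      using left.is_trace_x_exists[OF u0] by blast
    moreover obtain g1 where "is_trace_x \<tau> l U l u0 g1"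
      using right.is_trace_x_exists[OF u0] by blast
    ultimately show "\<exists>g0 g1. is_trace_x \<tau> l U (\<lambda>t. 0) u0 g0 \<and> is_trace_x \<tau> l U l u0 g1"
      by blast
    fix g0 g1 assume g: "is_trace_x \<tau> l U (\<lambda>t. 0) u0 g0 \<and> is_trace_x \<tau> l U l u0 g1"
    obtain v where v: "\<And>n::nat. v n \<in> dom_A" "(\<lambda>n. H01norm 0 1 (\<lambda>y. v n y - u0 y)) \<longlonglongrightarrow> 0"
      using dom_A_dense[OF u0] by blast
    have bound: "(L2norm 0 \<tau> (classical_trace_x l U (\<lambda>t. 0) (v n)))\<^sup>2 + (L2norm 0 \<tau> (classical_trace_x l U l (v n)))\<^sup>2
        \<le> C * (H01norm 0 1 (v n))\<^sup>2" for n
    proof -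
      have "L2norm 0 \<tau> (classical_trace_x l U (\<lambda>t. 0) (v n)) =
          L2norm 0 \<tau> (\<lambda>t. trace_at 0 1 (weak_deriv 0 1 (U t 0 (v n))) 0 / of_real (l t))"
        "L2norm 0 \<tau> (classical_trace_x l U l (v n)) =
          L2norm 0 \<tau> (\<lambda>t. trace_at 0 1 (weak_deriv 0 1 (U t 0 (v n))) 1 / of_real (l t))"
        unfolding L2norm_def
        by (intro arg_cong[where f = sqrt] Bochner_Integration.integral_cong;
            auto simp: left.classical_trace_x_eq[OF v(1)] right.classical_trace_x_eq[OF v(1)])+
      then show ?thesis
        using C(2)[OF left.solution[OF v(1)[of n]]] generates_initial_norm[OF gen _ v(1)[of n]] assms(1) by simp
    qed
    have "(L2norm 0 \<tau> g0)\<^sup>2 + (L2norm 0 \<tau> g1)\<^sup>2 \<le> C * (H01norm 0 1 u0)\<^sup>2"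
    proof (rule LIMSEQ_le)
      show "(\<lambda>n. (L2norm 0 \<tau> (classical_trace_x l U (\<lambda>t. 0) (v n)))\<^sup>2 + (L2norm 0 \<tau> (classical_trace_x l U l (v n)))\<^sup>2)
          \<longlonglongrightarrow> (L2norm 0 \<tau> g0)\<^sup>2 + (L2norm 0 \<tau> g1)\<^sup>2"
        using g by (intro tendsto_intros is_trace_x_norm_tendsto[OF _ v]) auto
      show "(\<lambda>n. C * (H01norm 0 1 (v n))\<^sup>2) \<longlonglongrightarrow> C * (H01norm 0 1 u0)\<^sup>2"
        by (intro tendsto_intros H01norm_tendsto u0 v)
    qed (use bound in auto)
    moreover have "(LINT t|leb 0 \<tau>. (cmod (g0 t))\<^sup>2 + (cmod (g1 t))\<^sup>2) = (L2norm 0 \<tau> g0)\<^sup>2 + (L2norm 0 \<tau> g1)\<^sup>2"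
      using g unfolding L2norm_sq is_trace_x_def
      by (intro Bochner_Integration.integral_add L2_integrable_norm_sq) auto
    ultimately show "(LINT t|leb 0 \<tau>. (cmod (g0 t))\<^sup>2 + (cmod (g1 t))\<^sup>2) \<le> C * (H01norm 0 1 u0)\<^sup>2"
      by simp
  qed
qed

end
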